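(* Let $\mathcal{H}$ be a separable Hilbert space, $T>0$. Let $F\colon[0,T]\times\mathcal{H}\rightrightarrows\mathcal{H}$ have nonempty, closed, convex values and satisfy: (F1) for each $v$, $F(\cdot,v)$ is measurable; (F2) for a.e. $t$, $F(t,\cdot)$ is upper semicontinuous from $\mathcal{H}$ into $\mathcal{H}_w$; (F3) there exist integrable $c,d\colon[0,T]\to\mathbb{R}_+$ with $\inf\{\|w\|\colon w\in F(t,v)\}\le c(t)\|v\|+d(t)$ for all $v$ and a.e. $t$; (F4) there is an integrable $k\colon[0,T]\to\mathbb{R}_+$ with $\gamma(F(t,A))\le k(t)\gamma(A)$ for a.e. $t$ and all bounded $A\subset\mathcal{H}$, where $\gamma$ is either the Kuratowski or the Hausdorff measure of non-compactness. Let $g\colon[0,T]\times[0,T]\times\mathcal{H}\to\mathcal{H}$ satisfy: (g1) for each $v$, $(t,s)\mapsto g(t,s,v)$ is measurable; (g2) for every $r>0$ there is an integrable $\mu_r\colon[0,T]\to\mathbb{R}_+$ with $\|g(t,s,x)-g(t,s,y)\|\le\mu_r(t)\|x-y\|$ for all $(t,s)\in D:=\{(t,s)\in[0,T]^2\colon s\le t\}$ and $x,y\in r\mathbb{B}$; (g3) there is a nonnegative integrable $\sigma\colon D\to\mathbb{R}$ with $\|g(t,s,x)\|\le\sigma(t,s)(1+\|x\|)$ for all $(t,s)\in D$, $x\in\mathcal{H}$. Let $C\colon[0,T]\times\mathcal{H}\rightrightarrows\mathcal{H}$ have nonempty closed values and satisfy: (C1) there exist $\zeta\in\operatorname{AC}([0,T];\mathbb{R}_+)$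 and $L\in[0,1[$ such that $|d(z,C(t,x))-d(z,C(s,y))|\le|\zeta(t)-\zeta(s)|+L\|x-y\|$ for all $s,t\in[0,T]$ and $x,y,z\in\mathcal{H}$; (C2) the family $\{C(t,x)\colon(t,x)\in[0,T]\times\mathcal{H}\}$ is equi-uniformly subsmooth; (C3) for every $t\in[0,T]$, every $r>0$ and every bounded $A\subset\mathcal{H}$, the set $C(t,A)\cap r\mathbb{B}$ is relatively compact. Let $x_0\in C(0,x_0)$. Then the problem $$\dot x(t)\in-N(C(t,x(t));x(t))+F(t,x(t))+\int_0^tg(t,s,x(s))ds\ \text{ a.e. } t\in[0,T],\qquad x(0)=x_0,$$ admits at least one solution $x\in\operatorname{AC}([0,T];\mathcal{H})$.
   Context: $\mathbb{B}$ is the closed unit ball, $\mathcal{H}_w$ is $\mathcal{H}$ with the weak topology, $d(z,S)=\inf_{y\in S}\|z-y\|$, $C(t,A)=\bigcup_{a\in A}C(t,a)$. Kuratowski measure: $\alpha(A)=\inf\{d>0\colon A$ has a finite cover by sets of diameter $\le d\}$; Hausdorff measure: $\beta(A)=\inf\{r>0\colon A$ is covered by finitely many balls of radius $r\}$. Clarke tangent cone: $h\in T(S;x)$ iff for every sequence $x_n\in S$, $x_n\to x$, and every $t_n\downarrow0$, there exist $h_n\to h$ with $x_n+t_nh_n\in S$; Clarke normal cone $N(S;x)=\{v\colon\langle v,h\rangle\le0\ \forall h\in T(S;x)\}$ for $x\in S$, and $N(S;x)=\emptyset$ if $x\notin S$. A family $(S(i))_{i\in E}$ of closed sets is equi-uniformly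 subsmooth if for every $\varepsilon>0$ there is $\delta>0$ such that $\langle x_1^*-x_2^*,x_1-x_2\rangle\ge-\varepsilon\|x_1-x_2\|$ for each $i\in E$, all $x_1,x_2\in S(i)$ with $\|x_1-x_2\|<\delta$ and all $x_j^*\in N(S(i);x_j)\cap\mathbb{B}$, $j=1,2$. *)

theory Defs
  imports "HOL-Analysis.Analysis"
begin

definition abs_cont_on :: "real \<Rightarrow> real \<Rightarrow> (real \<Rightarrow> 'a::real_normed_vector) \<Rightarrow> bool" where
  "abs_cont_on a b x \<longleftrightarrow>
     (\<forall>\<epsilon>>0. \<exists>\<delta>>0. \<forall>(n::nat) (l::nat \<Rightarrow> real) (u::nat \<Rightarrow> real).
        (\<forall>i<n. a \<le> l i \<and> l i \<le> u i \<and> u i \<le> b) \<and>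
        (\<forall>i<n. \<forall>j<n. i \<noteq> j \<longrightarrow> {l i<..<u i} \<inter> {l j<..<u j} = {}) \<and>
        (\<Sum>i<n. u i - l i) < \<delta>
        \<longrightarrow> (\<Sum>i<n. norm (x (u i) - x (l i))) < \<epsilon>)"

definition weak_topology :: "'a::real_inner topology" where
  "weak_topology = topology_generated_by {{x. inner x y \<in> U} | y U. open U}"

definition usc_weak :: "('a::real_inner \<Rightarrow> 'a set) \<Rightarrow> bool" where
  "usc_weak G \<longleftrightarrow> (\<forall>v W. openin weak_topology W \<and> G v \<subseteq> W \<longrightarrow>
      (\<exists>\<delta>>0. \<forall>u. norm (u - v) < \<delta> \<longrightarrow> G u \<subseteq> W))"

definition meas_multifun :: "real \<Rightarrow> (real \<Rightarrow> 'a::topological_space set) \<Rightarrow> bool" where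
  "meas_multifun T G \<longleftrightarrow>
     (\<forall>U. open U \<longrightarrow> {t \<in> {0..T}. G t \<inter> U \<noteq> {}} \<in> sets (lebesgue_on {0..T}))"

(* Kuratowski measure of non-compactness (value \<infinity> if no finite cover exists) *)
definition kuratowski_mnc :: "'a::metric_space set \<Rightarrow> ennreal" where
  "kuratowski_mnc A = Inf {ennreal d | d. d > 0 \<and>
      (\<exists>\<S>. finite \<S> \<and> A \<subseteq> \<Union>\<S> \<and> (\<forall>B\<in>\<S>. bounded B \<and> diameter B \<le> d))}"

definition hausdorff_mnc :: "'a::metric_space set \<Rightarrow> ennreal" where
  "hausdorff_mnc A = Inf {ennreal r | r. r > 0 \<and>
      (\<exists>Z. finite Z \<and> A \<subseteq> (\<Union>z\<in>Z. cball z r))}"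

definition clarke_tangent :: "'a::real_normed_vector set \<Rightarrow> 'a \<Rightarrow> 'a set" where
  "clarke_tangent S x = {h. \<forall>(xs::nat \<Rightarrow> 'a) (ts::nat \<Rightarrow> real).
      (\<forall>n. xs n \<in> S) \<and> xs \<longlonglongrightarrow> x \<and> (\<forall>n. ts n > 0) \<and> ts \<longlonglongrightarrow> 0 \<longrightarrow>
      (\<exists>hs. hs \<longlonglongrightarrow> h \<and> (\<forall>n. xs n + ts n *\<^sub>R hs n \<in> S))}"

definition clarke_normal :: "'a::real_inner set \<Rightarrow> 'a \<Rightarrow> 'a set" where
  "clarke_normal S x = (if x \<in> S then {v. \<forall>h\<in>clarke_tangent S x. inner v h \<le> 0} else {})"

definition equi_unif_subsmooth :: "'i set \<Rightarrow> ('i \<Rightarrow> 'a::real_inner set) \<Rightarrow> bool" where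
  "equi_unif_subsmooth E S \<longleftrightarrow> (\<forall>\<epsilon>>0. \<exists>\<delta>>0. \<forall>i\<in>E. \<forall>x1\<in>S i. \<forall>x2\<in>S i.
      \<forall>v1 \<in> clarke_normal (S i) x1 \<inter> cball 0 1. \<forall>v2 \<in> clarke_normal (S i) x2 \<inter> cball 0 1.
      norm (x1 - x2) < \<delta> \<longrightarrow> inner (v1 - v2) (x1 - x2) \<ge> - \<epsilon> * norm (x1 - x2))"

end

theory Submission
  imports Defs "HOL-Library.Diagonal_Subsequence"
begin

text \<open>
  Let \<open>m\<close> be an integrable function dominating \<open>1 + c + d + \<integral>\<sigma>(\<cdot>, s) ds\<close> and a density for the variation
  of \<open>\<zeta>\<close>. Cut \<open>[0, T]\<close> into \<open>N\<close> cells of equal \<open>m\<close>-mass \<open>\<eta>\<close> and run Moreau's catching-up scheme: the next node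
  is a nearest point in \<open>C(t\<^sub>i\<^sub>+\<^sub>1, x\<^sub>i)\<close> of \<open>x\<^sub>i\<close> plus the integral over the cell of the minimal selection of \<open>F\<close>
  and of the Volterra term along the nodes computed so far. Nearest points exist because the sets are
  ball-compact. Since the cells have equal mass and \<open>L < 1\<close>, the steps are \<open>O(\<eta>)\<close> and all velocities are bounded
  by a constant multiple of \<open>m\<close>.

  Ball-compactness of \<open>C(t, A)\<close> and a diagonal argument give a subsequence converging at every time.
  Convex combinations of the selections and of the normals, taken from the tails of the subsequence,
  converge almost everywhere, and the limit curve is the integral of the limit velocity. The limit of the
  selections lies in \<open>F(t, x(t))\<close> by weak upper semicontinuity and separation. By equi-uniform
  subsmoothness the approximate normals satisfy inequalities \<open>\<langle>v, z - y\<rangle> \<le> \<epsilon> \<parallel>v\<parallel> \<parallel>z - y\<parallel>\<close> for nearby points \<open>z\<close> of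
  the set, which are stable under convex combinations and limits and characterise the limit as a normal.
\<close>

section \<open>Lebesgue differentiation and absolute continuity\<close>

text \<open>The moving set depends on the state, so each step can be enlarged by the previous one
  through the factor L: a step is at most a drift term plus L times the preceding step. Over cells
  of equal mass the drift term has the same order \<eta> on every cell and the recursion closes at
  the fixed point of \<open>3 + L * \<kappa> = \<kappa>\<close>. Over cells of equal length the
  velocity on a cell would be controlled by the mass of the preceding cell, not by m at the same
  time. Domination by m is what makes the passage to the limit possible: the weight 1/m turns an L^1
  bound into a bound in a weighted L^2 space, where a Hilbert space argument replaces weak
  compactness in L^1. The Volterra term fits the recursion because at a time in the i-th cell it
  sees only the nodes up to i. The normals belong to varying points of varying sets, so convexity of
  a single cone does not help; what is averaged is an inequality linear in the normal, tested
  against points of the limit set.\<close>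

text \<open>Truncation: |f| is at most (|f| - n)^+ + n. The first term has a small integral for
  large n by dominated convergence, the second contributes n times the measure of the set.\<close>

lemma integrable_small_on_small_sets:
  fixes f :: "'a \<Rightarrow> real"
  assumes f: "integrable M f" and e: "0 < \<epsilon>"
  obtains \<delta> where "0 < \<delta>"
    "\<And>A. A \<in> sets M \<Longrightarrow> emeasure M A \<le> ennreal \<delta> \<Longrightarrow> (\<integral>\<^sup>+x\<in>A. ennreal \<bar>f x\<bar> \<partial>M) \<le> ennreal \<epsilon>"
proof -
  have [measurable]: "f \<in> borel_measurable M" using f by auto
  have "(\<lambda>n. \<integral>x. max 0 (\<bar>f x\<bar> - real n) \<partial>M) \<longlonglongrightarrow> (\<integral>x. 0 \<partial>M)"
  proof (rule integral_dominated_convergence[where w = "\<lambda>x. \<bar>f x\<bar>"])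
    show "integrable M (\<lambda>x. \<bar>f x\<bar>)" using f by auto
    show "AE x in M. (\<lambda>n. max 0 (\<bar>f x\<bar> - real n)) \<longlonglongrightarrow> 0"
    proof (rule AE_I2)
      fix x
      have "eventually (\<lambda>n. max 0 (\<bar>f x\<bar> - real n) = 0) sequentially"
        using eventually_ge_at_top[of "nat \<lceil>\<bar>f x\<bar>\<rceil>"] by eventually_elim linarith
      then show "(\<lambda>n. max 0 (\<bar>f x\<bar> - real n)) \<longlonglongrightarrow> 0" by (rule tendsto_eventually)
    qed
  qed auto
  then have "eventually (\<lambda>n. (\<integral>x. max 0 (\<bar>f x\<bar> - real n) \<partial>M) < \<epsilon>/2) sequentially"
    using e by (intro order_tendstoD) auto
  then obtain n where n: "(\<integral>x. max 0 (\<bar>f x\<bar> - real n) \<partial>M) < \<epsilon>/2"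
    by (auto simp: eventually_sequentially)
  have int: "integrable M (\<lambda>x. max 0 (\<bar>f x\<bar> - real n))"
    by (rule Bochner_Integration.integrable_bound[of M "\<lambda>x. \<bar>f x\<bar>"]) (use f in auto)
  show ?thesis
  proof (rule that)
    \<comment> \<open>With this bound on the measure the constant n contributes at most
      \<epsilon>/2; the summand 1 keeps the denominator positive for n = 0.\<close>
    show "0 < \<epsilon> / (2 * (real n + 1))" using e by auto
    fix A assume A[measurable]: "A \<in> sets M" and le: "emeasure M A \<le> ennreal (\<epsilon> / (2 * (real n + 1)))"
    have "(\<integral>\<^sup>+x\<in>A. ennreal \<bar>f x\<bar> \<partial>M)
        \<le> (\<integral>\<^sup>+x. ennreal (max 0 (\<bar>f x\<bar> - real n)) + ennreal n * indicator A x \<partial>M)"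
    proof (intro nn_integral_mono)
      fix x show "ennreal \<bar>f x\<bar> * indicator A x \<le> ennreal (max 0 (\<bar>f x\<bar> - real n)) + ennreal n * indicator A x"
        by (cases "x \<in> A") (auto simp flip: ennreal_plus intro!: ennreal_leI)
    qed
    also have "\<dots> = (\<integral>\<^sup>+x. ennreal (max 0 (\<bar>f x\<bar> - real n)) \<partial>M) + ennreal n * emeasure M A"
      by (subst nn_integral_add) (auto simp: nn_integral_cmult_indicator)
    also have "(\<integral>\<^sup>+x. ennreal (max 0 (\<bar>f x\<bar> - real n)) \<partial>M) = ennreal (\<integral>x. max 0 (\<bar>f x\<bar> - real n) \<partial>M)"
      by (rule nn_integral_eq_integral[OF int]) auto
    also have "\<dots> \<le> ennreal (\<epsilon>/2)" using n by (intro ennreal_leI) auto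
    also have "ennreal n * emeasure M A \<le> ennreal n * ennreal (\<epsilon> / (2 * (real n + 1)))"
      using le by (intro mult_left_mono) auto
    also have "\<dots> = ennreal (n * (\<epsilon> / (2 * (real n + 1))))"
      using e by (intro ennreal_mult[symmetric]) auto
    also have "\<dots> \<le> ennreal (\<epsilon>/2)"
      using e by (intro ennreal_leI) (auto simp: field_simps)
    also have "ennreal (\<epsilon>/2) + ennreal (\<epsilon>/2) = ennreal \<epsilon>"
      using e by (simp flip: ennreal_plus)
    finally show "(\<integral>\<^sup>+x\<in>A. ennreal \<bar>f x\<bar> \<partial>M) \<le> ennreal \<epsilon>" by (simp add: add_mono)
  qed
qed

lemma nn_integral_interval_eq:
  fixes f :: "real \<Rightarrow> real"
  assumes "integrable lebesgue f"
  shows "(\<integral>\<^sup>+x\<in>{a..b}. ennreal \<bar>f x\<bar> \<partial>lebesgue) = ennreal (LINT x:{a..b}|lebesgue. \<bar>f x\<bar>)"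
proof -
  have "integrable lebesgue (\<lambda>x. indicator {a..b} x *\<^sub>R \<bar>f x\<bar>)"
    using assms by (intro integrable_mult_indicator) auto
  then have "(\<integral>\<^sup>+x. ennreal (indicator {a..b} x *\<^sub>R \<bar>f x\<bar>) \<partial>lebesgue) = ennreal (LINT x:{a..b}|lebesgue. \<bar>f x\<bar>)"
    unfolding set_lebesgue_integral_def by (intro nn_integral_eq_integral) auto
  moreover have "(\<integral>\<^sup>+x. ennreal (indicator {a..b} x *\<^sub>R \<bar>f x\<bar>) \<partial>lebesgue) = (\<integral>\<^sup>+x\<in>{a..b}. ennreal \<bar>f x\<bar> \<partial>lebesgue)"
    by (intro nn_integral_cong) (auto simp: indicator_def)
  ultimately show ?thesis by simp
qed

lemma integrable_imp_set_integrable_lebesgue: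
  fixes f :: "real \<Rightarrow> 'b::{banach,second_countable_topology}"
  shows "integrable lebesgue f \<Longrightarrow> A \<in> sets lebesgue \<Longrightarrow> set_integrable lebesgue A f"
  unfolding set_integrable_def by (intro integrable_mult_indicator) auto

lemma set_integral_norm_le:
  fixes f :: "real \<Rightarrow> 'b::{banach,second_countable_topology}"
  shows "norm (LINT x:A|lebesgue. f x) \<le> (LINT x:A|lebesgue. norm (f x))"
proof -
  have "norm (LINT x:A|lebesgue. f x) \<le> (LINT x|lebesgue. norm (indicator A x *\<^sub>R f x))"
    unfolding set_lebesgue_integral_def by (rule integral_norm_bound)
  also have "\<dots> = (LINT x:A|lebesgue. norm (f x))"
    unfolding set_lebesgue_integral_def by (intro Bochner_Integration.integral_cong) auto
  finally show ?thesis .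
qed

lemma AE_lebesgue_neq: "AE x in lebesgue. x \<noteq> (a::real)"
  using AE_lborel_singleton[of a] by (rule AE_completion)

lemma set_integral_point_zero:
  fixes f :: "real \<Rightarrow> 'b::{banach,second_countable_topology}"
  shows "(LINT x:{a..a}|lebesgue. f x) = 0"
  unfolding set_lebesgue_integral_def
proof (rule integral_eq_zero_AE)
  show "AE x in lebesgue. indicat_real {a..a} x *\<^sub>R f x = 0"
    using AE_lebesgue_neq[of a] by eventually_elim auto
qed

lemma set_integral_interval_split:
  fixes f :: "real \<Rightarrow> 'b::{banach,second_countable_topology}"
  assumes f: "integrable lebesgue f" and "a \<le> b" "b \<le> c"
  shows "(LINT x:{a..c}|lebesgue. f x) = (LINT x:{a..b}|lebesgue. f x) + (LINT x:{b..c}|lebesgue. f x)"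
proof -
  have *: "integrable lebesgue (\<lambda>x. indicat_real {p..q} x *\<^sub>R f x)" for p q
    using f by (intro integrable_mult_indicator) auto
  have "(LINT x:{a..c}|lebesgue. f x)
      = (LINT x|lebesgue. indicat_real {a..b} x *\<^sub>R f x + indicat_real {b..c} x *\<^sub>R f x)"
    unfolding set_lebesgue_integral_def
  proof (rule integral_cong_AE)
    show "AE x in lebesgue. indicat_real {a..c} x *\<^sub>R f x = indicat_real {a..b} x *\<^sub>R f x + indicat_real {b..c} x *\<^sub>R f x"
      using AE_lebesgue_neq[of b] by eventually_elim (use assms in \<open>auto simp: indicator_def\<close>)
  qed (use *[THEN borel_measurable_integrable] in auto)
  also have "\<dots> = (LINT x:{a..b}|lebesgue. f x) + (LINT x:{b..c}|lebesgue. f x)"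
    unfolding set_lebesgue_integral_def using * by (intro Bochner_Integration.integral_add) auto
  finally show ?thesis .
qed

section \<open>Lebesgue differentiation by Vitali covering\<close>

text \<open>If the bound fails at t, rationals r < q separate f t from means over arbitrarily short
  intervals. The set of such t is null: disjoint Vitali intervals with mean above q lie in an open U
  that barely exceeds E' = {f < r}. Since f - r is negative on E', the excess (q - r) times their
  total length is paid for by U - E' alone. The intervals need only contain t, not be centred at
  it.\<close>

lemma lebesgue_upper_derivative:
  fixes f :: "real \<Rightarrow> real"
  assumes f: "integrable lebesgue f"
  shows "AE t in lebesgue. \<forall>\<epsilon>>0. \<exists>\<delta>>0. \<forall>a b. a \<le> t \<and> t \<le> b \<and> b - a < \<delta> \<longrightarrow>
           (LINT x:{a..b}|lebesgue. f x) \<le> (f t + \<epsilon>) * (b - a)"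
proof -
  have [measurable]: "f \<in> borel_measurable lebesgue" using f by auto
  define E where "E r q = {t. f t < r \<and> (\<forall>\<delta>>0. \<exists>a b. a \<le> t \<and> t \<le> b \<and> a < b \<and> b - a < \<delta> \<and>
      q * (b - a) < (LINT x:{a..b}|lebesgue. f x))}" for r q
  have neg: "negligible (E r q)" if rq: "r < q" for r q
    unfolding negligible_outer_le
  proof (intro allI impI)
    fix e :: real assume e: "0 < e"
    \<comment> \<open>Over U - E' the integral of |f| and |r| times the measure may cost e' each;
      together they make (q - r) * e.\<close>
    define e' where "e' = e * (q - r) / 2"
    have e': "0 < e'" using e rq by (auto simp: e'_def)
    obtain \<delta> where \<delta>: "0 < \<delta>"
      "\<And>A. A \<in> sets lebesgue \<Longrightarrow> emeasure lebesgue A \<le> ennreal \<delta> \<Longrightarrow> (\<integral>\<^sup>+x\<in>A. ennreal \<bar>f x\<bar> \<partial>lebesgue) \<le> ennreal e'"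
      using integrable_small_on_small_sets[OF f e'] by auto
    define \<delta>' where "\<delta>' = min \<delta> (e' / (\<bar>r\<bar> + 1))"
    have \<delta>': "0 < \<delta>'" using \<delta> e' by (auto simp: \<delta>'_def)
    define E' where "E' = {t. f t < r}"
    have E'[measurable]: "E' \<in> sets lebesgue" unfolding E'_def using borel_measurable_less[of f lebesgue "\<lambda>_. r"] by simp
    obtain U where U: "open U" "E' \<subseteq> U" "U - E' \<in> lmeasurable" "emeasure lebesgue (U - E') < ennreal \<delta>'"
      using sets_lebesgue_outer_open[OF E' \<delta>'] by auto
    have Um[measurable]: "U \<in> sets lebesgue" using U(1) by auto
    \<comment> \<open>Intervals are coded by their endpoints; the covering theorem speaks of balls,
      hence the midpoints and half-lengths below.\<close>
    define K where "K = {(a, b). a < b \<and> {a..b} \<subseteq> U \<and> q * (b - a) < (LINT x:{a..b}|lebesgue. f x)}"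
    have cb: "cball ((a + b)/2) ((b - a)/2) = {a..b}" for a b :: real
      by (auto simp: cball_eq_atLeastAtMost field_simps)
    obtain C where C: "countable C" "C \<subseteq> K"
      "pairwise (\<lambda>i j. disjnt (cball ((fst i + snd i)/2) ((snd i - fst i)/2)) (cball ((fst j + snd j)/2) ((snd j - fst j)/2))) C"
      "negligible (E r q - (\<Union>i\<in>C. cball ((fst i + snd i)/2) ((snd i - fst i)/2)))"
    proof (rule Vitali_covering_theorem_cballs[where K = K and S = "E r q" and r = "\<lambda>i. (snd i - fst i)/2"
          and a = "\<lambda>i. (fst i + snd i)/2"])
      show "0 < (snd i - fst i) / 2" if "i \<in> K" for i using that by (auto simp: K_def)
      fix t d :: real assume t: "t \<in> E r q" and d: "0 < d"
      then have "t \<in> U" using U by (auto simp: E_def E'_def)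
      then obtain h where h: "0 < h" "ball t h \<subseteq> U" using U(1) open_contains_ball by blast
      obtain a b where ab: "a \<le> t" "t \<le> b" "a < b" "b - a < min d h" "q * (b - a) < (LINT x:{a..b}|lebesgue. f x)"
      proof -
        have "\<forall>\<delta>>0. \<exists>a b. a \<le> t \<and> t \<le> b \<and> a < b \<and> b - a < \<delta> \<and> q * (b - a) < (LINT x:{a..b}|lebesgue. f x)"
          using t unfolding E_def by blast
        moreover have "min d h > 0" using h d by auto
        ultimately show ?thesis using that by blast
      qed
      have "{a..b} \<subseteq> ball t h" using ab by (auto simp: dist_real_def)
      with h ab have "(a, b) \<in> K" by (auto simp: K_def)
      with ab show "\<exists>i. i \<in> K \<and> t \<in> cball ((fst i + snd i) / 2) ((snd i - fst i) / 2) \<and> (snd i - fst i) / 2 < d"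
        by (intro exI[of _ "(a,b)"]) (auto simp: cb)
    qed (rule that)
    define I where "I i = {fst i..snd i}" for i :: "real \<times> real"
    have CI: "pairwise (\<lambda>i j. disjnt (I i) (I j)) C" "negligible (E r q - (\<Union>i\<in>C. I i))"
      using C unfolding I_def cb by auto
    have dis: "disjoint_family_on I C"
      using CI(1) by (auto simp: disjoint_family_on_def pairwise_def disjnt_def)
    \<comment> \<open>Serves as the density of a measure, so that the estimates on the countably
      many disjoint intervals add up by countable additivity.\<close>
    define h where "h x = ennreal ((\<bar>f x\<bar> + \<bar>r\<bar>) * indicator (U - E') x)" for x
    have hm[measurable]: "h \<in> borel_measurable lebesgue" unfolding h_def by measurable
    define W where "W = (\<Union>i\<in>C. I i)"
    have Wm[measurable]: "W \<in> sets lebesgue" unfolding W_def I_def using C by (intro sets.countable_UN') auto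
    have one: "ennreal (q - r) * emeasure lebesgue (I i) \<le> emeasure (density lebesgue h) (I i)" if "i \<in> C" for i
    proof -
      obtain a b where i: "i = (a, b)" by (cases i)
      have ab: "a < b" "{a..b} \<subseteq> U" "q * (b - a) < (LINT x:{a..b}|lebesgue. f x)"
        using that C(2) i by (auto simp: K_def)
      have si: "set_integrable lebesgue {a..b} f" using f by (intro integrable_imp_set_integrable_lebesgue) auto
      have sr: "set_integrable lebesgue {a..b} (\<lambda>x. r)"
        unfolding set_integrable_def using ab(1) by (intro integrable_scaleR_left integrable_real_indicator) auto
      have sh: "set_integrable lebesgue {a..b} (\<lambda>x. (\<bar>f x\<bar> + \<bar>r\<bar>) * indicator (U - E') x)"
      proof -
        have "set_integrable lebesgue {a..b} (\<lambda>x. \<bar>f x\<bar> + \<bar>r\<bar>)"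
          using si ab(1) by (intro set_integral_add set_integrable_abs) (auto simp: set_integrable_def intro!: integrable_real_indicator)
        then have "integrable lebesgue (\<lambda>x. indicator (U - E') x *\<^sub>R (indicator {a..b} x *\<^sub>R (\<bar>f x\<bar> + \<bar>r\<bar>)))"
          unfolding set_integrable_def by (intro integrable_mult_indicator[of "U - E'"]) auto
        then show ?thesis unfolding set_integrable_def by (simp add: mult_ac)
      qed
      have "(q - r) * (b - a) \<le> (LINT x:{a..b}|lebesgue. f x) - (LINT x:{a..b}|lebesgue. r)"
        using ab by (auto simp: set_lebesgue_integral_def algebra_simps)
      also have "\<dots> = (LINT x:{a..b}|lebesgue. f x - r)" using si sr by simp
      also have "\<dots> \<le> (LINT x:{a..b}|lebesgue. (\<bar>f x\<bar> + \<bar>r\<bar>) * indicator (U - E') x)"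
      proof (intro set_integral_mono set_integral_diff(1) si sr sh)
        fix x assume "x \<in> {a..b}"
        then have "x \<in> U" using ab by auto
        then show "f x - r \<le> (\<bar>f x\<bar> + \<bar>r\<bar>) * indicator (U - E') x"
          by (auto simp: E'_def indicator_def)
      qed
      finally have le: "(q - r) * (b - a) \<le> (LINT x:{a..b}|lebesgue. (\<bar>f x\<bar> + \<bar>r\<bar>) * indicator (U - E') x)" .
      have "ennreal (q - r) * emeasure lebesgue (I i) = ennreal ((q - r) * (b - a))"
        using ab rq by (simp add: I_def i ennreal_mult)
      also have "\<dots> \<le> ennreal (LINT x:{a..b}|lebesgue. (\<bar>f x\<bar> + \<bar>r\<bar>) * indicator (U - E') x)"
        using le by (rule ennreal_leI)
      also have "\<dots> = (\<integral>\<^sup>+x. ennreal (indicator {a..b} x *\<^sub>R ((\<bar>f x\<bar> + \<bar>r\<bar>) * indicator (U - E') x)) \<partial>lebesgue)"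
        unfolding set_lebesgue_integral_def
        by (subst nn_integral_eq_integral) (use sh in \<open>auto simp: set_integrable_def\<close>)
      also have "\<dots> = (\<integral>\<^sup>+x\<in>I i. h x \<partial>lebesgue)"
        by (intro nn_integral_cong) (auto simp: h_def I_def i indicator_def)
      also have "\<dots> = emeasure (density lebesgue h) (I i)"
        by (subst emeasure_density) (auto simp: I_def)
      finally show ?thesis .
    qed
    have "ennreal (q - r) * emeasure lebesgue W = ennreal (q - r) * (\<integral>\<^sup>+i. emeasure lebesgue (I i) \<partial>count_space C)"
      unfolding W_def using C dis by (subst emeasure_UN_countable) (auto simp: I_def)
    also have "\<dots> = (\<integral>\<^sup>+i. ennreal (q - r) * emeasure lebesgue (I i) \<partial>count_space C)"
      by (subst nn_integral_cmult) auto
    also have "\<dots> \<le> (\<integral>\<^sup>+i. emeasure (density lebesgue h) (I i) \<partial>count_space C)"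
      using one by (intro nn_integral_mono) auto
    also have "\<dots> = emeasure (density lebesgue h) W"
      unfolding W_def using C dis by (subst emeasure_UN_countable) (auto simp: I_def)
    also have "\<dots> \<le> (\<integral>\<^sup>+x. h x \<partial>lebesgue)"
      by (subst emeasure_density) (auto intro!: nn_integral_mono simp: indicator_def)
    also have "\<dots> = (\<integral>\<^sup>+x. ennreal \<bar>f x\<bar> * indicator (U - E') x + ennreal \<bar>r\<bar> * indicator (U - E') x \<partial>lebesgue)"
      by (intro nn_integral_cong) (auto simp: h_def indicator_def)
    also have "\<dots> = (\<integral>\<^sup>+x\<in>(U - E'). ennreal \<bar>f x\<bar> \<partial>lebesgue) + ennreal \<bar>r\<bar> * emeasure lebesgue (U - E')"
      by (subst nn_integral_add) (auto simp: nn_integral_cmult_indicator)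
    also have "\<dots> \<le> ennreal e' + ennreal e'"
    proof (intro add_mono)
      have *: "emeasure lebesgue (U - E') \<le> ennreal \<delta>'" using U(4) by (rule less_imp_le)
      show "(\<integral>\<^sup>+x\<in>(U - E'). ennreal \<bar>f x\<bar> \<partial>lebesgue) \<le> ennreal e'"
      proof (rule \<delta>(2))
        show "emeasure lebesgue (U - E') \<le> ennreal \<delta>"
          by (rule order_trans[OF *]) (auto simp: \<delta>'_def intro: ennreal_leI)
      qed measurable
      have "ennreal \<bar>r\<bar> * emeasure lebesgue (U - E') \<le> ennreal \<bar>r\<bar> * ennreal (e' / (\<bar>r\<bar> + 1))"
        by (intro mult_left_mono order_trans[OF *] ennreal_leI) (auto simp: \<delta>'_def)
      also have "\<dots> = ennreal (\<bar>r\<bar> * (e' / (\<bar>r\<bar> + 1)))" using e' by (intro ennreal_mult[symmetric]) auto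
      also have "\<dots> \<le> ennreal e'" using e' by (intro ennreal_leI) (auto simp: field_simps)
      finally show "ennreal \<bar>r\<bar> * emeasure lebesgue (U - E') \<le> ennreal e'" .
    qed
    also have "\<dots> = ennreal (q - r) * ennreal e"
      using e rq e' by (simp add: e'_def flip: ennreal_plus ennreal_mult)
    finally have We: "emeasure lebesgue W \<le> ennreal e"
      using rq by (simp add: ennreal_mult_le_mult_iff)
    define Z where "Z = W \<union> (E r q - W)"
    have nz: "E r q - W \<in> null_sets lebesgue" using CI(2) by (simp add: W_def negligible_iff_null_sets)
    have "emeasure lebesgue Z = emeasure lebesgue W"
      unfolding Z_def using nz by (intro emeasure_Un_null_set) auto
    with We have Ze: "emeasure lebesgue Z \<le> ennreal e" by simp
    have Zm: "Z \<in> sets lebesgue" using nz unfolding Z_def by (intro sets.Un) auto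
    show "\<exists>T. E r q \<subseteq> T \<and> T \<in> lmeasurable \<and> measure lebesgue T \<le> e"
    proof (intro exI conjI)
      show "E r q \<subseteq> Z" by (auto simp: Z_def)
      show "Z \<in> lmeasurable" using Zm Ze by (intro fmeasurableI) (auto intro: le_less_trans)
      show "measure lebesgue Z \<le> e" using Ze e unfolding measure_def by (intro enn2real_leI) auto
    qed
  qed
  have "AE t in lebesgue. \<forall>p\<in>{(r, q). r \<in> \<rat> \<and> q \<in> \<rat> \<and> r < q}. t \<notin> (case p of (r, q) \<Rightarrow> E r q)"
  proof (subst AE_ball_countable)
    have "countable ((\<rat> :: real set) \<times> (\<rat> :: real set))" using countable_rat by (intro countable_SIGMA) auto
    then show "countable {(r, q). r \<in> \<rat> \<and> q \<in> \<rat> \<and> r < (q :: real)}" by (rule countable_subset[rotated]) auto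
    show "\<forall>p\<in>{(r, q). r \<in> \<rat> \<and> q \<in> \<rat> \<and> r < q}. AE t in lebesgue. t \<notin> (case p of (r, q) \<Rightarrow> E r q)"
      using neg by (auto simp: negligible_iff_null_sets intro!: AE_not_in)
  qed
  then show ?thesis
  proof eventually_elim
    case (elim t)
    show ?case
    proof (intro allI impI)
      fix \<epsilon> :: real assume \<epsilon>: "0 < \<epsilon>"
      obtain q where q: "q \<in> \<rat>" "f t < q" "q < f t + \<epsilon>" using Rats_dense_in_real[of "f t" "f t + \<epsilon>"] \<epsilon> by auto
      obtain r where r: "r \<in> \<rat>" "f t < r" "r < q" using Rats_dense_in_real[of "f t" q] q by auto
      have "t \<notin> E r q" using elim q r by auto
      then obtain \<delta> where \<delta>: "\<delta> > 0" "\<And>a b. a \<le> t \<Longrightarrow> t \<le> b \<Longrightarrow> a < b \<Longrightarrow> b - a < \<delta> \<Longrightarrow>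
         (LINT x:{a..b}|lebesgue. f x) \<le> q * (b - a)"
        using r unfolding E_def mem_Collect_eq by (meson not_less)
      show "\<exists>\<delta>>0. \<forall>a b. a \<le> t \<and> t \<le> b \<and> b - a < \<delta> \<longrightarrow> (LINT x:{a..b}|lebesgue. f x) \<le> (f t + \<epsilon>) * (b - a)"
      proof (intro exI conjI allI impI)
        fix a b assume ab: "a \<le> t \<and> t \<le> b \<and> b - a < \<delta>"
        show "(LINT x:{a..b}|lebesgue. f x) \<le> (f t + \<epsilon>) * (b - a)"
        proof (cases "a = b")
          case True
          then show ?thesis using set_integral_point_zero[of a f] by simp
        next
          case False
          then have "(LINT x:{a..b}|lebesgue. f x) \<le> q * (b - a)" using ab by (intro \<delta>) auto
          also have "\<dots> \<le> (f t + \<epsilon>) * (b - a)" using q ab False by (intro mult_right_mono) auto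
          finally show ?thesis .
        qed
      qed (rule \<delta>)
    qed
  qed
qed


lemma set_integral_const_interval:
  fixes c :: "'b::{banach,second_countable_topology}"
  assumes "a \<le> b"
  shows "set_integrable lebesgue {a..b} (\<lambda>x. c)" "(LINT x:{a..b}|lebesgue. c) = (b - a) *\<^sub>R c"
proof -
  show "set_integrable lebesgue {a..b} (\<lambda>x. c)"
    unfolding set_integrable_def using assms
    by (intro integrable_scaleR_left integrable_real_indicator) auto
  show "(LINT x:{a..b}|lebesgue. c) = (b - a) *\<^sub>R c"
    unfolding set_lebesgue_integral_def using assms
    by (subst integral_scaleR_left) (auto intro!: integrable_real_indicator)
qed

text \<open>The scalar upper bound is applied to |u - e| for all e in a countable dense set. For e
  close to u t, the mean of u over a short interval is close to e and hence to u t, so no lower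
  bound is needed.\<close>

lemma lebesgue_differentiation:
  fixes u :: "real \<Rightarrow> 'b::{banach,second_countable_topology}"
  assumes u: "integrable lebesgue u"
  shows "AE t in lebesgue. \<forall>\<epsilon>>0. \<exists>\<delta>>0. \<forall>a b. a \<le> t \<and> t \<le> b \<and> b - a < \<delta> \<longrightarrow>
           norm ((LINT x:{a..b}|lebesgue. u x) - (b - a) *\<^sub>R u t) \<le> \<epsilon> * (b - a)"
proof -
  have [measurable]: "u \<in> borel_measurable lebesgue" using u by auto
  obtain D :: "'b set" where D: "countable D" "\<And>Y. open Y \<Longrightarrow> Y \<noteq> {} \<Longrightarrow> \<exists>d\<in>D. d \<in> Y"
    using countable_dense_setE by blast
  \<comment> \<open>For e different from 0 the function |u - e| is not integrable on the line; the
    constant subtracted here is restored on each bounded interval.\<close>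
  define f where "f e x = norm (u x - e) - norm e" for e x
  have fi: "integrable lebesgue (f e)" for e
  proof (rule Bochner_Integration.integrable_bound[OF u])
    show "f e \<in> borel_measurable lebesgue" unfolding f_def by measurable
    have "norm (f e x) \<le> norm (u x)" for x
      using norm_triangle_ineq3[of "u x - e" "- e"] by (simp add: f_def)
    then show "AE x in lebesgue. norm (f e x) \<le> norm (u x)" by simp
  qed
  have "AE t in lebesgue. \<forall>e\<in>D. \<forall>\<epsilon>>0. \<exists>\<delta>>0. \<forall>a b. a \<le> t \<and> t \<le> b \<and> b - a < \<delta> \<longrightarrow>
           (LINT x:{a..b}|lebesgue. f e x) \<le> (f e t + \<epsilon>) * (b - a)"
    unfolding AE_ball_countable[OF D(1)] by (intro ballI lebesgue_upper_derivative fi)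
  then show ?thesis
  proof eventually_elim
    case (elim t)
    show ?case
    proof (intro allI impI)
      fix \<epsilon> :: real assume \<epsilon>: "0 < \<epsilon>"
      obtain e where e: "e \<in> D" "norm (u t - e) < \<epsilon>/4"
        using D(2)[of "ball (u t) (\<epsilon>/4)"] \<epsilon> by (auto simp: dist_norm)
      obtain \<delta> where \<delta>: "0 < \<delta>" "\<And>a b. a \<le> t \<and> t \<le> b \<and> b - a < \<delta> \<Longrightarrow>
           (LINT x:{a..b}|lebesgue. f e x) \<le> (f e t + \<epsilon>/2) * (b - a)"
        using elim e(1) \<epsilon> by (meson half_gt_zero)
      show "\<exists>\<delta>>0. \<forall>a b. a \<le> t \<and> t \<le> b \<and> b - a < \<delta> \<longrightarrow>
           norm ((LINT x:{a..b}|lebesgue. u x) - (b - a) *\<^sub>R u t) \<le> \<epsilon> * (b - a)"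
      proof (intro exI conjI allI impI)
        fix a b assume ab: "a \<le> t \<and> t \<le> b \<and> b - a < \<delta>"
        have ab': "a \<le> b" using ab by auto
        note c = set_integral_const_interval[OF ab']
        have si: "set_integrable lebesgue {a..b} u" using u by (intro integrable_imp_set_integrable_lebesgue) auto
        have sf: "set_integrable lebesgue {a..b} (f e)" using fi by (intro integrable_imp_set_integrable_lebesgue) auto
        have "(LINT x:{a..b}|lebesgue. u x) - (b - a) *\<^sub>R e = (LINT x:{a..b}|lebesgue. u x - e)"
          using si c[where c = e] by simp
        then have "norm ((LINT x:{a..b}|lebesgue. u x) - (b - a) *\<^sub>R e) \<le> (LINT x:{a..b}|lebesgue. norm (u x - e))"
          using set_integral_norm_le by simp
        also have "\<dots> = (LINT x:{a..b}|lebesgue. f e x + norm e)" by (simp add: f_def)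
        also have "\<dots> = (LINT x:{a..b}|lebesgue. f e x) + (b - a) * norm e"
          using sf c[where c = "norm e"] by simp
        also have "\<dots> \<le> (f e t + \<epsilon>/2) * (b - a) + (b - a) * norm e" using \<delta>(2)[OF ab] by simp
        also have "\<dots> = (norm (u t - e) + \<epsilon>/2) * (b - a)" by (simp add: f_def algebra_simps)
        also have "\<dots> \<le> (\<epsilon>/4 + \<epsilon>/2) * (b - a)" using e ab by (intro mult_right_mono) auto
        finally have 1: "norm ((LINT x:{a..b}|lebesgue. u x) - (b - a) *\<^sub>R e) \<le> (\<epsilon>/4 + \<epsilon>/2) * (b - a)" .
        have "norm ((b - a) *\<^sub>R e - (b - a) *\<^sub>R u t) = (b - a) * norm (u t - e)"
          using ab' by (simp add: norm_minus_commute flip: scaleR_diff_right)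
        also have "\<dots> \<le> (b - a) * (\<epsilon>/4)" using e ab by (intro mult_left_mono) auto
        finally have 2: "norm ((b - a) *\<^sub>R e - (b - a) *\<^sub>R u t) \<le> (\<epsilon>/4) * (b - a)" by (simp add: mult.commute)
        have "norm ((LINT x:{a..b}|lebesgue. u x) - (b - a) *\<^sub>R u t)
          \<le> norm ((LINT x:{a..b}|lebesgue. u x) - (b - a) *\<^sub>R e) + norm ((b - a) *\<^sub>R e - (b - a) *\<^sub>R u t)"
          using norm_triangle_ineq[of "(LINT x:{a..b}|lebesgue. u x) - (b - a) *\<^sub>R e" "(b - a) *\<^sub>R e - (b - a) *\<^sub>R u t"]
          by simp
        also have "\<dots> \<le> (\<epsilon>/4 + \<epsilon>/2) * (b - a) + (\<epsilon>/4) * (b - a)" using 1 2 by (rule add_mono)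
        also have "\<dots> = \<epsilon> * (b - a)" by (simp add: field_simps)
        finally show "norm ((LINT x:{a..b}|lebesgue. u x) - (b - a) *\<^sub>R u t) \<le> \<epsilon> * (b - a)" .
      qed (rule \<delta>)
    qed
  qed
qed

text \<open>The differentiation lemma admits intervals with t as an endpoint, so it covers the
  difference quotients on either side of t.\<close>

lemma indefinite_integral_has_vector_derivative:
  fixes u :: "real \<Rightarrow> 'b::{banach,second_countable_topology}"
  assumes u: "integrable lebesgue u" and x: "\<And>t. t \<in> {a..b} \<Longrightarrow> x t = x0 + (LINT s:{a..t}|lebesgue. u s)"
  shows "AE t in lebesgue. t \<in> {a..b} \<longrightarrow> (x has_vector_derivative u t) (at t within {a..b})"
  using lebesgue_differentiation[OF u]
proof eventually_elim
  case (elim t)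
  show ?case
  proof
    assume t: "t \<in> {a..b}"
    show "(x has_vector_derivative u t) (at t within {a..b})"
      unfolding has_vector_derivative_def has_derivative_within_alt
    proof (intro conjI allI impI)
      show "bounded_linear (\<lambda>x. x *\<^sub>R u t)" by (rule bounded_linear_scaleR_left)
      fix \<epsilon> :: real assume "0 < \<epsilon>"
      then obtain \<delta> where \<delta>: "\<delta> > 0" "\<And>a b. a \<le> t \<and> t \<le> b \<and> b - a < \<delta> \<Longrightarrow>
           norm ((LINT x:{a..b}|lebesgue. u x) - (b - a) *\<^sub>R u t) \<le> \<epsilon> * (b - a)"
        using elim by blast
      have "norm (x y - x t - (y - t) *\<^sub>R u t) \<le> \<epsilon> * norm (y - t)" if y: "y \<in> {a..b}" "norm (y - t) < \<delta>" for y
      proof (cases "t \<le> y")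
        case True
        have "x y - x t = (LINT s:{t..y}|lebesgue. u s)"
          using set_integral_interval_split[OF u, of a t y] True t y by (simp add: x)
        with \<delta>(2)[of t y] True y show ?thesis by simp
      next
        case False
        have "x t - x y = (LINT s:{y..t}|lebesgue. u s)"
          using set_integral_interval_split[OF u, of a y t] False t y by (simp add: x)
        moreover have "norm (x y - x t - (y - t) *\<^sub>R u t) = norm ((x t - x y) - (t - y) *\<^sub>R u t)"
          by (subst norm_minus_commute) (simp add: algebra_simps)
        ultimately show ?thesis using \<delta>(2)[of y t] False y by simp
      qed
      with \<delta>(1) show "\<exists>d>0. \<forall>y\<in>{a..b}. norm (y - t) < d \<longrightarrow> norm (x y - x t - (y - t) *\<^sub>R u t) \<le> \<epsilon> * norm (y - t)"
        by blast
    qed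
  qed
qed

lemma abs_cont_on_dominated:
  fixes x :: "real \<Rightarrow> 'b::real_normed_vector" and m :: "real \<Rightarrow> real"
  assumes m: "integrable lebesgue m"
    and x: "\<And>s t. a \<le> s \<Longrightarrow> s \<le> t \<Longrightarrow> t \<le> b \<Longrightarrow> norm (x t - x s) \<le> (LINT r:{s..t}|lebesgue. m r)"
  shows "abs_cont_on a b x"
  unfolding abs_cont_on_def
proof (intro allI impI)
  fix \<epsilon> :: real assume \<epsilon>: "0 < \<epsilon>"
  have [measurable]: "m \<in> borel_measurable lebesgue" using m by auto
  obtain \<delta> where \<delta>: "0 < \<delta>"
    "\<And>A. A \<in> sets lebesgue \<Longrightarrow> emeasure lebesgue A \<le> ennreal \<delta> \<Longrightarrow> (\<integral>\<^sup>+x\<in>A. ennreal \<bar>m x\<bar> \<partial>lebesgue) \<le> ennreal (\<epsilon>/2)"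
    using integrable_small_on_small_sets[OF m, of "\<epsilon>/2"] \<epsilon> by auto
  show "\<exists>\<delta>>0. \<forall>(n::nat) l u. (\<forall>i<n. a \<le> l i \<and> l i \<le> u i \<and> u i \<le> b) \<and>
      (\<forall>i<n. \<forall>j<n. i \<noteq> j \<longrightarrow> {l i<..<u i} \<inter> {l j<..<u j} = {}) \<and> (\<Sum>i<n. u i - l i) < \<delta> \<longrightarrow>
      (\<Sum>i<n. norm (x (u i) - x (l i))) < \<epsilon>"
  proof (intro exI[of _ \<delta>] conjI allI impI \<delta>(1))
    fix n :: nat and l u :: "nat \<Rightarrow> real"
    assume "(\<forall>i<n. a \<le> l i \<and> l i \<le> u i \<and> u i \<le> b) \<and>
      (\<forall>i<n. \<forall>j<n. i \<noteq> j \<longrightarrow> {l i<..<u i} \<inter> {l j<..<u j} = {}) \<and> (\<Sum>i<n. u i - l i) < \<delta>"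
    then have lu: "\<And>i. i < n \<Longrightarrow> a \<le> l i \<and> l i \<le> u i \<and> u i \<le> b"
      and dis: "disjoint_family_on (\<lambda>i. {l i<..<u i}) {..<n}" and sum: "(\<Sum>i<n. u i - l i) < \<delta>"
      unfolding disjoint_family_on_def by auto
    define U where "U = (\<Union>i\<in>{..<n}. {l i<..<u i})"
    have Um[measurable]: "U \<in> sets lebesgue" unfolding U_def by (intro sets.finite_UN) auto
    define \<nu> where "\<nu> = density lebesgue (\<lambda>x. ennreal \<bar>m x\<bar>)"
    have *: "ennreal (norm (x (u i) - x (l i))) \<le> emeasure \<nu> {l i<..<u i}" if "i < n" for i
    proof -
      have "norm (x (u i) - x (l i)) \<le> (LINT r:{l i..u i}|lebesgue. m r)" using lu[OF that] by (intro x) auto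
      also have "\<dots> \<le> (LINT r:{l i..u i}|lebesgue. \<bar>m r\<bar>)"
        using m by (intro set_integral_mono integrable_imp_set_integrable_lebesgue) auto
      finally have "ennreal (norm (x (u i) - x (l i))) \<le> (\<integral>\<^sup>+x\<in>{l i..u i}. ennreal \<bar>m x\<bar> \<partial>lebesgue)"
        unfolding nn_integral_interval_eq[OF m] by (rule ennreal_leI)
      \<comment> \<open>Neighbouring closed intervals may share an endpoint; discarding the
        endpoints, a null set, makes the family disjoint.\<close>
      also have "\<dots> = (\<integral>\<^sup>+x\<in>{l i<..<u i}. ennreal \<bar>m x\<bar> \<partial>lebesgue)"
      proof (rule nn_integral_cong_AE)
        show "AE x in lebesgue. ennreal \<bar>m x\<bar> * indicator {l i..u i} x = ennreal \<bar>m x\<bar> * indicator {l i<..<u i} x"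
          using AE_lebesgue_neq[of "l i"] AE_lebesgue_neq[of "u i"]
          by eventually_elim (auto simp: indicator_def)
      qed
      also have "\<dots> = emeasure \<nu> {l i<..<u i}" unfolding \<nu>_def by (subst emeasure_density) auto
      finally show ?thesis .
    qed
    have eU: "emeasure lebesgue U = ennreal (\<Sum>i<n. u i - l i)"
    proof -
      have "emeasure lebesgue U = (\<Sum>i<n. emeasure lebesgue {l i<..<u i})"
        unfolding U_def using dis by (intro sum_emeasure[symmetric]) auto
      also have "\<dots> = (\<Sum>i<n. ennreal (u i - l i))" using lu by (intro sum.cong) auto
      also have "\<dots> = ennreal (\<Sum>i<n. u i - l i)" using lu by (intro sum_ennreal) auto
      finally show ?thesis .
    qed
    have "ennreal (\<Sum>i<n. norm (x (u i) - x (l i))) = (\<Sum>i<n. ennreal (norm (x (u i) - x (l i))))"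
      by (intro sum_ennreal[symmetric]) auto
    also have "\<dots> \<le> (\<Sum>i<n. emeasure \<nu> {l i<..<u i})" using * by (intro sum_mono) auto
    also have "\<dots> = emeasure \<nu> U" unfolding U_def using dis by (intro sum_emeasure) (auto simp: \<nu>_def)
    also have "\<dots> = (\<integral>\<^sup>+x\<in>U. ennreal \<bar>m x\<bar> \<partial>lebesgue)" unfolding \<nu>_def by (subst emeasure_density) auto
    also have "\<dots> \<le> ennreal (\<epsilon>/2)"
    proof (rule \<delta>(2)[OF Um])
      show "emeasure lebesgue U \<le> ennreal \<delta>" unfolding eU using sum by (intro ennreal_leI) auto
    qed
    finally show "(\<Sum>i<n. norm (x (u i) - x (l i))) < \<epsilon>"
      using \<epsilon> by (subst (asm) ennreal_le_iff) auto
  qed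
qed

section \<open>Densities of absolutely continuous functions\<close>

text \<open>Finite sets of intervals are easier to split, unite and sum over than the indexed
  families in \<open>abs_cont_on\<close>. The strict \<open>l < u\<close> excludes empty intervals,
  so that families whose intervals do not meet have no common element.\<close>

definition nonoverlapping :: "real \<Rightarrow> real \<Rightarrow> (real \<times> real) set \<Rightarrow> bool" where
  "nonoverlapping a b P \<longleftrightarrow> finite P \<and> (\<forall>(l, u)\<in>P. a \<le> l \<and> l < u \<and> u \<le> b) \<and>
     (\<forall>p\<in>P. \<forall>q\<in>P. p \<noteq> q \<longrightarrow> {fst p<..<snd p} \<inter> {fst q<..<snd q} = {})"

lemma nonoverlappingD:
  assumes "nonoverlapping a b P"
  shows "finite P" "\<And>l u. (l, u) \<in> P \<Longrightarrow> a \<le> l \<and> l < u \<and> u \<le> b"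
    "\<And>p q. p \<in> P \<Longrightarrow> q \<in> P \<Longrightarrow> p \<noteq> q \<Longrightarrow> {fst p<..<snd p} \<inter> {fst q<..<snd q} = {}"
  using assms unfolding nonoverlapping_def by auto

lemma nonoverlapping_eqI:
  assumes "nonoverlapping a b P" "(l, u) \<in> P" "(l', u') \<in> P" "x \<in> {l<..<u}" "x \<in> {l'<..<u'}"
  shows "l = l' \<and> u = u'"
  using nonoverlappingD(3)[OF assms(1-3)] assms(4,5) by fastforce

lemma sum_lengths_nonoverlapping:
  assumes P: "nonoverlapping a b P" and "a \<le> b"
  shows "(\<Sum>(l, u)\<in>P. u - l) \<le> b - a"
proof -
  have dis: "disjoint_family_on (\<lambda>p. {fst p<..<snd p}) P"
    using nonoverlappingD(3)[OF P] unfolding disjoint_family_on_def by auto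
  have "ennreal (\<Sum>(l, u)\<in>P. u - l) = (\<Sum>p\<in>P. ennreal (snd p - fst p))"
    unfolding case_prod_beta using nonoverlappingD(2)[OF P] by (intro sum_ennreal[symmetric]) force
  also have "\<dots> = (\<Sum>p\<in>P. emeasure lborel {fst p<..<snd p})"
    using nonoverlappingD(2)[OF P] by (intro sum.cong) force+
  also have "\<dots> = emeasure lborel (\<Union>p\<in>P. {fst p<..<snd p})"
    using nonoverlappingD(1)[OF P] dis by (intro sum_emeasure) auto
  also have "\<dots> \<le> emeasure lborel {a..b}"
    using nonoverlappingD(2)[OF P] by (intro emeasure_mono) (force)+
  also have "\<dots> = ennreal (b - a)" using assms by simp
  finally show ?thesis using assms by (simp add: ennreal_le_iff)
qed

lemma abs_cont_on_nonoverlapping: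
  assumes "abs_cont_on a b x" "0 < \<epsilon>"
  obtains \<delta> where "0 < \<delta>"
    "\<And>P. nonoverlapping a b P \<Longrightarrow> (\<Sum>(l, u)\<in>P. u - l) < \<delta> \<Longrightarrow> (\<Sum>(l, u)\<in>P. norm (x u - x l)) < \<epsilon>"
proof -
  obtain \<delta> where \<delta>: "0 < \<delta>" "\<And>(n::nat) l u. (\<forall>i<n. a \<le> l i \<and> l i \<le> u i \<and> u i \<le> b) \<and>
      (\<forall>i<n. \<forall>j<n. i \<noteq> j \<longrightarrow> {l i<..<u i} \<inter> {l j<..<u j} = {}) \<and> (\<Sum>i<n. u i - l i) < \<delta> \<Longrightarrow>
      (\<Sum>i<n. norm (x (u i) - x (l i))) < \<epsilon>"
    using assms unfolding abs_cont_on_def by meson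
  show ?thesis
  proof (rule that[OF \<delta>(1)])
    fix P assume P: "nonoverlapping a b P" and s: "(\<Sum>(l, u)\<in>P. u - l) < \<delta>"
    obtain h where h: "bij_betw h {..<card P} P"
      using ex_bij_betw_nat_finite[OF nonoverlappingD(1)[OF P]] by (auto simp: atLeast0LessThan)
    have hP: "h i \<in> P" if "i < card P" for i using h that by (auto simp: bij_betw_def)
    have inj: "h i \<noteq> h j" if "i < card P" "j < card P" "i \<noteq> j" for i j
      using h that by (auto simp: bij_betw_def inj_on_def)
    have eq: "(\<Sum>i<card P. f (fst (h i)) (snd (h i))) = (\<Sum>(l, u)\<in>P. f l u)" for f :: "real \<Rightarrow> real \<Rightarrow> real"
      using sum.reindex_bij_betw[OF h, of "\<lambda>p. f (fst p) (snd p)"] by (simp add: case_prod_beta)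
    have "(\<Sum>i<card P. norm (x (snd (h i)) - x (fst (h i)))) < \<epsilon>"
    proof (rule \<delta>(2), intro conjI allI impI)
      fix i assume "i < card P"
      from hP[OF this] nonoverlappingD(2)[OF P, of "fst (h i)" "snd (h i)"]
      show "a \<le> fst (h i)" "fst (h i) \<le> snd (h i)" "snd (h i) \<le> b" by auto
    next
      fix i j assume "i < card P" "j < card P" "i \<noteq> j"
      then show "{fst (h i)<..<snd (h i)} \<inter> {fst (h j)<..<snd (h j)} = {}"
        using hP inj by (intro nonoverlappingD(3)[OF P]) auto
    next
      show "(\<Sum>i<card P. snd (h i) - fst (h i)) < \<delta>" using eq[of "\<lambda>l u. u - l"] s by simp
    qed
    then show "(\<Sum>(l, u)\<in>P. norm (x u - x l)) < \<epsilon>" using eq[of "\<lambda>l u. norm (x u - x l)"] by simp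
  qed
qed

lemma nonoverlapping_Un:
  assumes P: "nonoverlapping a b P" and Q: "nonoverlapping a b Q"
    and PQ: "\<And>p q. p \<in> P \<Longrightarrow> q \<in> Q \<Longrightarrow> {fst p<..<snd p} \<inter> {fst q<..<snd q} = {}"
  shows "nonoverlapping a b (P \<union> Q)" "P \<inter> Q = {}"
proof -
  show "nonoverlapping a b (P \<union> Q)"
    unfolding nonoverlapping_def
  proof (intro conjI ballI impI)
    show "finite (P \<union> Q)" using nonoverlappingD(1) P Q by blast
    show "case p of (l, u) \<Rightarrow> a \<le> l \<and> l < u \<and> u \<le> b" if "p \<in> P \<union> Q" for p
      using that nonoverlappingD(2)[OF P] nonoverlappingD(2)[OF Q] by (cases p) blast
    show "{fst p<..<snd p} \<inter> {fst q<..<snd q} = {}" if "p \<in> P \<union> Q" "q \<in> P \<union> Q" "p \<noteq> q" for p q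
      using that PQ[of p q] PQ[of q p] nonoverlappingD(3)[OF P, of p q] nonoverlappingD(3)[OF Q, of p q] by blast
  qed
  show "P \<inter> Q = {}"
  proof (rule ccontr)
    assume "P \<inter> Q \<noteq> {}"
    then obtain l u where *: "(l, u) \<in> P" "(l, u) \<in> Q" by auto
    then have "{l<..<u} = {}" using PQ[of "(l, u)" "(l, u)"] by simp
    moreover have "l < u" using nonoverlappingD(2)[OF P *(1)] by simp
    ultimately show False using greaterThanLessThan_empty_iff by (metis not_less)
  qed
qed

lemma nonoverlapping_mono: "nonoverlapping s t P \<Longrightarrow> a \<le> s \<Longrightarrow> t \<le> b \<Longrightarrow> nonoverlapping a b P"
  unfolding nonoverlapping_def by fastforce

text \<open>Cut every interval at p: the pieces below p form Q, those above form R, and the triangle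
  inequality pays for the at most one interval that contains p in its interior.\<close>

lemma nonoverlapping_split:
  fixes f :: "real \<Rightarrow> 'a::real_normed_vector"
  assumes P: "nonoverlapping s t P"
  obtains Q R where "nonoverlapping s p Q" "nonoverlapping p t R"
    "(\<Sum>(l, u)\<in>P. norm (f u - f l)) \<le> (\<Sum>(l, u)\<in>Q. norm (f u - f l)) + (\<Sum>(l, u)\<in>R. norm (f u - f l))"
proof -
  note fin = nonoverlappingD(1)[OF P]
  define PL where "PL = {q \<in> P. fst q < p}"
  define PR where "PR = {q \<in> P. p < snd q}"
  define L where "L = (\<lambda>q :: real \<times> real. (fst q, min (snd q) p))"
  define R where "R = (\<lambda>q :: real \<times> real. (max (fst q) p, snd q))"
  have finL: "finite PL" "finite PR" using fin by (auto simp: PL_def PR_def)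
  have injL: "inj_on L PL"
  proof (rule inj_onI)
    fix x y assume xy: "x \<in> PL" "y \<in> PL" "L x = L y"
    obtain l u l' u' where e: "x = (l, u)" "y = (l', u')" by (cases x, cases y)
    then have "l < u" "l' < u'" "l < p" "l' < p" "l = l'" using xy nonoverlappingD(2)[OF P] by (auto simp: PL_def L_def)
    \<comment> \<open>Truncation could identify two intervals with the same left end; this midpoint
      lies in both, so they were equal already.\<close>
    then have m: "(l + min (min u p) u') / 2 \<in> {l<..<u}" "(l + min (min u p) u') / 2 \<in> {l'<..<u'}" by (auto simp: min_def)
    have "l = l' \<and> u = u'" by (rule nonoverlapping_eqI[OF P _ _ m]) (use xy in \<open>auto simp: e PL_def\<close>)
    then show "x = y" by (simp add: e)
  qed
  have injR: "inj_on R PR"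
  proof (rule inj_onI)
    fix x y assume xy: "x \<in> PR" "y \<in> PR" "R x = R y"
    obtain l u l' u' where e: "x = (l, u)" "y = (l', u')" by (cases x, cases y)
    then have "l < u" "l' < u'" "p < u" "p < u'" "u = u'" using xy nonoverlappingD(2)[OF P] by (auto simp: PR_def R_def)
    then have m: "(u + max (max l p) l') / 2 \<in> {l<..<u}" "(u + max (max l p) l') / 2 \<in> {l'<..<u'}" by (auto simp: max_def)
    have "l = l' \<and> u = u'" by (rule nonoverlapping_eqI[OF P _ _ m]) (use xy in \<open>auto simp: e PR_def\<close>)
    then show "x = y" by (simp add: e)
  qed
  show ?thesis
  proof (rule that)
    show "nonoverlapping s p (L ` PL)"
      unfolding nonoverlapping_def
    proof (intro conjI ballI impI)
      show "finite (L ` PL)" using finL by auto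
      show "case q of (l, u) \<Rightarrow> s \<le> l \<and> l < u \<and> u \<le> p" if "q \<in> L ` PL" for q
        using that nonoverlappingD(2)[OF P] by (auto simp: L_def PL_def)
      show "{fst q<..<snd q} \<inter> {fst r<..<snd r} = {}" if qr: "q \<in> L ` PL" "r \<in> L ` PL" "q \<noteq> r" for q r
      proof -
        obtain q' r' where "q' \<in> P" "r' \<in> P" "q = L q'" "r = L r'" using qr by (auto simp: PL_def)
        with qr nonoverlappingD(3)[OF P, of q' r'] show ?thesis by (auto simp: L_def set_eq_iff)
      qed
    qed
    show "nonoverlapping p t (R ` PR)"
      unfolding nonoverlapping_def
    proof (intro conjI ballI impI)
      show "finite (R ` PR)" using finL by auto
      show "case q of (l, u) \<Rightarrow> p \<le> l \<and> l < u \<and> u \<le> t" if "q \<in> R ` PR" for q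
        using that nonoverlappingD(2)[OF P] by (auto simp: R_def PR_def)
      show "{fst q<..<snd q} \<inter> {fst r<..<snd r} = {}" if qr: "q \<in> R ` PR" "r \<in> R ` PR" "q \<noteq> r" for q r
      proof -
        obtain q' r' where "q' \<in> P" "r' \<in> P" "q = R q'" "r = R r'" using qr by (auto simp: PR_def)
        with qr nonoverlappingD(3)[OF P, of q' r'] show ?thesis by (auto simp: R_def set_eq_iff)
      qed
    qed
    let ?n = "\<lambda>q. norm (f (snd q) - f (fst q))"
    have "(\<Sum>q\<in>P. ?n q) \<le> (\<Sum>q\<in>P. (if fst q < p then ?n (L q) else 0) + (if p < snd q then ?n (R q) else 0))"
    proof (rule sum_mono)
      fix q assume "q \<in> P"
      have *: "norm (f (snd q) - f (fst q)) \<le> norm (f p - f (fst q)) + norm (f (snd q) - f p)"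
        using norm_triangle_ineq[of "f p - f (fst q)" "f (snd q) - f p"] by simp
      then show "?n q \<le> (if fst q < p then ?n (L q) else 0) + (if p < snd q then ?n (R q) else 0)"
        using nonoverlappingD(2)[OF P, of "fst q" "snd q"] \<open>q \<in> P\<close> by (auto simp: L_def R_def min_def max_def)
    qed
    also have "\<dots> = (\<Sum>q\<in>PL. ?n (L q)) + (\<Sum>q\<in>PR. ?n (R q))"
      unfolding sum.distrib PL_def PR_def using fin by (simp add: sum.If_cases Int_def)
    also have "\<dots> = (\<Sum>q\<in>L ` PL. ?n q) + (\<Sum>q\<in>R ` PR. ?n q)"
      using injL injR by (simp add: sum.reindex)
    finally show "(\<Sum>(l, u)\<in>P. norm (f u - f l)) \<le> (\<Sum>(l, u)\<in>L ` PL. norm (f u - f l)) + (\<Sum>(l, u)\<in>R ` PR. norm (f u - f l))"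
      by (simp add: case_prod_beta)
  qed
qed

lemma nonoverlapping_empty [simp]: "nonoverlapping a b {}" by (simp add: nonoverlapping_def)

text \<open>On a piece of length at most \<delta>/2 every family has variation below 1, so k pieces
  have variation at most k, and finitely many pieces exhaust the interval.\<close>

lemma abs_cont_on_bounded_variation:
  fixes x :: "real \<Rightarrow> 'a::real_normed_vector"
  assumes x: "abs_cont_on a b x" and "a \<le> b"
  obtains K where "\<And>P. nonoverlapping a b P \<Longrightarrow> (\<Sum>(l, u)\<in>P. norm (x u - x l)) \<le> K"
proof -
  obtain \<delta> where \<delta>: "0 < \<delta>"
    "\<And>P. nonoverlapping a b P \<Longrightarrow> (\<Sum>(l, u)\<in>P. u - l) < \<delta> \<Longrightarrow> (\<Sum>(l, u)\<in>P. norm (x u - x l)) < 1"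
    using abs_cont_on_nonoverlapping[OF x, of 1] by auto
  \<comment> \<open>Capped at b, so that the k-th end point equals b for all large k.\<close>
  define r where "r k = min b (a + real k * (\<delta>/2))" for k :: nat
  have bnd: "(\<Sum>(l, u)\<in>P. norm (x u - x l)) \<le> real k" if "nonoverlapping a (r k) P" for k P
    using that
  proof (induction k arbitrary: P)
    case 0
    then have "P = {}" using nonoverlappingD(2)[OF 0] assms by (fastforce simp: r_def)
    then show ?case by simp
  next
    case (Suc k)
    obtain Q R where QR: "nonoverlapping a (r k) Q" "nonoverlapping (r k) (r (Suc k)) R"
      "(\<Sum>(l, u)\<in>P. norm (x u - x l)) \<le> (\<Sum>(l, u)\<in>Q. norm (x u - x l)) + (\<Sum>(l, u)\<in>R. norm (x u - x l))"
      using nonoverlapping_split[OF Suc.prems, of "r k" x] by blast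
    have "r k \<le> r (Suc k)" "a \<le> r k" "r (Suc k) \<le> b" "r (Suc k) - r k \<le> \<delta>/2" using \<delta>(1) assms by (auto simp: r_def min_def field_simps)
    then have "(\<Sum>(l, u)\<in>R. norm (x u - x l)) < 1"
      using sum_lengths_nonoverlapping[OF QR(2)] \<delta>(1)
      by (intro \<delta>(2) nonoverlapping_mono[OF QR(2)]) auto
    with Suc.IH[OF QR(1)] QR(3) show ?case by simp
  qed
  obtain k :: nat where "(b - a) / (\<delta>/2) \<le> real k" using real_arch_simple by blast
  then have "r k = b" using \<delta>(1) by (auto simp: r_def field_simps)
  with bnd[of k] show ?thesis by (intro that[of k]) simp
qed

text \<open>V is the total variation from a to t, additive because families can be cut at a point
  and joined there. It is itself absolutely continuous because refining a family of short intervals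
  does not increase its total length.\<close>

lemma abs_cont_on_variation_function:
  fixes x :: "real \<Rightarrow> 'a::real_normed_vector"
  assumes x: "abs_cont_on a b x" and ab: "a \<le> b"
  obtains V :: "real \<Rightarrow> real" where
    "\<And>s t. a \<le> s \<Longrightarrow> s \<le> t \<Longrightarrow> t \<le> b \<Longrightarrow> norm (x t - x s) \<le> V t - V s"
    "\<And>\<epsilon>. 0 < \<epsilon> \<Longrightarrow> \<exists>\<delta>>0. \<forall>P. nonoverlapping a b P \<and> (\<Sum>(l, u)\<in>P. u - l) < \<delta> \<longrightarrow> (\<Sum>(l, u)\<in>P. V u - V l) \<le> \<epsilon>"
proof -
  let ?S = "\<lambda>P. \<Sum>(l, u)\<in>P. norm (x u - x l)"
  obtain K where K: "\<And>P. nonoverlapping a b P \<Longrightarrow> ?S P \<le> K"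
    using abs_cont_on_bounded_variation[OF x ab] by blast
  define V where "V t = Sup (?S ` {P. nonoverlapping a t P})" for t
  have upper: "?S P \<le> V t" if "nonoverlapping a t P" "t \<le> b" for t P
    unfolding V_def using that K nonoverlapping_mono[of a t _ a b] by (intro cSUP_upper bdd_aboveI[of _ K]) auto
  have least: "V t \<le> c" if "\<And>P. nonoverlapping a t P \<Longrightarrow> ?S P \<le> c" for t c
    unfolding V_def using that nonoverlapping_empty[of a t] by (intro cSUP_least) blast+
  have diff_le: "V t - V s \<le> c" if "a \<le> s" "s \<le> t" "t \<le> b" and c: "\<And>P. nonoverlapping s t P \<Longrightarrow> ?S P \<le> c" for s t c
  proof -
    have "V t \<le> V s + c"
    proof (rule least)
      fix P assume "nonoverlapping a t P"
      then obtain Q R where "nonoverlapping a s Q" "nonoverlapping s t R" "?S P \<le> ?S Q + ?S R"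
        using nonoverlapping_split[of a t P s x] by blast
      moreover have "?S Q \<le> V s" using calculation that by (intro upper) auto
      ultimately show "?S P \<le> V s + c" using c[of R] by simp
    qed
    then show ?thesis by simp
  qed
  have sep: "nonoverlapping a t (P \<union> Q) \<and> P \<inter> Q = {}"
    if "a \<le> s" "s \<le> t" and P: "nonoverlapping a s P" and Q: "nonoverlapping s t Q" for s t P Q
  proof -
    have "{fst p<..<snd p} \<inter> {fst q<..<snd q} = {}" if "p \<in> P" "q \<in> Q" for p q
      using nonoverlappingD(2)[OF P, of "fst p" "snd p"] nonoverlappingD(2)[OF Q, of "fst q" "snd q"] that by auto
    then show ?thesis
      using nonoverlapping_Un[OF nonoverlapping_mono[OF P, of a t] nonoverlapping_mono[OF Q, of a t]] that by auto
  qed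
  have diff_ge: "?S Q \<le> V t - V s" if "a \<le> s" "s \<le> t" "t \<le> b" and Q: "nonoverlapping s t Q" for s t Q
  proof -
    have "V s \<le> V t - ?S Q"
    proof (rule least)
      fix P assume P: "nonoverlapping a s P"
      have u: "nonoverlapping a t (P \<union> Q)" "P \<inter> Q = {}" using sep[OF that(1,2) P Q] by auto
      have "?S P + ?S Q = ?S (P \<union> Q)"
        using u nonoverlappingD(1)[OF P] nonoverlappingD(1)[OF Q] by (intro sum.union_disjoint[symmetric]) auto
      also have "\<dots> \<le> V t" using u that by (intro upper) auto
      finally show "?S P \<le> V t - ?S Q" by simp
    qed
    then show ?thesis by simp
  qed
  show ?thesis
  proof (rule that)
    fix s t assume st: "a \<le> s" "s \<le> t" "t \<le> b"
    show "norm (x t - x s) \<le> V t - V s"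
    proof (cases "s = t")
      case False
      then have "nonoverlapping s t {(s, t)}" using st by (auto simp: nonoverlapping_def)
      from diff_ge[OF st this] show ?thesis by simp
    qed simp
  next
    fix \<epsilon> :: real assume "0 < \<epsilon>"
    obtain \<delta> where \<delta>: "0 < \<delta>" "\<And>P. nonoverlapping a b P \<Longrightarrow> (\<Sum>(l, u)\<in>P. u - l) < \<delta> \<Longrightarrow> ?S P < \<epsilon>"
      using abs_cont_on_nonoverlapping[OF x \<open>0 < \<epsilon>\<close>] by blast
    \<comment> \<open>Trade the intervals of \<open>Q\<close> for finer families one at a time, collecting the latter in \<open>F\<close>.\<close>
    have main: "(\<Sum>(l, u)\<in>Q. V u - V l) + ?S F \<le> \<epsilon>"
      if "finite Q" "nonoverlapping a b (Q \<union> F)" "Q \<inter> F = {}" "(\<Sum>(l, u)\<in>Q \<union> F. u - l) < \<delta>" for Q F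
      using that
    proof (induction Q arbitrary: F rule: finite_induct)
      case empty
      then show ?case using \<delta>(2)[of F] by auto
    next
      case (insert p Q)
      obtain l u where p: "p = (l, u)" by (cases p)
      note PQ = nonoverlappingD[OF insert.prems(1)]
      have lu: "a \<le> l" "l < u" "u \<le> b" using PQ(2)[of l u] p by auto
      have "V u - V l \<le> \<epsilon> - (\<Sum>(l, u)\<in>Q. V u - V l) - ?S F"
      proof (rule diff_le)
        fix G assume G: "nonoverlapping l u G"
        have QF: "nonoverlapping a b (Q \<union> F)" using insert.prems(1) unfolding nonoverlapping_def by auto
        have dis: "{fst q<..<snd q} \<inter> {fst r<..<snd r} = {}" if "q \<in> Q \<union> F" "r \<in> G" for q r
        proof -
          have "q \<noteq> p" using that insert.prems insert.hyps by auto
          then have "{fst q<..<snd q} \<inter> {l<..<u} = {}" using PQ(3)[of q p] that p by auto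
          moreover have "{fst r<..<snd r} \<subseteq> {l<..<u}" using nonoverlappingD(2)[OF G, of "fst r" "snd r"] that by auto
          ultimately show ?thesis by blast
        qed
        have all: "nonoverlapping a b (Q \<union> F \<union> G)" "(Q \<union> F) \<inter> G = {}"
          using nonoverlapping_Un[OF QF nonoverlapping_mono[OF G] dis] lu by auto
        have fin: "finite Q" "finite F" "finite G" using all nonoverlappingD(1)[OF all(1)] by auto
        have len: "(\<Sum>(l, u)\<in>Q \<union> (F \<union> G). u - l) < \<delta>"
        proof -
          have "(\<Sum>(l, u)\<in>Q \<union> (F \<union> G). u - l) = (\<Sum>(l, u)\<in>Q \<union> F. u - l) + (\<Sum>(l, u)\<in>G. u - l)"
            using fin all by (subst sum.union_disjoint[symmetric]) (auto simp: Un_assoc)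
          also have "\<dots> \<le> (\<Sum>(l, u)\<in>Q \<union> F. u - l) + (u - l)"
            using sum_lengths_nonoverlapping[OF G] lu by simp
          also have "\<dots> = (\<Sum>(l, u)\<in>insert p Q \<union> F. u - l)"
          proof -
            have "p \<notin> Q \<union> F" using insert by auto
            then show ?thesis using fin p by simp
          qed
          finally show ?thesis using insert.prems by simp
        qed
        have "(\<Sum>(l, u)\<in>Q. V u - V l) + ?S (F \<union> G) \<le> \<epsilon>"
          using all insert.prems len by (intro insert.IH) (auto simp: Un_assoc)
        moreover have "?S (F \<union> G) = ?S F + ?S G" using fin all by (intro sum.union_disjoint) auto
        ultimately show "?S G \<le> \<epsilon> - (\<Sum>(l, u)\<in>Q. V u - V l) - ?S F" by simp
      qed (use lu in auto)
      then show ?case using insert.hyps p by simp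
    qed
    show "\<exists>\<delta>>0. \<forall>P. nonoverlapping a b P \<and> (\<Sum>(l, u)\<in>P. u - l) < \<delta> \<longrightarrow> (\<Sum>(l, u)\<in>P. V u - V l) \<le> \<epsilon>"
    proof (intro exI[of _ \<delta>] conjI allI impI \<delta>(1))
      fix P assume "nonoverlapping a b P \<and> (\<Sum>(l, u)\<in>P. u - l) < \<delta>"
      then show "(\<Sum>(l, u)\<in>P. V u - V l) \<le> \<epsilon>" using main[of P "{}"] nonoverlappingD(1)[of a b P] by auto
    qed
  qed
qed


section \<open>The variation measure and its Radon-Nikodym density\<close>

text \<open>The Lebesgue-Stieltjes measure of the total variation vanishes on Lebesgue null sets;
  its Radon-Nikodym derivative is the density. Working with the variation makes the argument scalar
  whatever the values of x.\<close>

lemma abs_cont_on_imp_density: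
  fixes x :: "real \<Rightarrow> 'a::real_normed_vector"
  assumes x: "abs_cont_on a b x" and ab: "a < b"
  obtains m :: "real \<Rightarrow> real" where "integrable lebesgue m" "\<And>t. 0 \<le> m t"
    "\<And>s t. a \<le> s \<Longrightarrow> s \<le> t \<Longrightarrow> t \<le> b \<Longrightarrow> norm (x t - x s) \<le> (LINT r:{s..t}|lebesgue. m r)"
proof -
  obtain V :: "real \<Rightarrow> real" where
    V: "\<And>s t. a \<le> s \<Longrightarrow> s \<le> t \<Longrightarrow> t \<le> b \<Longrightarrow> norm (x t - x s) \<le> V t - V s"
    and VAC: "\<And>\<epsilon>. 0 < \<epsilon> \<Longrightarrow> \<exists>\<delta>>0. \<forall>P. nonoverlapping a b P \<and> (\<Sum>(l, u)\<in>P. u - l) < \<delta> \<longrightarrow> (\<Sum>(l, u)\<in>P. V u - V l) \<le> \<epsilon>"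
    using abs_cont_on_variation_function[OF x] ab by auto
  have Vmono: "V s \<le> V t" if "a \<le> s" "s \<le> t" "t \<le> b" for s t
    using V[OF that] norm_ge_zero[of "x t - x s"] by linarith
  \<comment> \<open>Clamping time to the interval extends V by constants, so the measure built from
    W is carried by \<open>{a<..b}\<close>.\<close>
  define c where "c t = max a (min t b)" for t
  define W where "W t = V (c t)" for t
  have cr: "a \<le> c t" "c t \<le> b" for t using ab by (auto simp: c_def)
  have Wmono: "W s \<le> W t" if "s \<le> t" for s t
    unfolding W_def using that ab by (intro Vmono cr) (auto simp: c_def)
  have Wc: "W t = V t" if "a \<le> t" "t \<le> b" for t using that by (auto simp: W_def c_def min_def)
  have cont: "isCont W t" for t
    unfolding continuous_at_eps_delta
  proof (intro allI impI)
    fix e :: real assume "0 < e"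
    obtain \<delta> where \<delta>: "\<delta> > 0" "\<And>P. nonoverlapping a b P \<Longrightarrow> (\<Sum>(l, u)\<in>P. u - l) < \<delta> \<Longrightarrow> (\<Sum>(l, u)\<in>P. V u - V l) \<le> e/2"
      using VAC[of "e/2"] \<open>0 < e\<close> by auto
    have *: "W q - W p \<le> e/2" if "p \<le> q" "q - p < \<delta>" for p q
    proof (cases "c p < c q")
      case True
      have "c q - c p \<le> q - p" using that by (auto simp: c_def max_def min_def)
      then show ?thesis using \<delta>(2)[of "{(c p, c q)}"] that True cr by (auto simp: nonoverlapping_def W_def)
    next
      case False
      have "c p \<le> c q" using that by (auto simp: c_def)
      with False have "c p = c q" by simp
      then show ?thesis using \<open>0 < e\<close> by (simp add: W_def)
    qed
    show "\<exists>d>0. \<forall>y. dist y t < d \<longrightarrow> dist (W y) (W t) < e"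
    proof (intro exI[of _ \<delta>] conjI allI impI \<delta>(1))
      fix y assume "dist y t < \<delta>"
      then show "dist (W y) (W t) < e"
        using *[of y t] *[of t y] Wmono[of y t] Wmono[of t y] \<open>0 < e\<close> by (cases "y \<le> t") (auto simp: dist_real_def)
    qed
  qed
  define \<nu> where "\<nu> = interval_measure W"
  have Ioc: "emeasure \<nu> {s<..t} = ennreal (W t - W s)" if "s \<le> t" for s t
    unfolding \<nu>_def using that Wmono cont by (intro emeasure_interval_measure_Ioc) (auto intro: continuous_at_imp_continuous_at_within)
  have sets_nu[simp, measurable_cong]: "sets \<nu> = sets borel" and space_nu[simp]: "space \<nu> = UNIV" by (auto simp: \<nu>_def)
  have tot: "emeasure \<nu> UNIV \<le> ennreal (V b - V a)"
  proof -
    have U: "(\<Union>n::nat. {- real n<..real n}) = UNIV"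
    proof -
      have "\<exists>n::nat. - real n < x \<and> x \<le> real n" for x :: real
        by (rule exI[of _ "nat \<lceil>\<bar>x\<bar>\<rceil> + 1"]) linarith
      then show ?thesis by auto
    qed
    have "emeasure \<nu> UNIV = (SUP n. emeasure \<nu> {- real n<..real n})"
      unfolding U[symmetric] by (intro SUP_emeasure_incseq[symmetric]) (auto simp: incseq_def)
    also have "\<dots> \<le> ennreal (V b - V a)"
    proof (rule SUP_least)
      fix n :: nat
      show "emeasure \<nu> {- real n<..real n} \<le> ennreal (V b - V a)"
      proof (subst Ioc)
        have "W (real n) \<le> V b" "V a \<le> W (- real n)" unfolding W_def using cr ab by (auto intro!: Vmono)
        then show "ennreal (W (real n) - W (- real n)) \<le> ennreal (V b - V a)" by (intro ennreal_leI) auto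
      qed auto
    qed
    finally show ?thesis .
  qed
  then have fin: "emeasure \<nu> UNIV \<noteq> \<infinity>" by (auto simp: top_unique)
  interpret \<nu>: finite_measure \<nu> by standard (use fin in auto)
  have out: "emeasure \<nu> (UNIV - {a<..b}) = 0"
  proof -
    have "emeasure \<nu> (UNIV - {a<..b}) = emeasure \<nu> UNIV - emeasure \<nu> {a<..b}"
      using \<nu>.emeasure_finite by (intro emeasure_Diff) auto
    also have "emeasure \<nu> {a<..b} = ennreal (V b - V a)" using ab by (subst Ioc) (auto simp: Wc)
    finally show ?thesis using tot \<nu>.emeasure_finite[of UNIV]
      by (simp add: diff_eq_0_iff_ennreal top.not_eq_extremum del: \<nu>.emeasure_finite)
  qed
  \<comment> \<open>By inner regularity compact sets suffice, and for them a finite cover by short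
    intervals is available, as absolute continuity of V requires.\<close>
  have compact_null: "emeasure \<nu> K = 0" if K: "compact K" "emeasure lborel K = 0" for K
  proof -
    have Km: "K \<in> sets borel" using K by (simp add: compact_imp_closed)
    have le: "emeasure \<nu> K \<le> ennreal e" if "e > 0" for e
    proof -
      obtain \<delta> where \<delta>: "\<delta> > 0" "\<And>P. nonoverlapping a b P \<Longrightarrow> (\<Sum>(l, u)\<in>P. u - l) < \<delta> \<Longrightarrow> (\<Sum>(l, u)\<in>P. V u - V l) \<le> e"
        using VAC[OF \<open>e > 0\<close>] by auto
      obtain U where U: "open U" "K \<subseteq> U" "emeasure lborel (U - K) < ennreal \<delta>"
        using outer_regular_lborel[of K \<delta>] Km \<delta>(1) by blast
      have Um: "U \<in> sets borel" using U by auto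
      have "emeasure lborel U \<le> emeasure lborel (U - K) + emeasure lborel K"
        using Um Km by (intro emeasure_subadditive[THEN order_trans[rotated]] emeasure_mono) auto
      then have U\<delta>: "emeasure lborel U < ennreal \<delta>" using U K by simp
      obtain h where h: "h > 0" "(\<Union>x\<in>K. ball x h) \<subseteq> U"
        using compact_subset_open_imp_ball_epsilon_subset[OF K(1) U(1,2)] by blast
      obtain N :: nat where N: "(b - a) / h < real N" using reals_Archimedean2 by blast
      have N0: "N > 0" using N ab h(1) by (cases N) (auto simp: field_simps)
      define w where "w = (b - a) / real N"
      have w: "0 < w" "w < h" using N N0 ab h(1) by (auto simp: w_def field_simps)
      define l where "l j = a + real j * w" for j :: nat
      have lN: "l N = b" using N0 by (simp add: l_def w_def)
      have lmono: "l i \<le> l j" if "i \<le> j" for i j using that w by (auto simp: l_def)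
      have lS: "l j < l (Suc j)" "l (Suc j) = l j + w" for j using w by (auto simp: l_def algebra_simps)
      \<comment> \<open>Grid cells that meet K. Their width is below h, the distance within which U
        surrounds K, so they lie in U and have total length below \<delta>.\<close>
      define J where "J = {j. j < N \<and> {l j<..l (Suc j)} \<inter> K \<noteq> {}}"
      have finJ: "finite J" by (auto simp: J_def)
      have cellU: "{l j<..l (Suc j)} \<subseteq> U" if jJ: "j \<in> J" for j
      proof
        fix y assume y: "y \<in> {l j<..l (Suc j)}"
        obtain k where k: "k \<in> K" "k \<in> {l j<..l (Suc j)}" using jJ unfolding J_def by blast
        then have "dist k y < h" using y w lS[of j] by (auto simp: dist_real_def)
        then have "y \<in> ball k h" by simp
        then show "y \<in> U" using h(2) k(1) by blast
      qed
      have disj: "disjoint_family_on (\<lambda>j. {l j<..l (Suc j)}) J"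
      proof -
        have "{l i<..l (Suc i)} \<inter> {l j<..l (Suc j)} = {}" if "i < j" for i j
          using lmono[of "Suc i" j] that by auto
        then show ?thesis unfolding disjoint_family_on_def by (metis Int_commute linorder_neqE_nat)
      qed
      define P where "P = (\<lambda>j. (l j, l (Suc j))) ` J"
      have inj: "inj_on (\<lambda>j. (l j, l (Suc j))) J"
        using w by (auto simp: inj_on_def l_def)
      have sumP: "(\<Sum>(p, q)\<in>P. f p q) = (\<Sum>j\<in>J. f (l j) (l (Suc j)))" for f :: "real \<Rightarrow> real \<Rightarrow> real"
        unfolding P_def by (subst sum.reindex[OF inj]) simp
      have rng: "a \<le> l j" "l (Suc j) \<le> b" if "j \<in> J" for j
      proof -
        show "a \<le> l j" using w by (simp add: l_def)
        show "l (Suc j) \<le> b" using lmono[of "Suc j" N] that lN by (auto simp: J_def)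
      qed
      have "nonoverlapping a b P"
        unfolding nonoverlapping_def
      proof (intro conjI ballI impI)
        show "finite P" using finJ by (simp add: P_def)
        show "case p of (l, u) \<Rightarrow> a \<le> l \<and> l < u \<and> u \<le> b" if "p \<in> P" for p
          using that rng lS by (auto simp: P_def)
        fix p q assume pq: "p \<in> P" "q \<in> P" "p \<noteq> q"
        then obtain i j where ij: "i \<in> J" "j \<in> J" "i \<noteq> j" "p = (l i, l (Suc i))" "q = (l j, l (Suc j))"
          by (auto simp: P_def)
        then have "{l i<..l (Suc i)} \<inter> {l j<..l (Suc j)} = {}" using disj by (auto simp: disjoint_family_on_def)
        then show "{fst p<..<snd p} \<inter> {fst q<..<snd q} = {}" using ij by fastforce
      qed
      moreover have "(\<Sum>(l, u)\<in>P. u - l) < \<delta>"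
      proof -
        have "ennreal (\<Sum>(l, u)\<in>P. u - l) = (\<Sum>j\<in>J. ennreal (l (Suc j) - l j))"
          unfolding sumP using lS by (intro sum_ennreal[symmetric]) (simp add: less_imp_le)
        also have "\<dots> = (\<Sum>j\<in>J. emeasure lborel {l j<..l (Suc j)})"
          using lS by (intro sum.cong) (auto simp: less_imp_le)
        also have "\<dots> = emeasure lborel (\<Union>j\<in>J. {l j<..l (Suc j)})"
          using finJ disj by (intro sum_emeasure) auto
        also have "\<dots> \<le> emeasure lborel U" using cellU Um by (intro emeasure_mono) auto
        also have "\<dots> < ennreal \<delta>" by (rule U\<delta>)
        finally show ?thesis using \<delta>(1) w by (subst (asm) ennreal_less_iff)
          (auto intro!: sum_nonneg simp: P_def lS less_imp_le)
      qed
      ultimately have Ve: "(\<Sum>j\<in>J. V (l (Suc j)) - V (l j)) \<le> e"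
        using \<delta>(2)[of P] sumP[of "\<lambda>l u. V u - V l"] by simp
      have cover: "K \<inter> {a<..b} \<subseteq> (\<Union>j\<in>J. {l j<..l (Suc j)})"
      proof
        fix y assume y: "y \<in> K \<inter> {a<..b}"
        \<comment> \<open>The cells are open on the left and closed on the right, hence the ceiling
          minus one and not the floor.\<close>
        define j where "j = nat (\<lceil>(y - a) / w\<rceil> - 1)"
        have pos: "(y - a) / w > 0" using y w by auto
        have j: "real j = of_int \<lceil>(y - a) / w\<rceil> - 1" using pos by (simp add: j_def)
        have "real j < (y - a) / w" "(y - a) / w \<le> real j + 1" unfolding j by linarith+
        then have 1: "l j < y" "y \<le> l (Suc j)" using w by (auto simp: l_def field_simps)
        have "j < N"
        proof (rule ccontr)
          assume "\<not> j < N"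
          then have "b \<le> l j" using lmono[of N j] lN by auto
          then show False using 1 y by auto
        qed
        then have "j \<in> J" using 1 y unfolding J_def by fastforce
        then show "y \<in> (\<Union>j\<in>J. {l j<..l (Suc j)})" using 1 by auto
      qed
      have "emeasure \<nu> K \<le> emeasure \<nu> ((\<Union>j\<in>J. {l j<..l (Suc j)}) \<union> (UNIV - {a<..b}))"
        using cover by (intro emeasure_mono) auto
      also have "\<dots> \<le> emeasure \<nu> (\<Union>j\<in>J. {l j<..l (Suc j)}) + emeasure \<nu> (UNIV - {a<..b})"
        using finJ by (intro emeasure_subadditive) auto
      also have "\<dots> = emeasure \<nu> (\<Union>j\<in>J. {l j<..l (Suc j)})" using out by simp
      also have "\<dots> = (\<Sum>j\<in>J. emeasure \<nu> {l j<..l (Suc j)})"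
        using finJ disj by (intro sum_emeasure[symmetric]) auto
      also have "\<dots> = (\<Sum>j\<in>J. ennreal (V (l (Suc j)) - V (l j)))"
      proof (intro sum.cong refl)
        fix j assume j: "j \<in> J"
        have r: "a \<le> l j" "l j \<le> b" "a \<le> l (Suc j)" "l (Suc j) \<le> b" "l j \<le> l (Suc j)"
          using rng[OF j] lS(1)[of j] by auto
        show "emeasure \<nu> {l j<..l (Suc j)} = ennreal (V (l (Suc j)) - V (l j))" using r by (simp add: Ioc Wc)
      qed
      also have "\<dots> = ennreal (\<Sum>j\<in>J. V (l (Suc j)) - V (l j))"
        using rng lS by (intro sum_ennreal) (auto intro!: Vmono simp: less_imp_le)
      also have "\<dots> \<le> ennreal e" using Ve by (rule ennreal_leI)
      finally show ?thesis .
    qed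
    show ?thesis
    proof (rule ccontr)
      assume "emeasure \<nu> K \<noteq> 0"
      then have "measure \<nu> K > 0" by (simp add: \<nu>.emeasure_eq_measure zero_less_measure_iff)
      with le[of "measure \<nu> K / 2"] show False by (simp add: \<nu>.emeasure_eq_measure)
    qed
  qed
  have "absolutely_continuous lborel \<nu>"
    unfolding absolutely_continuous_def
  proof
    fix N :: "real set" assume N: "N \<in> null_sets lborel"
    have Nb: "N \<in> sets borel" using N by auto
    have "emeasure \<nu> N = (SUP K\<in>{K. K \<subseteq> N \<and> compact K}. emeasure \<nu> K)"
      using fin Nb by (intro inner_regular) auto
    also have "\<dots> \<le> 0"
    proof (rule SUP_least)
      fix K assume "K \<in> {K. K \<subseteq> N \<and> compact K}"
      then have K: "K \<subseteq> N" "compact K" by auto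
      then have "emeasure lborel K \<le> emeasure lborel N" using Nb by (intro emeasure_mono) auto
      then have "emeasure lborel K = 0" using N by auto
      then show "emeasure \<nu> K \<le> 0" using compact_null K by auto
    qed
    finally show "N \<in> null_sets \<nu>" using Nb by auto
  qed
  then obtain f where f[measurable]: "f \<in> borel_measurable lborel" and fd: "density lborel f = \<nu>"
    using sigma_finite_measure.Radon_Nikodym[OF sigma_finite_lborel, of \<nu>] by auto
  have fint: "(\<integral>\<^sup>+x. f x \<partial>lborel) \<noteq> \<infinity>"
  proof -
    have "emeasure \<nu> UNIV = (\<integral>\<^sup>+x. f x \<partial>lborel)" unfolding fd[symmetric] by (subst emeasure_density) auto
    then show ?thesis using fin by simp
  qed
  have fAE: "AE x in lborel. f x = ennreal (enn2real (f x))"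
    using nn_integral_noteq_infinite[OF f fint] by eventually_elim (simp add: less_top)
  \<comment> \<open>The density has finite integral, so it is finite almost everywhere and the
    conversion to a real function changes it on a null set only.\<close>
  define m where "m x = enn2real (f x)" for x
  have mm[measurable]: "m \<in> borel_measurable lborel" unfolding m_def by measurable
  have mi: "integrable lborel m"
  proof (rule integrableI_nonneg)
    have "(\<integral>\<^sup>+x. ennreal (m x) \<partial>lborel) = (\<integral>\<^sup>+x. f x \<partial>lborel)"
      using fAE by (intro nn_integral_cong_AE) (auto simp: m_def elim!: eventually_mono)
    then show "(\<integral>\<^sup>+x. ennreal (m x) \<partial>lborel) < \<infinity>" using fint by (simp add: less_top)
  qed (auto simp: m_def)
  have ml: "integrable lebesgue m" using mi by (simp add: integrable_completion)
  show ?thesis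
  proof (rule that[OF ml])
    show "0 \<le> m t" for t by (simp add: m_def)
    fix s t assume st: "a \<le> s" "s \<le> t" "t \<le> b"
    have "ennreal (V t - V s) = emeasure \<nu> {s<..t}" using st by (subst Ioc) (auto simp: Wc)
    also have "\<dots> = (\<integral>\<^sup>+x\<in>{s<..t}. f x \<partial>lborel)" unfolding fd[symmetric] by (subst emeasure_density) auto
    also have "\<dots> = (\<integral>\<^sup>+x\<in>{s..t}. ennreal \<bar>m x\<bar> \<partial>lborel)"
      using fAE AE_lborel_singleton[of s] by (intro nn_integral_cong_AE, eventually_elim) (auto simp: m_def indicator_def)
    also have "\<dots> = (\<integral>\<^sup>+x\<in>{s..t}. ennreal \<bar>m x\<bar> \<partial>lebesgue)" by (simp add: nn_integral_completion)
    also have "\<dots> = ennreal (LINT r:{s..t}|lebesgue. m r)"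
      by (subst nn_integral_interval_eq[OF ml]) (simp add: m_def[abs_def])
    finally have "V t - V s = (LINT r:{s..t}|lebesgue. m r)"
      using Vmono[OF st] by (subst (asm) ennreal_inj)
        (auto simp: set_lebesgue_integral_def m_def intro!: Bochner_Integration.integral_nonneg)
    then show "norm (x t - x s) \<le> (LINT r:{s..t}|lebesgue. m r)" using V[OF st] by simp
  qed
qed

section \<open>Fubini for the completed Lebesgue measure\<close>

text \<open>A function measurable for the completion is a limit of simple functions. Each of them is
  altered on a null set, and countably many alterations still add up to a null set.\<close>

lemma completion_ex_borel_measurable_banach:
  fixes g :: "'a \<Rightarrow> 'b::{banach,second_countable_topology}"
  assumes g: "g \<in> borel_measurable (completion M)"
  obtains g' where "g' \<in> borel_measurable M" "AE x in M. g x = g' x"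
proof -
  obtain s where s: "\<And>i. simple_function (completion M) (s i)" "\<And>x. x \<in> space M \<Longrightarrow> (\<lambda>i. s i x) \<longlonglongrightarrow> g x"
    using borel_measurable_implies_sequence_metric[OF g, of 0] by auto
  obtain s' where s': "\<And>i. simple_function M (s' i)" "\<And>i. AE x in M. s i x = s' i x"
    using s(1)[THEN completion_ex_simple_function] by metis
  show ?thesis
  proof (rule that[of "\<lambda>x. lim (\<lambda>i. s' i x)"])
    show "(\<lambda>x. lim (\<lambda>i. s' i x)) \<in> borel_measurable M"
      using s'(1) by (intro borel_measurable_lim_metric borel_measurable_simple_function)
    have "AE x in M. \<forall>i. s i x = s' i x" unfolding AE_all_countable using s'(2) by blast
    with AE_space show "AE x in M. g x = lim (\<lambda>i. s' i x)"
    proof eventually_elim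
      case (elim x)
      then show ?case using s(2)[of x] by (simp add: limI)
    qed
  qed
qed

lemma borel_measurable_completion_AE:
  fixes f :: "'a \<Rightarrow> 'b::topological_space"
  assumes g: "g \<in> borel_measurable M" and ae: "AE x in M. f x = g x"
  shows "f \<in> borel_measurable (completion M)"
proof (rule measurableI)
  fix A :: "'b set" assume A: "A \<in> sets borel"
  interpret completion: complete_measure "completion M" ..
  have 1: "g -` A \<inter> space (completion M) \<in> sets (completion M)"
    by (rule measurable_sets[OF measurable_completion[OF g] A])
  have 2: "AE x in completion M. x \<in> g -` A \<inter> space (completion M) \<longleftrightarrow> x \<in> f -` A \<inter> space (completion M)"
    using AE_completion[OF ae] by eventually_elim auto
  show "f -` A \<inter> space (completion M) \<in> sets (completion M)"
    by (rule completion.in_sets_AE[OF 2 1]) auto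
qed simp

text \<open>Lebesgue measure on the plane is the completion of a product, and sections of a Lebesgue
  measurable function are measurable for almost every t only. Fubini is applied to a Borel
  representative and carried back along almost every section.\<close>

lemma lebesgue_Fubini:
  fixes f :: "real \<times> real \<Rightarrow> 'b::{banach,second_countable_topology}"
  assumes f: "integrable lebesgue f"
  shows "AE t in lebesgue. integrable lebesgue (\<lambda>s. f (t, s))"
    and "integrable lebesgue (\<lambda>t. LINT s|lebesgue. f (t, s))"
proof -
  obtain f' where f'[measurable]: "f' \<in> borel_measurable lborel" and ff': "AE x in lborel. f x = f' x"
    using completion_ex_borel_measurable_banach[of f lborel] f by auto
  have "integrable lebesgue f'"
    by (rule integrable_cong_AE_imp[OF f measurable_completion[OF f'] AE_completion[OF ff']])
  then have int': "integrable (lborel \<Otimes>\<^sub>M lborel) f'"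
    using f' by (simp only: lborel_prod integrable_completion)
  have "AE p in lborel \<Otimes>\<^sub>M lborel. f p = f' p" unfolding lborel_prod by (rule ff')
  then have ae: "AE t in lborel. AE s in lborel. f (t, s) = f' (t, s)"
    by (rule lborel_pair.AE_pair)
  have aei: "AE t in lborel. integrable lborel (\<lambda>s. f' (t, s))"
    using lborel_pair.AE_integrable_fst'[OF int'] .
  have both: "AE t in lborel. integrable lebesgue (\<lambda>s. f (t, s)) \<and> (LINT s|lebesgue. f (t, s)) = (LINT s|lborel. f' (t, s))"
    using ae aei
  proof eventually_elim
    case (elim t)
    have m': "(\<lambda>s. f' (t, s)) \<in> borel_measurable lborel" using elim by auto
    have m: "(\<lambda>s. f (t, s)) \<in> borel_measurable lebesgue" by (rule borel_measurable_completion_AE[OF m' elim(1)])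
    have i': "integrable lebesgue (\<lambda>s. f' (t, s))" using elim m' by (simp add: integrable_completion)
    have ae': "AE s in lebesgue. f' (t, s) = f (t, s)" using AE_completion[OF elim(1)] by eventually_elim simp
    have "integrable lebesgue (\<lambda>s. f (t, s))" by (rule integrable_cong_AE_imp[OF i' m ae'])
    moreover have "(LINT s|lebesgue. f (t, s)) = (LINT s|lebesgue. f' (t, s))"
      using m i' ae' by (intro integral_cong_AE) (auto elim: eventually_mono)
    moreover have "\<dots> = (LINT s|lborel. f' (t, s))" using m' by (simp add: integral_completion)
    ultimately show ?case by simp
  qed
  show "AE t in lebesgue. integrable lebesgue (\<lambda>s. f (t, s))"
    using AE_completion[OF both] by eventually_elim simp
  have I: "integrable lborel (\<lambda>t. LINT s|lborel. f' (t, s))"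
    using lborel_pair.integrable_fst'[OF int'] .
  have Il: "integrable lebesgue (\<lambda>t. LINT s|lborel. f' (t, s))"
    using I borel_measurable_integrable[OF I] by (simp add: integrable_completion)
  show "integrable lebesgue (\<lambda>t. LINT s|lebesgue. f (t, s))"
  proof (rule integrable_cong_AE_imp[OF Il])
    show "AE t in lebesgue. (LINT s|lborel. f' (t, s)) = (LINT s|lebesgue. f (t, s))"
      using AE_completion[OF both] by eventually_elim simp
    show "(\<lambda>t. LINT s|lebesgue. f (t, s)) \<in> borel_measurable lebesgue"
      using both by (intro borel_measurable_completion_AE[OF borel_measurable_integrable[OF I]]) (auto elim: eventually_mono)
  qed
qed

section \<open>Convex combinations of tails\<close>

text \<open>Convex weights with support in \<open>{k..<N}\<close>. As functions on all naturals that
  vanish off this range, two of them can be averaged once N is raised to a common value.\<close>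

definition tail_weights :: "nat \<Rightarrow> nat \<Rightarrow> (nat \<Rightarrow> real) \<Rightarrow> bool" where
  "tail_weights k N w \<longleftrightarrow> (\<forall>i. 0 \<le> w i) \<and> (\<forall>i. i < k \<or> N \<le> i \<longrightarrow> w i = 0) \<and> (\<Sum>i<N. w i) = 1"

lemma tail_weights_extend:
  assumes "tail_weights k N w" "N \<le> N'"
  shows "tail_weights k N' w" "(\<Sum>i<N'. w i *\<^sub>R a i) = (\<Sum>i<N. w i *\<^sub>R (a i :: 'a::real_vector))"
proof -
  have eq: "(\<Sum>i<N'. w i *\<^sub>R b i) = (\<Sum>i<N. w i *\<^sub>R (b i :: 'c::real_vector))" for b
    using assms by (intro sum.mono_neutral_right) (auto simp: tail_weights_def)
  then show "(\<Sum>i<N'. w i *\<^sub>R a i) = (\<Sum>i<N. w i *\<^sub>R a i)" .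
  show "tail_weights k N' w" using assms eq[of "\<lambda>_. 1::real"] by (auto simp: tail_weights_def)
qed

lemma tail_weights_antimono: "tail_weights k N w \<Longrightarrow> j \<le> k \<Longrightarrow> tail_weights j N w"
  unfolding tail_weights_def by (meson less_le_trans)

lemma tail_weights_average:
  assumes "tail_weights k N v" "tail_weights k N w"
  shows "tail_weights k N (\<lambda>i. (v i + w i) / 2)"
proof -
  have "(\<Sum>i<N. (v i + w i) / 2) = ((\<Sum>i<N. v i) + (\<Sum>i<N. w i)) / 2"
    by (simp only: sum_divide_distrib[symmetric] sum.distrib)
  then show ?thesis using assms by (auto simp: tail_weights_def)
qed

lemma tail_weights_norm_le:
  assumes w: "tail_weights k N w" and a: "\<And>i. k \<le> i \<Longrightarrow> norm (a i :: 'a::real_normed_vector) \<le> c"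
  shows "norm (\<Sum>i<N. w i *\<^sub>R a i) \<le> c"
proof -
  have "norm (\<Sum>i<N. w i *\<^sub>R a i) \<le> (\<Sum>i<N. w i * c)"
  proof (rule sum_norm_le)
    fix i show "norm (w i *\<^sub>R a i) \<le> w i * c"
      using w a[of i] by (cases "k \<le> i") (auto simp: tail_weights_def intro!: mult_left_mono)
  qed
  also have "\<dots> = c" using w by (simp add: tail_weights_def flip: sum_distrib_right)
  finally show ?thesis .
qed

lemma tail_weights_sum_const:
  "tail_weights k N w \<Longrightarrow> (\<Sum>i<N. w i *\<^sub>R c) = (c :: 'a::real_vector)"
  by (simp add: tail_weights_def flip: scaleR_sum_left)

lemma tail_weights_le:
  assumes w: "tail_weights k N w" and a: "\<And>i. k \<le> i \<Longrightarrow> a i \<le> (c::real)"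
  shows "(\<Sum>i<N. w i *\<^sub>R a i) \<le> c"
proof -
  have "(\<Sum>i<N. w i *\<^sub>R a i) \<le> (\<Sum>i<N. w i *\<^sub>R c)"
  proof (rule sum_mono)
    fix i show "w i *\<^sub>R a i \<le> w i *\<^sub>R c"
      using w a[of i] by (cases "k \<le> i") (auto simp: tail_weights_def intro!: mult_left_mono)
  qed
  also have "\<dots> = c" using w by (rule tail_weights_sum_const)
  finally show ?thesis .
qed

text \<open>The j-th average involves only terms from index j on, all of which are uniformly close
  to the limit. Hence averaging never disturbs a convergence already known.\<close>

lemma tail_weights_tendsto:
  fixes a :: "nat \<Rightarrow> 'a::real_normed_vector"
  assumes w: "\<And>j. tail_weights j (N j) (w j)" and a: "a \<longlonglongrightarrow> l"
  shows "(\<lambda>j. \<Sum>i<N j. w j i *\<^sub>R a i) \<longlonglongrightarrow> l"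
proof (rule LIMSEQ_I)
  fix e :: real assume "0 < e"
  then obtain n0 where n0: "\<And>n. n \<ge> n0 \<Longrightarrow> norm (a n - l) < e/2"
    using LIMSEQ_D[OF a, of "e/2"] by auto
  have "norm ((\<Sum>i<N j. w j i *\<^sub>R a i) - l) < e" if "j \<ge> n0" for j
  proof -
    have "(\<Sum>i<N j. w j i *\<^sub>R a i) - l = (\<Sum>i<N j. w j i *\<^sub>R (a i - l))"
      using tail_weights_sum_const[OF w[of j], of l] by (simp add: scaleR_diff_right sum_subtractf)
    also have "norm \<dots> \<le> e/2"
      using n0 that by (intro tail_weights_norm_le[OF w]) (auto intro: less_imp_le)
    finally show ?thesis using \<open>0 < e\<close> by simp
  qed
  then show "\<exists>no. \<forall>n\<ge>no. norm ((\<Sum>i<N n. w n i *\<^sub>R a i) - l) < e" by blast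
qed

text \<open>A Mazur-type lemma without weak compactness: in each tail pick a convex combination of almost minimal
  weighted \<open>L\<^sup>2\<close> norm. By the parallelogram identity these form a Cauchy sequence.\<close>

lemma convex_combinations_converge_AE:
  fixes \<phi> :: "nat \<Rightarrow> 'a \<Rightarrow> 'b::{real_inner,banach,second_countable_topology}" and m :: "'a \<Rightarrow> real"
  assumes meas[measurable]: "\<And>n. \<phi> n \<in> borel_measurable M" and m: "integrable M m" "\<And>x. 0 < m x"
    and le: "\<And>n x. norm (\<phi> n x) \<le> m x"
  obtains N w where "\<And>j. tail_weights j (N j) (w j)"
    "AE x in M. convergent (\<lambda>j. \<Sum>i<N j. w j i *\<^sub>R \<phi> i x)"
proof -
  have [measurable]: "m \<in> borel_measurable M" using m by auto
  define s where "s N w x = (\<Sum>i<N. w i *\<^sub>R \<phi> i x)" for N :: nat and w :: "nat \<Rightarrow> real" and x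
  have sm[measurable]: "s N w \<in> borel_measurable M" for N w unfolding s_def by measurable
  have sle: "norm (s N w x) \<le> m x" if "tail_weights k N w" for k N w x
    unfolding s_def using le by (intro tail_weights_norm_le[OF that])
  have qi: "integrable M (\<lambda>x. (norm (h x))\<^sup>2 / m x)"
    if [measurable]: "h \<in> borel_measurable M" and h: "\<And>x. norm (h x) \<le> c * m x" for h :: "'a \<Rightarrow> 'b" and c
  proof (rule Bochner_Integration.integrable_bound)
    show "integrable M (\<lambda>x. c\<^sup>2 * m x)" using m by auto
    have "(norm (h x))\<^sup>2 / m x \<le> c\<^sup>2 * m x" for x
    proof -
      have "(norm (h x))\<^sup>2 \<le> (c * m x)\<^sup>2" using h[of x] by (intro power_mono) auto
      then show ?thesis using m(2)[of x] by (simp add: field_simps power2_eq_square)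
    qed
    then show "AE x in M. norm ((norm (h x))\<^sup>2 / m x) \<le> norm (c\<^sup>2 * m x)"
      using m(2) by (auto simp: less_imp_le)
  qed measurable
  \<comment> \<open>The weight 1/m converts |h| \<le> m into a squared norm at most the integral of
    m, although h need not be square integrable for M itself.\<close>
  define q where "q h x = (norm (h x))\<^sup>2 / m x" for h :: "'a \<Rightarrow> 'b" and x
  define Q where "Q N w = (LINT x|M. q (s N w) x)" for N w
  define S where "S = integral\<^sup>L M m"
  have Q0: "0 \<le> Q N w" for N w unfolding Q_def q_def using m(2) by (intro Bochner_Integration.integral_nonneg) (auto simp: less_imp_le)
  have QS: "Q N w \<le> S" if w: "tail_weights k N w" for k N w
    unfolding Q_def q_def S_def
  proof (rule integral_mono)
    show "integrable M (\<lambda>x. (norm (s N w x))\<^sup>2 / m x)" using sle[OF w] by (intro qi[of _ 1]) auto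
    have "(norm (s N w x))\<^sup>2 \<le> (m x)\<^sup>2" for x using sle[OF w, of x] by (intro power_mono) auto
    then show "(norm (s N w x))\<^sup>2 / m x \<le> m x" for x using m(2)[of x] by (simp add: field_simps power2_eq_square)
  qed (rule m)
  define A where "A k = {Q N w | N w. tail_weights k N w}" for k
  have Ane: "A k \<noteq> {}" for k
  proof -
    have "tail_weights k (Suc k) (\<lambda>i. if i = k then 1 else 0)" by (auto simp: tail_weights_def)
    then show ?thesis unfolding A_def by blast
  qed
  have Abdd: "bdd_below (A k)" for k unfolding A_def using Q0 by (intro bdd_belowI[of _ 0]) auto
  define \<iota> :: "nat \<Rightarrow> real" where "\<iota> k = 1 / (real k + 1)" for k
  have \<iota>: "0 < \<iota> k" "k \<le> l \<Longrightarrow> \<iota> l \<le> \<iota> k" for k l by (auto simp: \<iota>_def field_simps)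
  \<comment> \<open>The sets A k shrink as k grows, so these infima increase; being bounded by S,
    they form a Cauchy sequence.\<close>
  define r where "r k = Inf (A k)" for k
  have rle: "r k \<le> Q N w" if "tail_weights k N w" for k N w
    unfolding r_def using Abdd that by (intro cInf_lower) (auto simp: A_def)
  have rmono: "r k \<le> r l" if "k \<le> l" for k l
    unfolding r_def using that Ane Abdd by (intro cInf_superset_mono) (auto simp: A_def intro: tail_weights_antimono)
  have rS: "r k \<le> S" for k
  proof -
    obtain N w where "tail_weights k N w" using Ane[of k] by (auto simp: A_def)
    then show ?thesis using rle QS order_trans by blast
  qed
  have "\<exists>N w. tail_weights k N w \<and> Q N w < r k + \<iota> k" for k
  proof -
    have "Inf (A k) < r k + \<iota> k" using \<iota> by (simp add: r_def)
    then obtain q where "q \<in> A k" "q < r k + \<iota> k" using cInf_lessD[OF Ane] by blast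
    then show ?thesis by (auto simp: A_def)
  qed
  then obtain N w where w: "\<And>k. tail_weights k (N k) (w k)" and Qr: "\<And>k. Q (N k) (w k) < r k + \<iota> k"
    by metis
  define \<sigma> where "\<sigma> k = s (N k) (w k)" for k
  have \<sigma>m[measurable]: "\<sigma> k \<in> borel_measurable M" for k unfolding \<sigma>_def by measurable
  have \<sigma>le: "norm (\<sigma> k x) \<le> m x" for k x unfolding \<sigma>_def by (rule sle[OF w])
  define d where "d k l = (LINT x|M. q (\<lambda>x. \<sigma> k x - \<sigma> l x) x)" for k l
  have dle2: "norm (\<sigma> k x - \<sigma> l x) \<le> 2 * m x" for k l x
    using norm_triangle_ineq4[of "\<sigma> k x" "\<sigma> l x"] \<sigma>le[of k x] \<sigma>le[of l x] by simp
  have di: "integrable M (q (\<lambda>x. \<sigma> k x - \<sigma> l x))" for k l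
    unfolding q_def using dle2 by (intro qi[of _ 2]) auto
  have dle: "d k l \<le> 2 * (r l - r k) + 4 * \<iota> k" if "k \<le> l" for k l
  proof -
    define K where "K = max (N k) (N l)"
    define v where "v = (\<lambda>i. (w k i + w l i) / 2)"
    have wk: "tail_weights k K (w k)" "\<And>x. s K (w k) x = \<sigma> k x"
      using tail_weights_extend[OF w[of k], of K] by (auto simp: K_def s_def \<sigma>_def)
    have wl: "tail_weights k K (w l)" "\<And>x. s K (w l) x = \<sigma> l x"
      using tail_weights_extend[OF w[of l], of K] tail_weights_antimono[OF _ that] by (auto simp: K_def s_def \<sigma>_def)
    \<comment> \<open>The midpoint of the k-th and l-th combination is again a combination from the
      k-th tail, so its norm square is at least r k. The parallelogram identity then bounds the
      distance of the two.\<close>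
    have v: "tail_weights k K v" unfolding v_def by (rule tail_weights_average[OF wk(1) wl(1)])
    have sv: "s K v x = (1/2) *\<^sub>R (\<sigma> k x + \<sigma> l x)" for x
      unfolding wk(2)[symmetric] wl(2)[symmetric] s_def v_def
      by (simp add: scaleR_sum_right scaleR_add_right scaleR_add_left add_divide_distrib flip: sum.distrib)
    have pt: "q (\<lambda>x. \<sigma> k x - \<sigma> l x) x = 2 * q (\<sigma> k) x + 2 * q (\<sigma> l) x - 4 * q (s K v) x" for x
    proof -
      have "(norm (\<sigma> k x - \<sigma> l x))\<^sup>2 = 2 * (norm (\<sigma> k x))\<^sup>2 + 2 * (norm (\<sigma> l x))\<^sup>2 - 4 * (norm (s K v x))\<^sup>2"
        unfolding sv by (simp add: power2_norm_eq_inner inner_simps inner_commute algebra_simps)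
      then show ?thesis by (simp add: q_def diff_divide_distrib add_divide_distrib)
    qed
    have ik: "integrable M (q (\<sigma> k))" for k unfolding q_def using \<sigma>le by (intro qi[of _ 1]) auto
    have iv: "integrable M (q (s K v))" unfolding q_def using sle[OF v] by (intro qi[of _ 1]) auto
    have "d k l = 2 * Q (N k) (w k) + 2 * Q (N l) (w l) - 4 * Q K v"
      unfolding d_def pt Q_def \<sigma>_def[symmetric] using ik iv by simp
    also have "\<dots> \<le> 2 * (r k + \<iota> k) + 2 * (r l + \<iota> l) - 4 * r k"
      using Qr[of k] Qr[of l] rle[OF v] by (smt (verit))
    also have "\<dots> \<le> 2 * (r l - r k) + 4 * \<iota> k"
      using \<iota>(2)[OF that] by (simp add: algebra_simps)
    finally show ?thesis .
  qed
  have "convergent r" using rmono rS by (intro Bseq_mono_convergent BseqI'[of _ "\<bar>S\<bar> + \<bar>r 0\<bar>"]) (smt (verit) real_norm_def le0)+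
  then have Cr: "Cauchy r" by (rule convergent_Cauchy)
  have S0: "0 \<le> S" unfolding S_def using m(2) by (intro Bochner_Integration.integral_nonneg) (auto simp: less_imp_le)
  have \<sigma>i: "integrable M (\<sigma> k)" for k
    by (rule Bochner_Integration.integrable_bound[OF m(1)]) (use \<sigma>le m(2) in \<open>auto intro: order_trans[OF _ abs_ge_self]\<close>)
  obtain \<rho> where \<rho>: "strict_mono \<rho>" "AE x in M. Cauchy (\<lambda>i. \<sigma> (\<rho> i) x)"
  proof (rule cauchy_L1_AE_cauchy_subseq[of M \<sigma>])
    fix e :: real assume e: "0 < e"
    \<comment> \<open>Return from weighted L^2 to L^1 by |h| \<le> (c/2) m + |h|^2 / (2 c m). This c
      makes the first term integrate to at most e/2; the second gets e/4 from
      \<open>dsmall\<close>.\<close>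
    define c where "c = e / (S + 1)"
    have c: "0 < c" using e S0 by (simp add: c_def)
    obtain n1 where n1: "\<And>k l. k \<ge> n1 \<Longrightarrow> l \<ge> n1 \<Longrightarrow> \<bar>r l - r k\<bar> < c * e / 8"
      using CauchyD[OF Cr, of "c * e / 8"] c e by (auto simp: mult_pos_pos)
    obtain n2 :: nat where n2: "16 / (c * e) < real n2" using reals_Archimedean2 by blast
    have dsmall: "d k l \<le> c * e / 2" if "k \<ge> max n1 n2" "k \<le> l" for k l
    proof -
      have "4 * \<iota> k \<le> c * e / 4"
      proof -
        have "real n2 \<le> real k" using that by simp
        then have "16 / (c * e) < real k + 1" using n2 by linarith
        then show ?thesis using c e by (simp add: \<iota>_def field_simps)
      qed
      moreover have "r l - r k < c * e / 8"
        by (rule le_less_trans[OF abs_ge_self n1]) (use that in auto)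
      ultimately show ?thesis using dle[OF that(2)] by argo
    qed
    have L1: "(LINT x|M. norm (\<sigma> k x - \<sigma> l x)) < e" if "k \<ge> max n1 n2" "k \<le> l" for k l
    proof -
      have amgm: "norm (\<sigma> k x - \<sigma> l x) \<le> c / 2 * m x + 1 / (2 * c) * q (\<lambda>x. \<sigma> k x - \<sigma> l x) x" for x
      proof -
        have "0 \<le> (c * m x - norm (\<sigma> k x - \<sigma> l x))\<^sup>2" by simp
        then show ?thesis using c m(2)[of x] by (simp add: q_def field_simps power2_eq_square)
      qed
      have "(LINT x|M. norm (\<sigma> k x - \<sigma> l x)) \<le> (LINT x|M. c / 2 * m x + 1 / (2 * c) * q (\<lambda>x. \<sigma> k x - \<sigma> l x) x)"
        using \<sigma>i m(1) di amgm by (intro integral_mono) auto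
      also have "\<dots> = c / 2 * S + 1 / (2 * c) * d k l"
        unfolding S_def d_def using m(1) di[of k l] by (subst Bochner_Integration.integral_add) auto
      also have "\<dots> \<le> c / 2 * S + 1 / (2 * c) * (c * e / 2)"
        using dsmall[OF that] c by (intro add_left_mono mult_left_mono) auto
      also have "\<dots> = c / 2 * S + e / 4" using c by simp
      also have "\<dots> \<le> e / 2 + e / 4"
      proof -
        have "c * S \<le> c * (S + 1)" using c by simp
        also have "\<dots> = e" using S0 by (simp add: c_def)
        finally show ?thesis by (simp add: mult.commute)
      qed
      also have "e / 2 + e / 4 < e" using e by simp
      finally show ?thesis .
    qed
    show "\<exists>N. \<forall>i\<ge>N. \<forall>j\<ge>N. (LINT x|M. norm (\<sigma> i x - \<sigma> j x)) < e"
    proof (intro exI[of _ "max n1 n2"] allI impI)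
      fix i j assume ij: "i \<ge> max n1 n2" "j \<ge> max n1 n2"
      show "(LINT x|M. norm (\<sigma> i x - \<sigma> j x)) < e"
      proof (cases "i \<le> j")
        case True then show ?thesis using L1 ij by blast
      next
        case False then show ?thesis using L1[of j i] ij by (simp add: norm_minus_commute)
      qed
    qed
  qed (use \<sigma>i in auto)
  show ?thesis
  \<comment> \<open>L^1 convergence yields almost everywhere convergence along a subsequence only;
    as j \<le> \<rho> j, the reindexed weights still start at j or later.\<close>
  proof (rule that[of "\<lambda>j. N (\<rho> j)" "\<lambda>j. w (\<rho> j)"])
    show "tail_weights j (N (\<rho> j)) (w (\<rho> j))" for j
      using w[of "\<rho> j"] seq_suble[OF \<rho>(1), of j] by (rule tail_weights_antimono)
    show "AE x in M. convergent (\<lambda>j. \<Sum>i<N (\<rho> j). w (\<rho> j) i *\<^sub>R \<phi> i x)"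
      using \<rho>(2) by eventually_elim (simp add: \<sigma>_def s_def Cauchy_convergent_iff)
  qed
qed

section \<open>Projections, measurable selections and normal cones\<close>

lemma ex_dist_less_infdist:
  assumes "S \<noteq> {}" "0 < e"
  obtains y where "y \<in> S" "dist z y < infdist z S + e"
proof -
  have "infdist z S < infdist z S + e" using assms by simp
  then have "\<exists>y\<in>S. dist z y < infdist z S + e"
    using assms cINF_less_iff[of S "dist z" "infdist z S + e"] by (simp add: infdist_notempty)
  then show ?thesis using that by blast
qed

text \<open>No compactness is at hand: minimising sequences are Cauchy because the midpoint of two
  near-minimisers stays in S, and the parallelogram identity forces them together.\<close>

lemma ex_nearest_point_convex:
  fixes S :: "'a::{real_inner,banach} set"
  assumes S: "closed S" "convex S" "S \<noteq> {}"
  obtains p where "p \<in> S" "\<And>y. y \<in> S \<Longrightarrow> norm (z - p) \<le> norm (z - y)" "\<And>y. y \<in> S \<Longrightarrow> inner (z - p) (y - p) \<le> 0"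
proof -
  define \<delta> where "\<delta> = infdist z S"
  have d0: "0 \<le> \<delta>" by (simp add: \<delta>_def infdist_nonneg)
  have lower: "\<delta> \<le> norm (z - y)" if "y \<in> S" for y
    using infdist_le[OF that, of z] by (simp add: \<delta>_def dist_norm)
  have "\<exists>y\<in>S. norm (z - y) < \<delta> + 1 / (real n + 1)" for n
    using ex_dist_less_infdist[OF S(3), of "1 / (real n + 1)" z] by (force simp: \<delta>_def dist_norm)
  then obtain y where y: "\<And>n. y n \<in> S" "\<And>n. norm (z - y n) < \<delta> + 1 / (real n + 1)" by metis
  \<comment> \<open>Excess of the squared distance over \<delta>^2, from (\<delta> + i)^2 =
    \<delta>^2 + (2 \<delta> + i) i with i \<le> 1.\<close>
  define \<epsilon> where "\<epsilon> n = (2 * \<delta> + 1) * (1 / (real n + 1))" for n :: nat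
  have sq: "(norm (z - y n))\<^sup>2 \<le> \<delta>\<^sup>2 + \<epsilon> n" for n
  proof -
    let ?i = "1 / (real n + 1)"
    have i: "0 < ?i" "?i \<le> 1" by auto
    have "(norm (z - y n))\<^sup>2 \<le> (\<delta> + ?i)\<^sup>2" using y(2)[of n] by (intro power_mono) auto
    also have "\<dots> = \<delta>\<^sup>2 + (2 * \<delta> + ?i) * ?i" by (simp add: power2_eq_square algebra_simps)
    also have "\<dots> \<le> \<delta>\<^sup>2 + \<epsilon> n" unfolding \<epsilon>_def using i by (intro add_left_mono mult_right_mono) auto
    finally show ?thesis .
  qed
  have par: "(norm (y n - y k))\<^sup>2 \<le> 2 * \<epsilon> n + 2 * \<epsilon> k" for n k
  proof -
    have mid: "(1/2) *\<^sub>R y n + (1/2) *\<^sub>R y k \<in> S" using y S(2) by (intro convexD) auto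
    have "(norm (y n - y k))\<^sup>2 = 2 * (norm (z - y n))\<^sup>2 + 2 * (norm (z - y k))\<^sup>2 - 4 * (norm (z - ((1/2) *\<^sub>R y n + (1/2) *\<^sub>R y k)))\<^sup>2"
      by (simp add: power2_norm_eq_inner inner_simps inner_commute algebra_simps)
    also have "\<dots> \<le> 2 * (\<delta>\<^sup>2 + \<epsilon> n) + 2 * (\<delta>\<^sup>2 + \<epsilon> k) - 4 * \<delta>\<^sup>2"
      using sq[of n] sq[of k] power_mono[OF lower[OF mid] d0, of 2] by (intro diff_mono add_mono mult_left_mono) auto
    also have "\<dots> = 2 * \<epsilon> n + 2 * \<epsilon> k" by simp
    finally show ?thesis .
  qed
  have lim: "\<epsilon> \<longlonglongrightarrow> 0"
    unfolding \<epsilon>_def using tendsto_mult_right_zero[OF LIMSEQ_inverse_real_of_nat, of "2 * \<delta> + 1"]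
    by (simp add: inverse_eq_divide add.commute)
  have "Cauchy y"
  proof (rule metric_CauchyI)
    fix e :: real assume e: "0 < e"
    then have "eventually (\<lambda>n. \<epsilon> n < e\<^sup>2 / 4) sequentially" using lim by (intro order_tendstoD) auto
    then obtain n0 where n0: "\<And>n. n \<ge> n0 \<Longrightarrow> \<epsilon> n < e\<^sup>2 / 4" by (auto simp: eventually_sequentially)
    have "dist (y n) (y k) < e" if "n \<ge> n0" "k \<ge> n0" for n k
    proof -
      have "(norm (y n - y k))\<^sup>2 < e\<^sup>2" using par[of n k] n0[OF that(1)] n0[OF that(2)] by simp
      then show ?thesis using e by (simp add: dist_norm power2_less_imp_less)
    qed
    then show "\<exists>M. \<forall>m\<ge>M. \<forall>n\<ge>M. dist (y m) (y n) < e" by blast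
  qed
  then obtain p where p: "y \<longlonglongrightarrow> p" using Cauchy_convergent convergent_def by blast
  have pS: "p \<in> S" using closed_sequentially[OF S(1)] y(1) p by blast
  have "norm (z - p) \<le> \<delta>"
  proof (rule LIMSEQ_le)
    show "(\<lambda>n. norm (z - y n)) \<longlonglongrightarrow> norm (z - p)" by (intro tendsto_intros p)
    show "(\<lambda>n. \<delta> + 1 / (real n + 1)) \<longlonglongrightarrow> \<delta>"
      using tendsto_add[OF tendsto_const[of \<delta>] LIMSEQ_inverse_real_of_nat] by (simp add: inverse_eq_divide add.commute)
  qed (use y(2) in \<open>auto intro: less_imp_le\<close>)
  then have near: "norm (z - p) \<le> norm (z - y)" if "y \<in> S" for y using lower[OF that] by simp
  moreover have "inner (z - p) (w - p) \<le> 0" if "w \<in> S" for w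
    using near by (intro any_closest_point_dot[OF S(2,1) pS that]) (simp add: dist_norm)
  ultimately show ?thesis using pS that by blast
qed

text \<open>The least norm r is measurable because r t < a says that G t meets an open ball. By the
  variational inequality, points of G t of nearly least norm are close to p t, so p is a limit of
  functions that pick the first dense point near such a point.\<close>

lemma min_norm_selection_measurable:
  fixes G :: "real \<Rightarrow> 'a::{real_inner,banach,second_countable_topology} set"
  assumes meas: "meas_multifun T G"
    and p: "\<And>t. t \<in> {0..T} \<Longrightarrow> p t \<in> G t"
    and min: "\<And>t y. t \<in> {0..T} \<Longrightarrow> y \<in> G t \<Longrightarrow> norm (p t) \<le> norm y"
    and var: "\<And>t y. t \<in> {0..T} \<Longrightarrow> y \<in> G t \<Longrightarrow> inner (p t) (y - p t) \<ge> 0"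
  shows "p \<in> borel_measurable (lebesgue_on {0..T})"
proof -
  define M where "M = lebesgue_on {0..T}"
  have sp[simp]: "space M = {0..T}" by (simp add: M_def)
  have hit: "{t \<in> space M. G t \<inter> U \<noteq> {}} \<in> sets M" if "open U" for U
    using meas that unfolding meas_multifun_def M_def by simp
  define r where "r t = norm (p t)" for t
  have r[measurable]: "r \<in> borel_measurable M"
    unfolding borel_measurable_iff_less
  proof
    fix a :: real
    have "{t \<in> space M. r t < a} = {t \<in> space M. G t \<inter> ball 0 a \<noteq> {}}"
    proof (intro Collect_cong conj_cong refl iffI)
      fix t assume "t \<in> space M" "G t \<inter> ball 0 a \<noteq> {}"
      then show "r t < a" using min[of t] by (force simp: r_def)
    next
      fix t assume "t \<in> space M" "r t < a"
      then have "p t \<in> G t \<inter> ball 0 a" using p[of t] by (simp add: r_def)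
      then show "G t \<inter> ball 0 a \<noteq> {}" by blast
    qed
    then show "{t \<in> space M. r t < a} \<in> sets M" using hit[of "ball 0 a"] by simp
  qed
  obtain D :: "'a set" where D: "countable D" "\<And>Y. open Y \<Longrightarrow> Y \<noteq> {} \<Longrightarrow> \<exists>d\<in>D. d \<in> Y"
    using countable_dense_setE by blast
  then have "D \<noteq> {}" by blast
  define e where "e = from_nat_into D"
  have e: "\<exists>k. e k \<in> Y" if "open Y" "Y \<noteq> {}" for Y
    using D(2)[OF that] from_nat_into_surj[OF D(1)] unfolding e_def by metis
  define \<eta> where "\<eta> n = 1 / (real n + 1)" for n :: nat
  have \<eta>: "0 < \<eta> n" for n by (simp add: \<eta>_def)
  define P where "P n k t \<longleftrightarrow> G t \<inter> (ball 0 (r t + \<eta> n) \<inter> ball (e k) (\<eta> n)) \<noteq> {}" for n k t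
  have Pm: "Measurable.pred M (P n k)" for n k
  proof -
    \<comment> \<open>The radius r t + \<eta> n varies with t; a rational between the norm and this
      radius reduces the condition to hitting fixed open sets.\<close>
    have "{t \<in> space M. P n k t}
        = (\<Union>q\<in>\<rat>. {t \<in> space M. q < r t + \<eta> n} \<inter> {t \<in> space M. G t \<inter> (ball 0 q \<inter> ball (e k) (\<eta> n)) \<noteq> {}})"
    proof (intro set_eqI iffI)
      fix t assume "t \<in> {t \<in> space M. P n k t}"
      then obtain w where w: "t \<in> space M" "w \<in> G t" "norm w < r t + \<eta> n" "w \<in> ball (e k) (\<eta> n)" by (auto simp: P_def)
      obtain q where "q \<in> \<rat>" "norm w < q" "q < r t + \<eta> n" using Rats_dense_in_real[OF w(3)] by auto
      with w show "t \<in> (\<Union>q\<in>\<rat>. {t \<in> space M. q < r t + \<eta> n} \<inter> {t \<in> space M. G t \<inter> (ball 0 q \<inter> ball (e k) (\<eta> n)) \<noteq> {}})"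
        by (intro UN_I[of q]) auto
    next
      fix t assume "t \<in> (\<Union>q\<in>\<rat>. {t \<in> space M. q < r t + \<eta> n} \<inter> {t \<in> space M. G t \<inter> (ball 0 q \<inter> ball (e k) (\<eta> n)) \<noteq> {}})"
      then obtain q w where "t \<in> space M" "q < r t + \<eta> n" "w \<in> G t" "norm w < q" "w \<in> ball (e k) (\<eta> n)" by auto
      then show "t \<in> {t \<in> space M. P n k t}" unfolding P_def by force
    qed
    also have "\<dots> \<in> sets M"
    proof (intro sets.countable_UN'' countable_rat sets.Int)
      fix q :: real
      show "{t \<in> space M. q < r t + \<eta> n} \<in> sets M" by measurable
      show "{t \<in> space M. G t \<inter> (ball 0 q \<inter> ball (e k) (\<eta> n)) \<noteq> {}} \<in> sets M" by (intro hit) auto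
    qed
    finally show ?thesis by (simp add: pred_def)
  qed
  define K where "K n t = (LEAST k. P n k t)" for n t
  have Km: "K n \<in> measurable M (count_space UNIV)" for n
    unfolding K_def by (rule measurable_Least[OF Pm])
  have "p \<in> borel_measurable M"
  proof (rule borel_measurable_LIMSEQ_metric)
    show "(\<lambda>t. e (K n t)) \<in> borel_measurable M" for n
      using Km by (rule measurable_compose) simp
    fix t assume t: "t \<in> space M"
    have PK: "P n (K n t) t" for n
    proof -
      obtain k where "e k \<in> ball (p t) (\<eta> n)" using e[of "ball (p t) (\<eta> n)"] \<eta>[of n] by auto
      then have "P n k t" using t p[of t] \<eta>[of n] by (auto simp: P_def r_def dist_commute)
      then show ?thesis unfolding K_def by (rule LeastI)
    qed
    have bound: "dist (e (K n t)) (p t) \<le> \<eta> n + sqrt (\<eta> n * (2 * r t + \<eta> n))" for n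
    proof -
      obtain w where w: "w \<in> G t" "norm w < r t + \<eta> n" "dist (e (K n t)) w < \<eta> n" using PK[of n] by (auto simp: P_def)
      \<comment> \<open>The cross term has a favourable sign by \<open>var\<close>, so the distance
        to p t is controlled by the excess in norm alone.\<close>
      have "(norm (w - p t))\<^sup>2 = (norm w)\<^sup>2 - (r t)\<^sup>2 - 2 * inner (p t) (w - p t)"
        by (simp add: r_def power2_norm_eq_inner inner_simps inner_commute)
      also have "\<dots> \<le> (norm w)\<^sup>2 - (r t)\<^sup>2" using var[of t w] t w by simp
      also have "\<dots> \<le> (r t + \<eta> n)\<^sup>2 - (r t)\<^sup>2" using w(2) by (intro diff_right_mono power_mono) auto
      also have "\<dots> = \<eta> n * (2 * r t + \<eta> n)" by (simp add: power2_eq_square algebra_simps)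
      finally have "norm (w - p t) \<le> sqrt (\<eta> n * (2 * r t + \<eta> n))" by (rule real_le_rsqrt)
      then show ?thesis using w(3) dist_triangle[of "e (K n t)" "p t" w] by (simp add: dist_norm)
    qed
    have \<eta>0: "\<eta> \<longlonglongrightarrow> 0"
      using LIMSEQ_inverse_real_of_nat by (simp add: \<eta>_def[abs_def] inverse_eq_divide add.commute)
    have "(\<lambda>n. \<eta> n + sqrt (\<eta> n * (2 * r t + \<eta> n))) \<longlonglongrightarrow> 0 + sqrt (0 * (2 * r t + 0))"
      by (intro tendsto_intros \<eta>0)
    then have "(\<lambda>n. \<eta> n + sqrt (\<eta> n * (2 * r t + \<eta> n))) \<longlonglongrightarrow> 0" by simp
    then have "(\<lambda>n. dist (e (K n t)) (p t)) \<longlonglongrightarrow> 0"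
      by (rule tendsto_sandwich[OF _ _ tendsto_const, rotated 2]) (use bound in \<open>auto intro!: always_eventually\<close>)
    then show "(\<lambda>n. e (K n t)) \<longlonglongrightarrow> p t" by (rule tendsto_dist_iff[THEN iffD2])
  qed
  then show ?thesis by (simp add: M_def)
qed

section \<open>Normal cones: sufficient conditions and stability\<close>

text \<open>Frechet normals are Clarke normals: a Clarke tangent direction is in particular
  approximated along the constant sequence x, and testing the inequality at those points and
  dividing by the step gives the sign.\<close>

lemma clarke_normalI:
  fixes x :: "'a::real_inner"
  assumes x: "x \<in> S" and v: "\<And>\<epsilon>. 0 < \<epsilon> \<Longrightarrow> \<exists>\<delta>>0. \<forall>z\<in>S. norm (z - x) < \<delta> \<longrightarrow> inner v (z - x) \<le> \<epsilon> * norm (z - x)"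
  shows "v \<in> clarke_normal S x"
proof -
  have "inner v h \<le> 0" if h: "h \<in> clarke_tangent S x" for h
  proof -
    define ts where "ts n = 1 / (real n + 1)" for n :: nat
    have ts: "ts \<longlonglongrightarrow> 0" "\<And>n. ts n > 0"
      using LIMSEQ_inverse_real_of_nat by (auto simp: ts_def[abs_def] inverse_eq_divide add.commute)
    obtain hs where hs: "hs \<longlonglongrightarrow> h" "\<And>n. x + ts n *\<^sub>R hs n \<in> S"
      using h x ts unfolding clarke_tangent_def mem_Collect_eq
      by (elim allE[of _ "\<lambda>_. x"] allE[of _ ts]) auto
    have le: "inner v h \<le> \<epsilon> * norm h" if e: "0 < \<epsilon>" for \<epsilon>
    proof -
      obtain \<delta> where \<delta>: "\<delta> > 0" "\<And>z. z \<in> S \<Longrightarrow> norm (z - x) < \<delta> \<Longrightarrow> inner v (z - x) \<le> \<epsilon> * norm (z - x)"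
        using v[OF e] by auto
      have "(\<lambda>n. norm (ts n *\<^sub>R hs n)) \<longlonglongrightarrow> norm (0 *\<^sub>R h)" by (intro tendsto_intros ts hs)
      then have "eventually (\<lambda>n. norm (ts n *\<^sub>R hs n) < \<delta>) sequentially" using \<delta>(1) by (intro order_tendstoD) auto
      then have ev: "eventually (\<lambda>n. inner v (hs n) \<le> \<epsilon> * norm (hs n)) sequentially"
      proof eventually_elim
        case (elim n)
        then have "inner v (ts n *\<^sub>R hs n) \<le> \<epsilon> * norm (ts n *\<^sub>R hs n)" using \<delta>(2)[OF hs(2)[of n]] by simp
        then show ?case using ts(2)[of n] by (simp add: algebra_simps)
      qed
      have "(\<lambda>n. inner v (hs n)) \<longlonglongrightarrow> inner v h" "(\<lambda>n. \<epsilon> * norm (hs n)) \<longlonglongrightarrow> \<epsilon> * norm h"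
        by (intro tendsto_intros hs)+
      then show ?thesis using ev by (intro tendsto_le[OF sequentially_bot]) auto
    qed
    show ?thesis
    proof (rule field_le_epsilon)
      fix e :: real assume e: "0 < e"
      have "inner v h \<le> e / (norm h + 1) * norm h" using e by (intro le) (auto intro!: divide_pos_pos add_nonneg_pos)
      also have "\<dots> \<le> e"
      proof -
        have "e * norm h \<le> e * (norm h + 1)" using e by (intro mult_left_mono) auto
        then show ?thesis by (simp add: pos_divide_le_eq add_nonneg_pos)
      qed
      finally show "inner v h \<le> 0 + e" by simp
    qed
  qed
  then show ?thesis using x by (simp add: clarke_normal_def)
qed

lemma clarke_normal_scaleR: "v \<in> clarke_normal S x \<Longrightarrow> 0 \<le> c \<Longrightarrow> c *\<^sub>R v \<in> clarke_normal S x"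
  by (auto simp: clarke_normal_def mult_nonneg_nonpos split: if_splits)

text \<open>Comparing |u - p|^2 with |u - z|^2 gives 2 <u - p, z - p> \<le> |z - p|^2, which is
  below 2 \<epsilon> |z - p| within radius 2 \<epsilon>.\<close>

lemma proximal_imp_clarke_normal:
  fixes p :: "'a::real_inner"
  assumes p: "p \<in> S" and near: "\<And>y. y \<in> S \<Longrightarrow> norm (u - p) \<le> norm (u - y)"
  shows "u - p \<in> clarke_normal S p"
proof (rule clarke_normalI[OF p])
  fix \<epsilon> :: real assume e: "0 < \<epsilon>"
  have "inner (u - p) (z - p) \<le> \<epsilon> * norm (z - p)" if "z \<in> S" "norm (z - p) < 2 * \<epsilon>" for z
  proof -
    have "(norm (u - p))\<^sup>2 \<le> (norm (u - z))\<^sup>2" using near[OF that(1)] by (intro power_mono) auto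
    also have "(norm (u - z))\<^sup>2 = (norm (u - p))\<^sup>2 - 2 * inner (u - p) (z - p) + (norm (z - p))\<^sup>2"
      by (simp add: power2_norm_eq_inner inner_simps inner_commute)
    finally have "2 * inner (u - p) (z - p) \<le> norm (z - p) * norm (z - p)" by (simp add: power2_eq_square)
    also have "\<dots> \<le> (2 * \<epsilon>) * norm (z - p)" using that by (intro mult_right_mono) auto
    finally show ?thesis by simp
  qed
  then show "\<exists>\<delta>>0. \<forall>z\<in>S. norm (z - p) < \<delta> \<longrightarrow> inner (u - p) (z - p) \<le> \<epsilon> * norm (z - p)"
    using e by (intro exI[of _ "2 * \<epsilon>"]) auto
qed

lemma equi_unif_subsmooth_normal:
  assumes sub: "equi_unif_subsmooth E S" and e: "0 < \<epsilon>"
  obtains \<delta> where "0 < \<delta>" "\<And>i x z v. i \<in> E \<Longrightarrow> x \<in> S i \<Longrightarrow> z \<in> S i \<Longrightarrow> v \<in> clarke_normal (S i) x \<Longrightarrow>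
      norm (z - x) < \<delta> \<Longrightarrow> inner v (z - x) \<le> \<epsilon> * norm v * norm (z - x)"
proof -
  obtain \<delta> where \<delta>: "0 < \<delta>" "\<And>i x1 x2 v1 v2. i \<in> E \<Longrightarrow> x1 \<in> S i \<Longrightarrow> x2 \<in> S i \<Longrightarrow> v1 \<in> clarke_normal (S i) x1 \<inter> cball 0 1 \<Longrightarrow>
      v2 \<in> clarke_normal (S i) x2 \<inter> cball 0 1 \<Longrightarrow> norm (x1 - x2) < \<delta> \<Longrightarrow> inner (v1 - v2) (x1 - x2) \<ge> - \<epsilon> * norm (x1 - x2)"
    using sub e unfolding equi_unif_subsmooth_def by metis
  show ?thesis
  proof (rule that[OF \<delta>(1)])
    fix i x z v assume i: "i \<in> E" "x \<in> S i" "z \<in> S i" "v \<in> clarke_normal (S i) x" "norm (z - x) < \<delta>"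
    have 0: "0 \<in> clarke_normal (S i) z \<inter> cball 0 1" using i by (simp add: clarke_normal_def)
    have 1: "(1 / norm v) *\<^sub>R v \<in> clarke_normal (S i) x \<inter> cball 0 1"
      using clarke_normal_scaleR[OF i(4), of "1 / norm v"] by simp
    show "inner v (z - x) \<le> \<epsilon> * norm v * norm (z - x)"
    proof (cases "v = 0")
      case False
      have "inner ((1 / norm v) *\<^sub>R v - 0) (x - z) \<ge> - \<epsilon> * norm (x - z)"
        using i by (intro \<delta>(2)[OF i(1-3) 1 0]) (simp add: norm_minus_commute)
      then have "inner v (x - z) \<ge> - \<epsilon> * norm (x - z) * norm v" using False by (simp add: field_simps)
      moreover have "inner v (z - x) = - inner v (x - z)" by (simp add: inner_diff_right)
      ultimately show ?thesis by (simp add: norm_minus_commute mult_ac)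
    qed simp
  qed
qed

text \<open>If f were outside G x, an open half-space containing G x but keeping away from f would
  be a weakly open set, hence would contain G (xs n) for large n. Half-spaces are convex, so the
  averages could not reach f.\<close>

lemma usc_weak_convex_limit:
  fixes G :: "'a::{real_inner,banach} \<Rightarrow> 'a set"
  assumes usc: "usc_weak G" and G: "closed (G x)" "convex (G x)" "G x \<noteq> {}"
    and xs: "xs \<longlonglongrightarrow> x" and fs: "\<And>n. fs n \<in> G (xs n)"
    and w: "\<And>j. tail_weights j (N j) (w j)" and lim: "(\<lambda>j. \<Sum>i<N j. w j i *\<^sub>R fs i) \<longlonglongrightarrow> f"
  shows "f \<in> G x"
proof -
  obtain p where p: "p \<in> G x" "\<And>y. y \<in> G x \<Longrightarrow> inner (f - p) (y - p) \<le> 0"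
    using ex_nearest_point_convex[OF G, of f] by metis
  define e where "e = f - p"
  \<comment> \<open>Halfway between <p, e> and <f, e> = <p, e> + |e|^2.\<close>
  define c where "c = inner p e + (norm e)\<^sup>2 / 2"
  have "f = p"
  proof (rule ccontr)
    assume "f \<noteq> p"
    then have e0: "norm e > 0" by (simp add: e_def)
    define W where "W = {y. inner y e \<in> {..<c}}"
    have "openin weak_topology W"
      unfolding weak_topology_def W_def by (rule topology_generated_by_Basis, intro CollectI exI[of _ e] exI[of _ "{..<c}"] conjI refl open_lessThan)
    moreover have "G x \<subseteq> W"
    proof
      fix y assume "y \<in> G x"
      then have "inner y e \<le> inner p e" using p(2)[of y] by (simp add: e_def inner_diff_right inner_commute)
      then show "y \<in> W" using e0 by (auto simp: W_def c_def intro: le_less_trans)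
    qed
    ultimately obtain \<delta> where \<delta>: "\<delta> > 0" "\<And>u. norm (u - x) < \<delta> \<Longrightarrow> G u \<subseteq> W"
      using usc unfolding usc_weak_def by blast
    obtain n0 where n0: "\<And>n. n \<ge> n0 \<Longrightarrow> norm (xs n - x) < \<delta>" using LIMSEQ_D[OF xs \<delta>(1)] by auto
    have fle: "inner (fs n) e \<le> c" if "n \<ge> n0" for n
    proof -
      have "fs n \<in> W" using \<delta>(2)[OF n0[OF that]] fs by blast
      then show ?thesis by (simp add: W_def)
    qed
    have "inner (\<Sum>i<N j. w j i *\<^sub>R fs i) e \<le> c" if "j \<ge> n0" for j
      using tail_weights_le[OF w[of j], of "\<lambda>i. inner (fs i) e" c] fle that by (simp add: inner_sum_left)
    moreover have "(\<lambda>j. inner (\<Sum>i<N j. w j i *\<^sub>R fs i) e) \<longlonglongrightarrow> inner f e" by (intro tendsto_intros lim)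
    ultimately have "inner f e \<le> c" by (intro LIMSEQ_le_const2) auto
    moreover have "inner f e = inner p e + (norm e)\<^sup>2" by (simp add: e_def power2_norm_eq_inner inner_simps)
    ultimately show False using e0 by (simp add: c_def)
  qed
  with p show ?thesis by simp
qed

text \<open>Fix a test point z of the limit set. Convergence of the distance functions supplies
  points of the approximating sets tending to z, at which the subsmooth inequality of each vs n is
  available. Moving back to z and y costs an error that vanishes uniformly for bounded normals, and
  the resulting inequalities are averaged.\<close>

lemma clarke_normal_convex_limit:
  fixes S :: "'i \<Rightarrow> 'a::real_inner set"
  assumes sub: "equi_unif_subsmooth E S" and i: "\<And>n. \<iota> n \<in> E" "\<And>n. S (\<iota> n) \<noteq> {}" and S0: "closed S0" "S0 \<noteq> {}"
    and inf: "\<And>z. (\<lambda>n. infdist z (S (\<iota> n))) \<longlonglongrightarrow> infdist z S0"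
    and y: "ys \<longlonglongrightarrow> y" "\<And>n. ys n \<in> S (\<iota> n)"
    and v: "\<And>n. vs n \<in> clarke_normal (S (\<iota> n)) (ys n)" "\<And>n. norm (vs n) \<le> \<rho>"
    and w: "\<And>j. tail_weights j (N j) (w j)" and lim: "(\<lambda>j. \<Sum>i<N j. w j i *\<^sub>R vs i) \<longlonglongrightarrow> v"
  shows "v \<in> clarke_normal S0 y"
proof (rule clarke_normalI)
  have "infdist y S0 \<le> 0"
  proof (rule LIMSEQ_le[OF inf])
    show "(\<lambda>n. dist y (ys n)) \<longlonglongrightarrow> 0" using tendsto_dist[OF tendsto_const[of y] y(1)] by simp
    show "\<exists>n0. \<forall>n\<ge>n0. infdist y (S (\<iota> n)) \<le> dist y (ys n)" using y(2) by (auto intro: infdist_le)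
  qed
  then have "infdist y S0 = 0" using infdist_nonneg[of y S0] by simp
  then show "y \<in> S0" using in_closed_iff_infdist_zero[OF S0] by simp
  fix \<epsilon> :: real assume e: "0 < \<epsilon>"
  have \<rho>: "0 \<le> \<rho>" using v(2)[of 0] norm_ge_zero order_trans by blast
  \<comment> \<open>The radius \<delta> must be fixed before the averages, so \<epsilon> is divided
    by the bound on the normals; the summand 1 covers \<rho> = 0.\<close>
  define \<epsilon>1 where "\<epsilon>1 = \<epsilon> / (\<rho> + 1)"
  have e1: "0 < \<epsilon>1" "\<epsilon>1 * \<rho> \<le> \<epsilon>" using e \<rho> by (auto simp: \<epsilon>1_def field_simps)
  obtain \<delta> where \<delta>: "0 < \<delta>" "\<And>i x z v. i \<in> E \<Longrightarrow> x \<in> S i \<Longrightarrow> z \<in> S i \<Longrightarrow> v \<in> clarke_normal (S i) x \<Longrightarrow>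
      norm (z - x) < \<delta> \<Longrightarrow> inner v (z - x) \<le> \<epsilon>1 * norm v * norm (z - x)"
    using equi_unif_subsmooth_normal[OF sub e1(1)] by metis
  have "inner v (z - y) \<le> \<epsilon> * norm (z - y)" if z: "z \<in> S0" "norm (z - y) < \<delta>" for z
  proof -
    have "\<exists>u\<in>S (\<iota> n). dist z u < infdist z (S (\<iota> n)) + 1 / (real n + 1)" for n
      by (rule ex_dist_less_infdist[OF i(2)[of n], of "1 / (real n + 1)" z]) auto
    then obtain zs where zs: "\<And>n. zs n \<in> S (\<iota> n)" "\<And>n. dist z (zs n) < infdist z (S (\<iota> n)) + 1 / (real n + 1)"
      by metis
    have "(\<lambda>n. infdist z (S (\<iota> n)) + 1 / (real n + 1)) \<longlonglongrightarrow> infdist z S0 + 0"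
      using LIMSEQ_inverse_real_of_nat by (intro tendsto_add inf) (simp add: inverse_eq_divide add.commute)
    then have "(\<lambda>n. infdist z (S (\<iota> n)) + 1 / (real n + 1)) \<longlonglongrightarrow> 0" using z by simp
    then have dz: "(\<lambda>n. dist z (zs n)) \<longlonglongrightarrow> 0"
      by (rule tendsto_sandwich[OF _ _ tendsto_const, rotated 2]) (use zs in \<open>auto intro!: always_eventually less_imp_le\<close>)
    then have zl: "zs \<longlonglongrightarrow> z" using tendsto_dist_iff[of zs z sequentially] by (simp add: dist_commute)
    have "(\<lambda>n. norm (zs n - ys n)) \<longlonglongrightarrow> norm (z - y)" by (intro tendsto_intros zl y)
    then have "eventually (\<lambda>n. norm (zs n - ys n) < \<delta>) sequentially" using z by (intro order_tendstoD) auto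
    then obtain n0 where n0: "\<And>n. n \<ge> n0 \<Longrightarrow> norm (zs n - ys n) < \<delta>" by (auto simp: eventually_sequentially)
    \<comment> \<open>Right-hand side after replacing zs n and ys n by z and y. It converges, so its
      averages converge to the same limit.\<close>
    define b where "b n = \<epsilon>1 * \<rho> * norm (zs n - ys n) + \<rho> * (norm (z - zs n) + norm (ys n - y))" for n
    have "b \<longlonglongrightarrow> \<epsilon>1 * \<rho> * norm (z - y) + \<rho> * (norm (z - z) + norm (y - y))"
      unfolding b_def by (intro tendsto_intros zl y)
    then have blim: "(\<lambda>j. \<Sum>i<N j. w j i *\<^sub>R b i) \<longlonglongrightarrow> \<epsilon>1 * \<rho> * norm (z - y)" by (intro tail_weights_tendsto[OF w]) simp
    have vb: "inner (vs n) (z - y) - b n \<le> 0" if "n \<ge> n0" for n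
    proof -
      have "inner (vs n) (zs n - ys n) \<le> \<epsilon>1 * norm (vs n) * norm (zs n - ys n)"
        using i y zs v n0[OF that] by (intro \<delta>(2)[of "\<iota> n"]) auto
      also have "\<dots> \<le> \<epsilon>1 * \<rho> * norm (zs n - ys n)" using v(2)[of n] e1 by (intro mult_right_mono mult_left_mono) auto
      finally have a: "inner (vs n) (zs n - ys n) \<le> \<epsilon>1 * \<rho> * norm (zs n - ys n)" .
      have "inner (vs n) (z - zs n) + inner (vs n) (ys n - y) \<le> norm (vs n) * norm (z - zs n) + norm (vs n) * norm (ys n - y)"
        by (intro add_mono norm_cauchy_schwarz)
      also have "\<dots> \<le> \<rho> * norm (z - zs n) + \<rho> * norm (ys n - y)" using v(2)[of n] by (intro add_mono mult_right_mono) auto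
      finally have "inner (vs n) (z - zs n) + inner (vs n) (ys n - y) \<le> \<rho> * (norm (z - zs n) + norm (ys n - y))"
        by (simp add: algebra_simps)
      moreover have "inner (vs n) (z - y) = inner (vs n) (zs n - ys n) + (inner (vs n) (z - zs n) + inner (vs n) (ys n - y))"
        by (simp add: inner_diff_right)
      ultimately show ?thesis using a by (simp add: b_def)
    qed
    have "inner (\<Sum>i<N j. w j i *\<^sub>R vs i) (z - y) \<le> (\<Sum>i<N j. w j i *\<^sub>R b i)" if "j \<ge> n0" for j
    proof -
      have "(\<Sum>i<N j. w j i *\<^sub>R (inner (vs i) (z - y) - b i)) \<le> 0"
        using vb that by (intro tail_weights_le[OF w[of j]]) auto
      then show ?thesis by (simp add: inner_sum_left right_diff_distrib sum_subtractf)
    qed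
    moreover have "(\<lambda>j. inner (\<Sum>i<N j. w j i *\<^sub>R vs i) (z - y)) \<longlonglongrightarrow> inner v (z - y)" by (intro tendsto_intros lim)
    ultimately have "inner v (z - y) \<le> \<epsilon>1 * \<rho> * norm (z - y)" using blim by (intro LIMSEQ_le) auto
    also have "\<dots> \<le> \<epsilon> * norm (z - y)" using e1 by (intro mult_right_mono) auto
    finally show ?thesis .
  qed
  then show "\<exists>\<delta>>0. \<forall>z\<in>S0. norm (z - y) < \<delta> \<longrightarrow> inner v (z - y) \<le> \<epsilon> * norm (z - y)"
    using \<delta>(1) by blast
qed

lemma ex_nearest_point_ball_compact:
  fixes S :: "'a::real_normed_vector set"
  assumes S: "S \<noteq> {}" and comp: "\<And>r. 0 < r \<Longrightarrow> compact (S \<inter> cball 0 r)"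
  obtains p where "p \<in> S" "\<And>y. y \<in> S \<Longrightarrow> norm (u - p) \<le> norm (u - y)"
proof -
  obtain y0 where y0: "y0 \<in> S" using S by auto
  \<comment> \<open>Every point at least as near to u as y0 lies in this ball, so minimising over
    the ball minimises over S.\<close>
  define r where "r = norm u + norm (u - y0) + 1"
  have in_ball: "y \<in> cball 0 r" if "norm (u - y) \<le> norm (u - y0)" for y
    using norm_triangle_sub[of y u] that by (simp add: r_def norm_minus_commute)
  have r: "0 < r" by (simp add: r_def add_nonneg_pos)
  have "\<exists>p\<in>S \<inter> cball 0 r. \<forall>y\<in>S \<inter> cball 0 r. norm (u - p) \<le> norm (u - y)"
    using y0 in_ball[of y0] by (intro continuous_attains_inf[OF comp[OF r]] continuous_intros) auto
  then obtain p where p: "p \<in> S \<inter> cball 0 r" "\<And>y. y \<in> S \<inter> cball 0 r \<Longrightarrow> norm (u - p) \<le> norm (u - y)"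
    by blast
  show ?thesis
  proof (rule that)
    show "p \<in> S" using p by simp
    fix y assume y: "y \<in> S"
    show "norm (u - p) \<le> norm (u - y)"
    proof (cases "norm (u - y) \<le> norm (u - y0)")
      case True then show ?thesis using p(2) in_ball y by blast
    next
      case False
      have "norm (u - p) \<le> norm (u - y0)" using p(2) in_ball[of y0] y0 by blast
      with False show ?thesis by simp
    qed
  qed
qed

section \<open>The sweeping process\<close>

lemma abs_cont_on_imp_continuous_on:
  assumes "abs_cont_on a b x"
  shows "continuous_on {a..b} x"
  unfolding continuous_on_iff
proof (intro ballI allI impI)
  fix s e assume s: "s \<in> {a..b}" and e: "0 < (e::real)"
  obtain \<delta> where \<delta>: "0 < \<delta>" "\<And>P. nonoverlapping a b P \<Longrightarrow> (\<Sum>(l, u)\<in>P. u - l) < \<delta> \<Longrightarrow> (\<Sum>(l, u)\<in>P. norm (x u - x l)) < e"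
    using abs_cont_on_nonoverlapping[OF assms e] by blast
  have *: "norm (x t - x s) < e" if "a \<le> s" "s < t" "t \<le> b" "t - s < \<delta>" for s t
    using \<delta>(2)[of "{(s, t)}"] that by (auto simp: nonoverlapping_def)
  show "\<exists>d>0. \<forall>t\<in>{a..b}. dist t s < d \<longrightarrow> dist (x t) (x s) < e"
  proof (intro exI[of _ \<delta>] conjI ballI impI \<delta>(1))
    fix t assume t: "t \<in> {a..b}" "dist t s < \<delta>"
    show "dist (x t) (x s) < e"
      using *[of s t] *[of t s] s t e by (cases "s < t"; cases "t < s") (auto simp: dist_norm norm_minus_commute)
  qed
qed

text \<open>The analysis is carried out over a type of class \<open>banach\<close>, where Bochner
  integrals are available; the general statement is reduced to this case by an isometric
  copy.\<close>

locale sweeping_process =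
  fixes T :: real
    and F :: "real \<Rightarrow> 'a::{real_inner,banach,second_countable_topology} \<Rightarrow> 'a set"
    and g :: "real \<Rightarrow> real \<Rightarrow> 'a \<Rightarrow> 'a"
    and C :: "real \<Rightarrow> 'a \<Rightarrow> 'a set"
    and c d :: "real \<Rightarrow> real"
    and \<sigma> :: "real \<times> real \<Rightarrow> real"
    and \<zeta> :: "real \<Rightarrow> real"
    and L :: real
    and x0 :: 'a
  assumes T_pos: "T > 0"
    and F_values: "\<And>t v. t \<in> {0..T} \<Longrightarrow> F t v \<noteq> {} \<and> closed (F t v) \<and> convex (F t v)"
    and F1: "\<And>v. meas_multifun T (\<lambda>t. F t v)"
    and F2: "AE t in lebesgue_on {0..T}. usc_weak (F t)"
    and F3: "integrable (lebesgue_on {0..T}) c" "integrable (lebesgue_on {0..T}) d"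
            "\<And>t. t \<in> {0..T} \<Longrightarrow> c t \<ge> 0 \<and> d t \<ge> 0"
            "AE t in lebesgue_on {0..T}. \<forall>v. Inf (norm ` F t v) \<le> c t * norm v + d t"
    and g1: "\<And>v. (\<lambda>(t, s). g t s v) \<in> borel_measurable (lebesgue_on ({0..T} \<times> {0..T}))"
    and g2: "\<And>r. r > 0 \<Longrightarrow> \<exists>\<mu>. integrable (lebesgue_on {0..T}) \<mu> \<and>
               (\<forall>t\<in>{0..T}. \<mu> t \<ge> 0) \<and>
               (\<forall>t s x y. (t, s) \<in> {(t, s). t \<in> {0..T} \<and> s \<in> {0..T} \<and> s \<le> t} \<and>
                  x \<in> cball 0 r \<and> y \<in> cball 0 r \<longrightarrow>
                  norm (g t s x - g t s y) \<le> \<mu> t * norm (x - y))"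
    and g3: "integrable (lebesgue_on {(t, s). t \<in> {0..T} \<and> s \<in> {0..T} \<and> s \<le> t}) \<sigma>"
            "\<And>t s. (t, s) \<in> {(t, s). t \<in> {0..T} \<and> s \<in> {0..T} \<and> s \<le> t} \<Longrightarrow> \<sigma> (t, s) \<ge> 0"
            "\<And>t s x. (t, s) \<in> {(t, s). t \<in> {0..T} \<and> s \<in> {0..T} \<and> s \<le> t} \<Longrightarrow>
               norm (g t s x) \<le> \<sigma> (t, s) * (1 + norm x)"
    and C_values: "\<And>t x. t \<in> {0..T} \<Longrightarrow> C t x \<noteq> {} \<and> closed (C t x)"
    and C1: "abs_cont_on 0 T \<zeta>" "0 \<le> L" "L < 1"
            "\<And>s t x y z. s \<in> {0..T} \<Longrightarrow> t \<in> {0..T} \<Longrightarrow>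
               \<bar>infdist z (C t x) - infdist z (C s y)\<bar> \<le> \<bar>\<zeta> t - \<zeta> s\<bar> + L * norm (x - y)"
    and C2: "equi_unif_subsmooth ({0..T} \<times> UNIV) (\<lambda>(t, x). C t x)"
    and C3: "\<And>t r A. t \<in> {0..T} \<Longrightarrow> r > 0 \<Longrightarrow> bounded A \<Longrightarrow>
               compact (closure ((\<Union>a\<in>A. C t a) \<inter> cball 0 r))"
    and x0_in: "x0 \<in> C 0 x0"
begin

section \<open>The Volterra term and the minimal selection\<close>

definition D :: "(real \<times> real) set" where
  "D = {(t, s). t \<in> {0..T} \<and> s \<in> {0..T} \<and> s \<le> t}"

text \<open>Extension by zero off the triangle turns the integral over [0, t] into one over the
  line, with the same domain for all t, as Fubini requires.\<close>

definition g0 :: "real \<Rightarrow> real \<Rightarrow> 'a \<Rightarrow> 'a" where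
  "g0 t s v = (if (t, s) \<in> D then g t s v else 0)"

definition \<sigma>0 :: "real \<times> real \<Rightarrow> real" where
  "\<sigma>0 p = (if p \<in> D then \<sigma> p else 0)"

definition Sg :: "real \<Rightarrow> real" where
  "Sg t = (LINT s|lebesgue. \<sigma>0 (t, s))"

lemma D_sets [measurable]: "D \<in> sets lebesgue"
proof -
  have "closed {p :: real \<times> real. 0 \<le> fst p \<and> fst p \<le> T \<and> 0 \<le> snd p \<and> snd p \<le> T \<and> snd p \<le> fst p}"
    by (intro closed_Collect_conj closed_Collect_le continuous_intros)
  moreover have "D = {p. 0 \<le> fst p \<and> fst p \<le> T \<and> 0 \<le> snd p \<and> snd p \<le> T \<and> snd p \<le> fst p}"
    by (auto simp: D_def)
  ultimately show ?thesis by simp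
qed

lemma \<sigma>0_integrable: "integrable lebesgue \<sigma>0"
proof -
  have "integrable lebesgue (\<lambda>p. indicator D p *\<^sub>R \<sigma> p)"
    using g3(1) D_sets integrable_restrict_space[of D lebesgue \<sigma>] by (simp add: D_def)
  moreover have "(\<lambda>p. indicator D p *\<^sub>R \<sigma> p) = \<sigma>0" by (auto simp: \<sigma>0_def indicator_def fun_eq_iff)
  ultimately show ?thesis by simp
qed

lemma \<sigma>0_nonneg: "0 \<le> \<sigma>0 p"
  using g3(2) by (cases p) (auto simp: \<sigma>0_def D_def)

lemma Sg_integrable: "integrable lebesgue Sg"
  unfolding Sg_def using lebesgue_Fubini(2)[OF \<sigma>0_integrable] .

lemma Sg_nonneg: "0 \<le> Sg t"
  unfolding Sg_def using \<sigma>0_nonneg by (intro Bochner_Integration.integral_nonneg) auto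

lemma g0_bound: "norm (g0 t s v) \<le> \<sigma>0 (t, s) * (1 + norm v)"
  using g3(3)[of t s v] by (auto simp: g0_def \<sigma>0_def D_def)

lemma g0_measurable: "(\<lambda>p. g0 (fst p) (snd p) v) \<in> borel_measurable lebesgue"
proof -
  have Q: "{0..T} \<times> {0..T} \<in> sets (lebesgue :: (real \<times> real) measure)"
    by (intro lmeasurable_compact[THEN fmeasurableD] compact_Times compact_Icc)
  have iff: "(\<lambda>p. g (fst p) (snd p) v) \<in> borel_measurable (lebesgue_on ({0..T} \<times> {0..T})) \<longleftrightarrow>
      (\<lambda>p. indicator ({0..T} \<times> {0..T}) p *\<^sub>R g (fst p) (snd p) v) \<in> borel_measurable lebesgue"
    by (rule borel_measurable_restrict_space_iff) (use Q in simp)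
  have "(\<lambda>(t, s). g t s v) = (\<lambda>p. g (fst p) (snd p) v)" by (simp add: case_prod_beta')
  with g1[of v] have "(\<lambda>p. indicator ({0..T} \<times> {0..T}) p *\<^sub>R g (fst p) (snd p) v) \<in> borel_measurable lebesgue"
    unfolding iff[symmetric] by (simp only:)
  then have "(\<lambda>p. indicator D p *\<^sub>R (indicator ({0..T} \<times> {0..T}) p *\<^sub>R g (fst p) (snd p) v)) \<in> borel_measurable lebesgue"
    by (rule borel_measurable_scaleR[OF borel_measurable_indicator[OF D_sets]])
  moreover have "(\<lambda>p. indicator D p *\<^sub>R (indicator ({0..T} \<times> {0..T}) p *\<^sub>R g (fst p) (snd p) v)) = (\<lambda>p. g0 (fst p) (snd p) v)"
    by (auto simp: g0_def D_def indicator_def fun_eq_iff)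
  ultimately show ?thesis by simp
qed

definition GX :: "(real \<Rightarrow> 'a) \<Rightarrow> real \<Rightarrow> 'a" where
  "GX X t = (LINT s|lebesgue. g0 t s (X s))"

text \<open>A curve with countably many values needs measurability of g for each fixed state only;
  \<open>g0\<close> composed with it is then measurable in the plane, and its domination by a
  multiple of \<sigma>0 gives integrability.\<close>

lemma step_integral_term:
  fixes x :: "nat \<Rightarrow> 'a"
  assumes j: "j \<in> measurable borel (count_space UNIV)" and R: "\<And>t. norm (x (j t)) \<le> R"
  shows "AE t in lebesgue. integrable lebesgue (\<lambda>s. g0 t s (x (j s)))"
    and "integrable lebesgue (GX (\<lambda>s. x (j s)))"
    and "AE t in lebesgue. norm (GX (\<lambda>s. x (j s)) t) \<le> (1 + R) * Sg t"
proof -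
  have R0: "0 \<le> R" using R[of 0] norm_ge_zero order_trans by blast
  have j2: "(\<lambda>p :: real \<times> real. j (snd p)) \<in> measurable lebesgue (count_space UNIV)"
    by (intro measurable_completion measurable_compose[OF _ j]) (simp add: borel_measurable_continuous_onI continuous_on_snd)
  have m: "(\<lambda>p. g0 (fst p) (snd p) (x (j (snd p)))) \<in> borel_measurable lebesgue"
    by (rule measurable_compose_countable[OF g0_measurable j2])
  have bd: "norm (g0 t s (x (j s))) \<le> (1 + R) * \<sigma>0 (t, s)" for t s
  proof -
    have "\<sigma>0 (t, s) * (1 + norm (x (j s))) \<le> \<sigma>0 (t, s) * (1 + R)"
      using R[of s] \<sigma>0_nonneg by (intro mult_left_mono) auto
    then show ?thesis using g0_bound[of t s "x (j s)"] by (simp add: mult.commute)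
  qed
  have i: "integrable lebesgue (\<lambda>p. g0 (fst p) (snd p) (x (j (snd p))))"
  proof (rule Bochner_Integration.integrable_bound[OF _ m])
    show "integrable lebesgue (\<lambda>p. (1 + R) * \<sigma>0 p)" using \<sigma>0_integrable by simp
    show "AE p in lebesgue. norm (g0 (fst p) (snd p) (x (j (snd p)))) \<le> norm ((1 + R) * \<sigma>0 p)"
    proof (rule AE_I2)
      fix p :: "real \<times> real"
      show "norm (g0 (fst p) (snd p) (x (j (snd p)))) \<le> norm ((1 + R) * \<sigma>0 p)"
        using bd[of "fst p" "snd p"] R0 \<sigma>0_nonneg[of p] by simp
    qed
  qed
  show a: "AE t in lebesgue. integrable lebesgue (\<lambda>s. g0 t s (x (j s)))"
    using lebesgue_Fubini(1)[OF i] by simp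
  show "integrable lebesgue (GX (\<lambda>s. x (j s)))"
    unfolding GX_def using lebesgue_Fubini(2)[OF i] by simp
  show "AE t in lebesgue. norm (GX (\<lambda>s. x (j s)) t) \<le> (1 + R) * Sg t"
    using a lebesgue_Fubini(1)[OF \<sigma>0_integrable]
  proof eventually_elim
    case (elim t)
    have "norm (GX (\<lambda>s. x (j s)) t) \<le> (LINT s|lebesgue. norm (g0 t s (x (j s))))"
      unfolding GX_def by (rule integral_norm_bound)
    also have "\<dots> \<le> (LINT s|lebesgue. (1 + R) * \<sigma>0 (t, s))"
      using elim bd by (intro integral_mono) auto
    also have "\<dots> = (1 + R) * Sg t" by (simp add: Sg_def)
    finally show ?case .
  qed
qed

text \<open>The variational inequality is part of the choice because measurability of the selection
  rests on it. The value 0 outside [0, T] makes the selection measurable on the whole line.\<close>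

definition fsel :: "real \<Rightarrow> 'a \<Rightarrow> 'a" where
  "fsel t v = (if t \<in> {0..T} then SOME p. p \<in> F t v \<and> (\<forall>y\<in>F t v. norm p \<le> norm y \<and> inner p (y - p) \<ge> 0) else 0)"

lemma fsel:
  assumes "t \<in> {0..T}"
  shows "fsel t v \<in> F t v" "y \<in> F t v \<Longrightarrow> norm (fsel t v) \<le> norm y" "y \<in> F t v \<Longrightarrow> inner (fsel t v) (y - fsel t v) \<ge> 0"
proof -
  have "\<exists>p. p \<in> F t v \<and> (\<forall>y\<in>F t v. norm p \<le> norm y \<and> inner p (y - p) \<ge> 0)"
  proof -
    obtain p where "p \<in> F t v" "\<And>y. y \<in> F t v \<Longrightarrow> norm (0 - p) \<le> norm (0 - y)" "\<And>y. y \<in> F t v \<Longrightarrow> inner (0 - p) (y - p) \<le> 0"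
      using ex_nearest_point_convex[of "F t v" 0] F_values[OF assms, of v] by blast
    then show ?thesis by auto
  qed
  from someI_ex[OF this] assms
  show "fsel t v \<in> F t v" "y \<in> F t v \<Longrightarrow> norm (fsel t v) \<le> norm y" "y \<in> F t v \<Longrightarrow> inner (fsel t v) (y - fsel t v) \<ge> 0"
    by (auto simp: fsel_def)
qed

lemma fsel_measurable: "(\<lambda>t. fsel t v) \<in> borel_measurable lebesgue"
proof -
  have "(\<lambda>t. fsel t v) \<in> borel_measurable (lebesgue_on {0..T})"
    using fsel by (intro min_norm_selection_measurable[OF F1[of v]]) auto
  then have "(\<lambda>t. indicator {0..T} t *\<^sub>R fsel t v) \<in> borel_measurable lebesgue"
    using borel_measurable_restrict_space_iff[of "{0..T}" lebesgue "\<lambda>t. fsel t v"] by simp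
  moreover have "(\<lambda>t. indicator {0..T} t *\<^sub>R fsel t v) = (\<lambda>t. fsel t v)" by (auto simp: fsel_def indicator_def fun_eq_iff)
  ultimately show ?thesis by simp
qed

lemma fsel_bound: "AE t in lebesgue. t \<in> {0..T} \<longrightarrow> (\<forall>v. norm (fsel t v) \<le> c t * norm v + d t)"
proof -
  have "AE t in lebesgue. t \<in> {0..T} \<longrightarrow> (\<forall>v. Inf (norm ` F t v) \<le> c t * norm v + d t)"
    using F3(4) by (simp add: AE_restrict_space_iff)
  then show ?thesis
  proof eventually_elim
    case (elim t)
    show ?case
    proof (intro impI allI)
      fix v assume t: "t \<in> {0..T}"
      have "norm (fsel t v) \<le> Inf (norm ` F t v)"
        using fsel[OF t] F_values[OF t] by (intro cINF_greatest) auto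
      with elim t show "norm (fsel t v) \<le> c t * norm v + d t" by (meson order_trans)
    qed
  qed
qed

section \<open>Mass as a clock\<close>

text \<open>One density for all data. The summand 1 makes its primitive strictly increasing, so that
  mass can replace time, and makes the density a positive weight on [0, T]; its vanishing elsewhere
  keeps the primitive constant after T.\<close>

lemma ex_density:
  "\<exists>m. integrable lebesgue m \<and> (\<forall>t. 0 \<le> m t) \<and> (\<forall>t. t \<notin> {0..T} \<longrightarrow> m t = 0) \<and> (\<forall>t\<in>{0..T}. 1 + c t + d t + Sg t \<le> m t) \<and>
     (\<forall>s t. 0 \<le> s \<longrightarrow> s \<le> t \<longrightarrow> t \<le> T \<longrightarrow> \<bar>\<zeta> t - \<zeta> s\<bar> \<le> (LINT r:{s..t}|lebesgue. m r))"
proof -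
  obtain m1 :: "real \<Rightarrow> real" where m1: "integrable lebesgue m1" "\<And>t. 0 \<le> m1 t"
    "\<And>s t. 0 \<le> s \<Longrightarrow> s \<le> t \<Longrightarrow> t \<le> T \<Longrightarrow> norm (\<zeta> t - \<zeta> s) \<le> (LINT r:{s..t}|lebesgue. m1 r)"
    using abs_cont_on_imp_density[OF C1(1) T_pos] by blast
  define m where "m t = indicator {0..T} t *\<^sub>R (1 + c t + d t + Sg t + m1 t)" for t
  have I: "integrable lebesgue (\<lambda>t. indicator {0..T} t *\<^sub>R f t)" if "integrable (lebesgue_on {0..T}) f" for f :: "real \<Rightarrow> real"
    using that by (simp add: integrable_restrict_space)
  have mi: "integrable lebesgue m"
    unfolding m_def
  proof (intro I Bochner_Integration.integrable_add F3(1,2))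
    show "integrable (lebesgue_on {0..T}) (\<lambda>x. 1)" by simp
    show "integrable (lebesgue_on {0..T}) Sg" "integrable (lebesgue_on {0..T}) m1"
      by (subst integrable_restrict_space; auto simp del: real_scaleR_def intro!: integrable_mult_indicator Sg_integrable m1(1))+
  qed
  have nn: "0 \<le> 1 + c t + d t + Sg t + m1 t" "m1 t \<le> 1 + c t + d t + Sg t + m1 t" if "t \<in> {0..T}" for t
    using F3(3)[OF that] Sg_nonneg[of t] m1(2)[of t] by auto
  show ?thesis
  proof (intro exI[of _ m] conjI allI impI ballI mi)
    show "0 \<le> m t" for t using nn[of t] by (auto simp: m_def indicator_def)
    show "m t = 0" if "t \<notin> {0..T}" for t using that by (simp add: m_def)
    show "1 + c t + d t + Sg t \<le> m t" if "t \<in> {0..T}" for t using that m1(2)[of t] by (simp add: m_def)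
    fix s t assume st: "0 \<le> s" "s \<le> t" "t \<le> T"
    have "norm (\<zeta> t - \<zeta> s) \<le> (LINT r:{s..t}|lebesgue. m1 r)" by (rule m1(3)[OF st])
    also have "\<dots> \<le> (LINT r:{s..t}|lebesgue. m r)"
      using nn st by (intro set_integral_mono integrable_imp_set_integrable_lebesgue m1(1) mi) (auto simp: m_def)
    finally show "\<bar>\<zeta> t - \<zeta> s\<bar> \<le> (LINT r:{s..t}|lebesgue. m r)" by simp
  qed
qed

definition m :: "real \<Rightarrow> real" where
  "m = (SOME m. integrable lebesgue m \<and> (\<forall>t. 0 \<le> m t) \<and> (\<forall>t. t \<notin> {0..T} \<longrightarrow> m t = 0) \<and> (\<forall>t\<in>{0..T}. 1 + c t + d t + Sg t \<le> m t) \<and>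
     (\<forall>s t. 0 \<le> s \<longrightarrow> s \<le> t \<longrightarrow> t \<le> T \<longrightarrow> \<bar>\<zeta> t - \<zeta> s\<bar> \<le> (LINT r:{s..t}|lebesgue. m r)))"

lemma m:
  shows "integrable lebesgue m" "0 \<le> m t" "t \<notin> {0..T} \<Longrightarrow> m t = 0" "t \<in> {0..T} \<Longrightarrow> 1 + c t + d t + Sg t \<le> m t"
    "0 \<le> s \<Longrightarrow> s \<le> t \<Longrightarrow> t \<le> T \<Longrightarrow> \<bar>\<zeta> t - \<zeta> s\<bar> \<le> (LINT r:{s..t}|lebesgue. m r)"
  using someI_ex[OF ex_density] unfolding m_def[symmetric] by blast+

definition \<Lambda> :: "real \<Rightarrow> real" where
  "\<Lambda> t = (LINT s:{0..t}|lebesgue. m s)"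

lemma m_set_integrable: "set_integrable lebesgue {a..b} m"
  using m(1) by (intro integrable_imp_set_integrable_lebesgue) auto

lemma \<Lambda>_diff: "0 \<le> s \<Longrightarrow> s \<le> t \<Longrightarrow> \<Lambda> t - \<Lambda> s = (LINT r:{s..t}|lebesgue. m r)"
  unfolding \<Lambda>_def using set_integral_interval_split[OF m(1), of 0 s t] by simp

lemma \<Lambda>_0: "\<Lambda> 0 = 0"
  unfolding \<Lambda>_def by (rule set_integral_point_zero)

lemma \<Lambda>_mono: "s \<le> t \<Longrightarrow> \<Lambda> s \<le> \<Lambda> t"
  unfolding \<Lambda>_def set_lebesgue_integral_def using m_set_integrable m(2)
  by (intro integral_mono) (auto simp: set_integrable_def indicator_def)

lemma \<Lambda>_strict:
  assumes "0 \<le> s" "s \<le> t" "t \<le> T"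
  shows "t - s \<le> \<Lambda> t - \<Lambda> s"
proof -
  have "(LINT r:{s..t}|lebesgue. 1::real) \<le> (LINT r:{s..t}|lebesgue. m r)"
  proof (rule set_integral_mono)
    show "set_integrable lebesgue {s..t} (\<lambda>r. 1::real)" using set_integral_const_interval(1) assms by blast
    fix r assume "r \<in> {s..t}"
    then have "r \<in> {0..T}" using assms by auto
    then show "1 \<le> m r" using m(4)[of r] F3(3)[of r] Sg_nonneg[of r] by linarith
  qed (rule m_set_integrable)
  moreover have "(LINT r:{s..t}|lebesgue. 1::real) = t - s" using set_integral_const_interval(2)[of s t "1::real"] assms by simp
  ultimately show ?thesis using \<Lambda>_diff assms by simp
qed

lemma \<zeta>_\<Lambda>: "0 \<le> s \<Longrightarrow> s \<le> t \<Longrightarrow> t \<le> T \<Longrightarrow> \<bar>\<zeta> t - \<zeta> s\<bar> \<le> \<Lambda> t - \<Lambda> s"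
  using m(5) \<Lambda>_diff by simp

definition TL :: real where "TL = \<Lambda> T"

lemma TL_pos: "0 < TL"
  using \<Lambda>_strict[of 0 T] T_pos \<Lambda>_0 by (simp add: TL_def)

lemma \<Lambda>_continuous: "continuous_on {0..T} \<Lambda>"
proof (rule abs_cont_on_imp_continuous_on, rule abs_cont_on_dominated[OF m(1)])
  fix s t :: real assume "0 \<le> s" "s \<le> t" "t \<le> T"
  then show "norm (\<Lambda> t - \<Lambda> s) \<le> (LINT r:{s..t}|lebesgue. m r)" using \<Lambda>_diff[of s t] \<Lambda>_mono[of s t] by simp
qed

text \<open>The inverse of \<Lambda> on [0, T], where \<Lambda> is continuous and strictly
  increasing.\<close>

definition \<tau> :: "real \<Rightarrow> real" where
  "\<tau> y = (SOME t. t \<in> {0..T} \<and> \<Lambda> t = y)"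

lemma \<tau>:
  assumes "0 \<le> y" "y \<le> TL"
  shows "0 \<le> \<tau> y" "\<tau> y \<le> T" "\<Lambda> (\<tau> y) = y"
proof -
  have "\<exists>t. t \<in> {0..T} \<and> \<Lambda> t = y"
    using IVT'[of \<Lambda> 0 y T] assms \<Lambda>_0 \<Lambda>_continuous T_pos by (auto simp: TL_def)
  from someI_ex[OF this] show "0 \<le> \<tau> y" "\<tau> y \<le> T" "\<Lambda> (\<tau> y) = y" by (auto simp: \<tau>_def)
qed

lemma \<Lambda>_range: "t \<in> {0..T} \<Longrightarrow> 0 \<le> \<Lambda> t \<and> \<Lambda> t \<le> TL"
  using \<Lambda>_mono[of 0 t] \<Lambda>_mono[of t T] \<Lambda>_0 by (auto simp: TL_def)

lemma \<Lambda>_le_imp: "0 \<le> t \<Longrightarrow> t \<le> T \<Longrightarrow> 0 \<le> s \<Longrightarrow> s \<le> T \<Longrightarrow> \<Lambda> s \<le> \<Lambda> t \<Longrightarrow> s \<le> t"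
  using \<Lambda>_strict[of t s] by (cases "s \<le> t") auto

subsection \<open>The catching-up scheme\<close>

lemma \<Lambda>_le_TL: "\<Lambda> t \<le> TL"
proof (cases "t \<le> T")
  case True then show ?thesis using \<Lambda>_mono by (simp add: TL_def)
next
  case False
  have "\<Lambda> t = \<Lambda> T"
    unfolding \<Lambda>_def set_lebesgue_integral_def
    using m(3) False by (intro Bochner_Integration.integral_cong refl) (auto simp: indicator_def)
  then show ?thesis by (simp add: TL_def)
qed

lemma integral_dominated_by_\<Lambda>:
  fixes f :: "real \<Rightarrow> 'b::{banach,second_countable_topology}"
  assumes f: "integrable lebesgue f" and le: "AE t in lebesgue. norm (f t) \<le> \<beta> * m t" and pq: "0 \<le> p" "p \<le> q"
  shows "norm (LINT t:{p..q}|lebesgue. f t) \<le> \<beta> * (\<Lambda> q - \<Lambda> p)"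
proof -
  have "norm (LINT t:{p..q}|lebesgue. f t) \<le> (LINT t:{p..q}|lebesgue. norm (f t))" by (rule set_integral_norm_le)
  also have "\<dots> \<le> (LINT t:{p..q}|lebesgue. \<beta> * m t)"
    using f m(1) le by (intro set_integral_mono_AE integrable_imp_set_integrable_lebesgue) (auto elim: eventually_mono)
  also have "\<dots> = \<beta> * (\<Lambda> q - \<Lambda> p)" using \<Lambda>_diff[OF pq] by simp
  finally show ?thesis .
qed

lemma GX_outside: "t \<notin> {0..T} \<Longrightarrow> GX X t = 0"
proof -
  assume "t \<notin> {0..T}"
  then have "g0 t s (X s) = 0" for s by (auto simp: g0_def D_def)
  then show ?thesis by (simp add: GX_def)
qed

text \<open>The affine growth of F and g costs one common factor 1 + R, since m dominates c + d +
  Sg.\<close>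

lemma step_terms:
  fixes x :: "nat \<Rightarrow> 'a"
  assumes j: "j \<in> measurable borel (count_space UNIV)" and R: "\<And>t. norm (x (j t)) \<le> R"
  shows "integrable lebesgue (\<lambda>t. fsel t (x (j t)))"
    and "AE t in lebesgue. norm (fsel t (x (j t))) + norm (GX (\<lambda>s. x (j s)) t) \<le> (1 + R) * m t"
proof -
  have R0: "0 \<le> R" using R[of 0] norm_ge_zero order_trans by blast
  have "j \<in> measurable lebesgue (count_space UNIV)" using j by (intro measurable_completion) simp
  then have meas: "(\<lambda>t. fsel t (x (j t))) \<in> borel_measurable lebesgue"
    by (rule measurable_compose_countable[OF fsel_measurable])
  show ae: "AE t in lebesgue. norm (fsel t (x (j t))) + norm (GX (\<lambda>s. x (j s)) t) \<le> (1 + R) * m t"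
    using fsel_bound step_integral_term(3)[where j = j and x = x, OF j R]
  proof eventually_elim
    case (elim t)
    show ?case
    proof (cases "t \<in> {0..T}")
      case True
      have cd: "0 \<le> c t" "0 \<le> d t" using F3(3)[OF True] by auto
      have "norm (fsel t (x (j t))) \<le> c t * norm (x (j t)) + d t" using elim True by blast
      also have "\<dots> \<le> c t * (1 + R) + d t * (1 + R)"
        using cd R[of t] R0 by (intro add_mono mult_left_mono) (auto simp: algebra_simps)
      finally have "norm (fsel t (x (j t))) + norm (GX (\<lambda>s. x (j s)) t) \<le> (1 + R) * (c t + d t + Sg t)"
        using elim by (simp add: algebra_simps)
      also have "\<dots> \<le> (1 + R) * m t" using m(4)[OF True] R0 by (intro mult_left_mono) auto
      finally show ?thesis .
    next
      case False
      have "fsel t (x (j t)) = 0" using False by (simp only: fsel_def if_False)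
      then show ?thesis using R0 m(2)[of t] by (simp add: GX_outside[OF False])
    qed
  qed
  show "integrable lebesgue (\<lambda>t. fsel t (x (j t)))"
  proof (rule Bochner_Integration.integrable_bound[OF _ meas])
    show "integrable lebesgue (\<lambda>t. (1 + R) * m t)" using m(1) by simp
    show "AE t in lebesgue. norm (fsel t (x (j t))) \<le> norm ((1 + R) * m t)"
      using ae by eventually_elim (smt (verit) norm_ge_zero real_norm_def)
  qed
qed

section \<open>Constants and estimates of the scheme\<close>

text \<open>Ratio of step length to \<eta> times the size of the state. The drift enters a step
  twice, directly and through the projection, and \<zeta> once, whence 3; the motion of the set with
  the state adds L times the previous step.\<close>

definition \<kappa> :: real where "\<kappa> = 3 / (1 - L)"

text \<open>Discrete Gronwall bound for 1 plus the norm of the nodes. The factor 2 allows N + 1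
  steps, whose total mass (N + 1) \<eta> is at most 2 TL.\<close>

definition R0 :: real where "R0 = (1 + norm x0) * exp (2 * \<kappa> * TL)"

text \<open>One constant above R0, \<kappa> R0 and their sum, so that a single bound serves states,
  selections, normals and errors.\<close>

definition BB :: real where "BB = (2 + \<kappa>) * R0"

lemma \<kappa>: "3 \<le> \<kappa>" "3 + L * \<kappa> = \<kappa>"
  using C1(2,3) by (auto simp: \<kappa>_def field_simps)

lemma R0_pos: "1 \<le> R0"
proof -
  have "1 * 1 \<le> (1 + norm x0) * exp (2 * \<kappa> * TL)" using \<kappa> TL_pos by (intro mult_mono) auto
  then show ?thesis by (simp add: R0_def)
qed

lemma projection_exists:
  assumes "t \<in> {0..T}"
  obtains p where "p \<in> C t y" "\<And>z. z \<in> C t y \<Longrightarrow> norm (u - p) \<le> norm (u - z)"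
proof (rule ex_nearest_point_ball_compact[of "C t y" u])
  show "C t y \<noteq> {}" using C_values[OF assms] by blast
  fix r :: real assume "0 < r"
  then have "compact (closure ((\<Union>a\<in>{y}. C t a) \<inter> cball 0 r))" using C3[OF assms, of r "{y}"] by simp
  moreover have "closed (C t y \<inter> cball 0 r)" using C_values[OF assms] by (intro closed_Int) auto
  ultimately show "compact (C t y \<inter> cball 0 r)" by simp
qed (rule that)

text \<open>\<eta> is the mass of a cell; on a cell X is the node at its left end, Y the node at its
  right end and \<theta> that right end. X is piecewise constant and feeds F, g and the state
  argument of C; v is normal at Y. The last clause compares X with the integral curve of the
  velocities.\<close>

definition approximation ::
    "real \<Rightarrow> (real \<Rightarrow> 'a) \<Rightarrow> (real \<Rightarrow> 'a) \<Rightarrow> (real \<Rightarrow> real) \<Rightarrow> (real \<Rightarrow> 'a) \<Rightarrow> (real \<Rightarrow> 'a) \<Rightarrow> bool" where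
  "approximation \<eta> X Y \<theta> f v \<longleftrightarrow>
    (\<forall>t. norm (X t) \<le> BB) \<and>
    (\<forall>t\<in>{0..T}. \<theta> t \<in> {0..T} \<and> \<bar>\<zeta> (\<theta> t) - \<zeta> t\<bar> \<le> \<eta> \<and> Y t \<in> C (\<theta> t) (X t) \<and> norm (Y t - X t) \<le> BB * \<eta> \<and>
        v t \<in> clarke_normal (C (\<theta> t) (X t)) (Y t) \<and> f t \<in> F t (X t)) \<and>
    (\<forall>t. norm (v t) \<le> BB * m t) \<and>
    integrable lebesgue f \<and> integrable lebesgue v \<and> integrable lebesgue (GX X) \<and>
    (AE t in lebesgue. norm (f t) \<le> BB * m t \<and> norm (GX X t) \<le> BB * m t \<and> integrable lebesgue (\<lambda>s. g0 t s (X s))) \<and>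
    (\<forall>t\<in>{0..T}. norm (X t - (x0 + (LINT s:{0..t}|lebesgue. f s + GX X s - v s))) \<le> BB * \<eta>)"

lemma approximate_solution:
  fixes N :: nat
  assumes N: "0 < N" and \<eta>: "\<eta> = TL / real N"
  shows "\<exists>X Y \<theta> f v. approximation \<eta> X Y \<theta> f v"
proof -
  have \<eta>0: "0 < \<eta>" using TL_pos N \<eta> by simp
  have N\<eta>: "real N * \<eta> = TL" using N \<eta> by simp
  have \<eta>TL: "\<eta> \<le> TL"
  proof -
    have "1 * \<eta> \<le> real N * \<eta>" using N \<eta>0 by (intro mult_right_mono) auto
    then show ?thesis using N\<eta> by simp
  qed
  \<comment> \<open>The cap at TL lets the nodes continue as T for i \<ge> N, so the recursion needs
    no final index.\<close>
  define tn where "tn i = \<tau> (min (real i * \<eta>) TL)" for i :: nat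
  have tn: "0 \<le> tn i" "tn i \<le> T" "\<Lambda> (tn i) = min (real i * \<eta>) TL" for i
    using \<tau>[of "min (real i * \<eta>) TL"] \<eta>0 TL_pos by (auto simp: tn_def)
  have tnT: "tn i \<in> {0..T}" for i using tn by auto
  have tn_mono: "tn i \<le> tn (Suc i)" for i
  proof (rule \<Lambda>_le_imp[OF tn(1,2) tn(1,2)])
    have "real i * \<eta> \<le> real (Suc i) * \<eta>" using \<eta>0 by (intro mult_right_mono) auto
    then show "\<Lambda> (tn i) \<le> \<Lambda> (tn (Suc i))" unfolding tn(3) by (rule min.mono) simp
  qed
  have tn0: "tn 0 = 0"
    using \<Lambda>_le_imp[of 0 "tn 0"] tn[of 0] \<Lambda>_0 T_pos TL_pos by simp
  have cell: "\<Lambda> (tn (Suc i)) - \<Lambda> (tn i) \<le> \<eta>" for i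
    using \<eta>0 by (auto simp: tn min_def algebra_simps)
  \<comment> \<open>The cell that contains t, read off in mass. At t = T it equals N, so the step
    over the degenerate cell at T is used as well.\<close>
  define idx where "idx t = nat \<lfloor>\<Lambda> t / \<eta>\<rfloor>" for t
  have \<Lambda>m: "\<Lambda> \<in> borel_measurable borel" using \<Lambda>_mono by (intro borel_measurable_mono) (simp add: mono_def)
  have idx_m: "idx \<in> measurable borel (count_space UNIV)"
    unfolding idx_def using \<Lambda>m by measurable
  have idx_le: "real (idx t) * \<eta> \<le> max 0 (\<Lambda> t)" for t
  proof -
    have "real (idx t) \<le> max 0 (\<Lambda> t / \<eta>)" unfolding idx_def by linarith
    then have "real (idx t) * \<eta> \<le> max 0 (\<Lambda> t / \<eta>) * \<eta>" using \<eta>0 by (intro mult_right_mono) auto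
    also have "\<dots> = max 0 (\<Lambda> t)" using \<eta>0 by (auto simp: max_def zero_le_divide_iff)
    finally show ?thesis .
  qed
  have idx_gt: "\<Lambda> t < (real (idx t) + 1) * \<eta>" for t
  proof -
    have "\<Lambda> t / \<eta> < real (idx t) + 1" unfolding idx_def by linarith
    then show ?thesis using \<eta>0 by (simp add: field_simps)
  qed
  have idxN: "idx t \<le> N" for t
  proof -
    have "real (idx t) * \<eta> \<le> real N * \<eta>" using idx_le[of t] \<Lambda>_le_TL[of t] TL_pos N\<eta> by (auto simp: max_def split: if_splits)
    then show ?thesis using \<eta>0 by simp
  qed
  have idx_less: "idx t \<le> i" if "\<Lambda> t < (real i + 1) * \<eta>" for t i
  proof (rule ccontr)
    assume "\<not> idx t \<le> i"
    then have "(real i + 1) * \<eta> \<le> real (idx t) * \<eta>" using \<eta>0 by (intro mult_right_mono) auto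
    moreover have "0 < (real i + 1) * \<eta>" using \<eta>0 by simp
    ultimately show False using idx_le[of t] that by (auto simp: max_def split: if_splits)
  qed
  have in_cell: "tn (idx t) \<le> t" "t \<le> tn (Suc (idx t))" if t: "t \<in> {0..T}" for t
  proof -
    have r: "0 \<le> \<Lambda> t" "\<Lambda> t \<le> TL" using \<Lambda>_range[OF t] by auto
    have t': "0 \<le> t" "t \<le> T" using t by auto
    show "tn (idx t) \<le> t" by (rule \<Lambda>_le_imp[OF t' tn(1,2)]) (use idx_le[of t] r in \<open>simp add: tn(3)\<close>)
    show "t \<le> tn (Suc (idx t))"
      by (rule \<Lambda>_le_imp[OF tn(1,2) t']) (use idx_gt[of t] r in \<open>simp add: tn(3) add.commute\<close>)
  qed
  \<comment> \<open>Causality: before the end of the i-th cell no node beyond i has been seen, which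
    is what the Volterra term needs.\<close>
  have before: "idx s \<le> i" if "s \<le> t" "t < tn (Suc i)" "0 \<le> t" for s t i
  proof (rule idx_less)
    have "\<Lambda> s \<le> \<Lambda> t" using that \<Lambda>_mono by blast
    also have "\<dots> < \<Lambda> (tn (Suc i))" using \<Lambda>_strict[of t "tn (Suc i)"] that tn by auto
    also have "\<dots> \<le> (real i + 1) * \<eta>" by (simp add: tn add.commute)
    finally show "\<Lambda> s < (real i + 1) * \<eta>" .
  qed
  have idx_eq: "idx t = i" if "tn i \<le> t" "t < tn (Suc i)" "i < N" for t i
  proof (rule antisym)
    have t0: "0 \<le> t" using that tn(1)[of i] by linarith
    show "idx t \<le> i" using before[of t t i] that t0 by simp
    have "real i * \<eta> \<le> real N * \<eta>" using that \<eta>0 by (intro mult_right_mono) auto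
    then have "real i * \<eta> \<le> \<Lambda> t" using \<Lambda>_mono[OF that(1)] N\<eta> by (simp add: tn)
    also have "\<dots> < (real (idx t) + 1) * \<eta>" by (rule idx_gt)
    finally have "real i < real (idx t) + 1" using \<eta>0 by simp
    then show "i \<le> idx t" by linarith
  qed
  \<comment> \<open>Drift over the i-th cell. The minimum makes it depend on the nodes up to i only,
    so that the recursion is well-founded; inside the cell, for arguments up to t, it changes
    nothing.\<close>
  define h where "h f i = (LINT t:{tn i..tn (Suc i)}|lebesgue. fsel t (f (min i (idx t))) + GX (\<lambda>s. f (min i (idx s))) t)"
    for f :: "nat \<Rightarrow> 'a" and i
  \<comment> \<open>Course-of-values recursion by choice: r is an admissible n-th node when f gives
    the earlier ones. The Volterra term needs the whole history, not just the last node.\<close>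
  define P where "P f n r = (case n of 0 \<Rightarrow> r = x0 | Suc i \<Rightarrow> r \<in> C (tn (Suc i)) (f i) \<and>
      (\<forall>z\<in>C (tn (Suc i)) (f i). norm (f i + h f i - r) \<le> norm (f i + h f i - z)))" for f :: "nat \<Rightarrow> 'a" and n r
  have "\<exists>x. \<forall>n. P x n (x n)"
  proof (rule dependent_wellorder_choice)
    fix r :: 'a and f f' :: "nat \<Rightarrow> 'a" and n :: nat assume eq: "\<And>y. y < n \<Longrightarrow> f y = f' y"
    show "P f n r = P f' n r"
    proof (cases n)
      case (Suc i)
      then have "(\<lambda>t. f (min i (idx t))) = (\<lambda>t. f' (min i (idx t)))" using eq by auto
      moreover from this have "h f i = h f' i" unfolding h_def by metis
      ultimately show ?thesis using eq[of i] Suc by (simp add: P_def)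
    qed (simp add: P_def)
  next
    fix n :: nat and f :: "nat \<Rightarrow> 'a"
    show "\<exists>r. P f n r"
    proof (cases n)
      case (Suc i)
      obtain p where "p \<in> C (tn (Suc i)) (f i)" "\<And>z. z \<in> C (tn (Suc i)) (f i) \<Longrightarrow> norm (f i + h f i - p) \<le> norm (f i + h f i - z)"
        using projection_exists[OF tnT] by metis
      then show ?thesis by (auto simp: P_def Suc)
    qed (simp add: P_def)
  qed
  then obtain x where x: "\<And>n. P x n (x n)" by blast
  have x_0: "x 0 = x0" using x[of 0] by (simp add: P_def)
  have xS: "x (Suc i) \<in> C (tn (Suc i)) (x i)"
    and near: "z \<in> C (tn (Suc i)) (x i) \<Longrightarrow> norm (x i + h x i - x (Suc i)) \<le> norm (x i + h x i - z)" for i z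
    using x[of "Suc i"] by (auto simp: P_def)
  \<comment> \<open>The displacement removed by the projection, a proximal normal at the new
    node.\<close>
  define w where "w i = x i + h x i - x (Suc i)" for i
  have wN: "w i \<in> clarke_normal (C (tn (Suc i)) (x i)) (x (Suc i))" for i
    unfolding w_def using xS near by (intro proximal_imp_clarke_normal) auto
  have min_m: "(\<lambda>t. min i (idx t)) \<in> measurable borel (count_space UNIV)" for i
    using idx_m by (rule measurable_compose) simp
  have h_bound: "norm (h x i) \<le> \<beta> * \<eta>" if b: "\<And>j. j \<le> i \<Longrightarrow> 1 + norm (x j) \<le> \<beta>" for i \<beta>
  proof -
    have R: "norm (x (min i (idx t))) \<le> \<beta> - 1" for t using b[of "min i (idx t)"] by simp
    have \<beta>0: "0 \<le> \<beta>" using b[of i] norm_ge_zero[of "x i"] by linarith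
    have "norm (h x i) \<le> \<beta> * (\<Lambda> (tn (Suc i)) - \<Lambda> (tn i))"
      unfolding h_def
    proof (rule integral_dominated_by_\<Lambda>)
      show "integrable lebesgue (\<lambda>t. fsel t (x (min i (idx t))) + GX (\<lambda>s. x (min i (idx s))) t)"
        by (intro Bochner_Integration.integrable_add step_terms(1)[where j = "\<lambda>t. min i (idx t)" and x = x, OF min_m R] step_integral_term(2)[where j = "\<lambda>t. min i (idx t)" and x = x, OF min_m R])
      show "AE t in lebesgue. norm (fsel t (x (min i (idx t))) + GX (\<lambda>s. x (min i (idx s))) t) \<le> \<beta> * m t"
        using step_terms(2)[where j = "\<lambda>t. min i (idx t)" and x = x, OF min_m R] by eventually_elim (simp add: norm_triangle_le)
    qed (use tn tn_mono in auto)
    also have "\<dots> \<le> \<beta> * \<eta>" using cell \<beta>0 by (intro mult_left_mono) auto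
    finally show ?thesis .
  qed
  define b where "b i = (1 + norm x0) * (1 + \<kappa> * \<eta>) ^ i" for i :: nat
  have \<kappa>\<eta>: "0 < \<kappa> * \<eta>" using \<kappa> \<eta>0 by simp
  have b_mono: "b i \<le> b j" if "i \<le> j" for i j
    unfolding b_def using that \<kappa>\<eta> by (intro mult_left_mono power_increasing) auto
  have b1: "1 \<le> b i" for i
    using b_mono[of 0 i] by (simp add: b_def) (smt (verit) norm_ge_zero)
  have bS: "b (Suc i) = b i + \<kappa> * \<eta> * b i" for i by (simp add: b_def algebra_simps)
  \<comment> \<open>The removed displacement is the distance to the new set. It splits into the
    drift and the distance of x i, which lay in the previous set, so the hypothesis on C compares
    both. For i = 0 the initial point lies in C 0 x0 and no previous step enters.\<close>
  have w_bound: "norm (w i) \<le> norm (h x i) + \<eta> + L * (if i = 0 then 0 else norm (x i - x (i - 1)))" for i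
  proof -
    let ?S = "C (tn (Suc i)) (x i)"
    let ?p = "x (i - 1)"
    have ne: "?S \<noteq> {}" using C_values[OF tnT] by blast
    have "norm (w i) \<le> infdist (x i + h x i) ?S"
      unfolding infdist_notempty[OF ne] w_def using near by (intro cINF_greatest ne) (auto simp: dist_norm)
    also have "\<dots> \<le> infdist (x i) ?S + norm (h x i)"
      using infdist_triangle[of "x i + h x i" ?S "x i"] by (simp add: dist_norm)
    also have "infdist (x i) ?S \<le> \<eta> + L * (if i = 0 then 0 else norm (x i - ?p))"
    proof -
      have mem: "x i \<in> C (tn i) (if i = 0 then x i else ?p)"
        using xS[of "i - 1"] x0_in x_0 tn0 by (cases i) auto
      have "\<bar>infdist (x i) ?S - infdist (x i) (C (tn i) (if i = 0 then x i else ?p))\<bar>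
          \<le> \<bar>\<zeta> (tn (Suc i)) - \<zeta> (tn i)\<bar> + L * norm (x i - (if i = 0 then x i else ?p))"
        by (rule C1(4)[OF tnT tnT])
      moreover have "\<bar>\<zeta> (tn (Suc i)) - \<zeta> (tn i)\<bar> \<le> \<eta>"
        using \<zeta>_\<Lambda>[of "tn i" "tn (Suc i)"] tn tn_mono[of i] cell[of i] by auto
      moreover have "infdist (x i) (C (tn i) (if i = 0 then x i else ?p)) = 0" using mem by (rule infdist_zero)
      ultimately show ?thesis by (auto split: if_splits)
    qed
    finally show ?thesis by simp
  qed
  have step: "1 + norm (x i) \<le> b i \<and> norm (h x i) \<le> b i * \<eta> \<and> norm (w i) \<le> \<kappa> * \<eta> * b i \<and> norm (x (Suc i) - x i) \<le> \<kappa> * \<eta> * b i" for i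
  proof (induction i rule: less_induct)
    case (less i)
    have xb: "1 + norm (x i) \<le> b i"
    proof (cases i)
      case 0 then show ?thesis by (simp add: x_0 b_def)
    next
      case (Suc k)
      have "norm (x i) \<le> norm (x k) + norm (x (Suc k) - x k)" using norm_triangle_sub[of "x (Suc k)" "x k"] Suc by simp
      then show ?thesis using less.IH[of k] Suc bS[of k] by auto
    qed
    have hb: "norm (h x i) \<le> b i * \<eta>"
    proof (rule h_bound)
      fix j assume "j \<le> i"
      then show "1 + norm (x j) \<le> b i" using less.IH[of j] xb b_mono[of j i] by (cases "j = i") auto
    qed
    have prev: "(if i = 0 then 0 else norm (x i - x (i - 1))) \<le> \<kappa> * \<eta> * b i"
    proof (cases i)
      case 0 then show ?thesis using \<kappa>\<eta> b1[of 0] by simp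
    next
      case (Suc k)
      have "norm (x (Suc k) - x k) \<le> \<kappa> * \<eta> * b k" using less.IH[of k] Suc by auto
      also have "\<dots> \<le> \<kappa> * \<eta> * b i" using \<kappa>\<eta> b_mono[of k i] Suc by (intro mult_left_mono) auto
      finally show ?thesis using Suc by simp
    qed
    have e1: "\<eta> \<le> b i * \<eta>" using b1[of i] \<eta>0 by simp
    have Lp: "L * (if i = 0 then 0 else norm (x i - x (i - 1))) \<le> L * (\<kappa> * \<eta> * b i)"
      using prev C1(2) by (intro mult_left_mono)
    have pos: "0 \<le> b i * \<eta>" using b1[of i] \<eta>0 by simp
    \<comment> \<open>Drift twice, \<zeta> once and L times the previous step: the equation for
      \<kappa> closes the induction with the same constant.\<close>
    have "(3 + L * \<kappa>) * (b i * \<eta>) = \<kappa> * (b i * \<eta>)" using \<kappa> by simp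
    then have K: "3 * (b i * \<eta>) + L * (\<kappa> * \<eta> * b i) = \<kappa> * \<eta> * b i" by (simp add: algebra_simps)
    have wb: "norm (w i) + norm (h x i) \<le> \<kappa> * \<eta> * b i"
      using w_bound[of i] hb e1 Lp K by linarith
    have "norm (x (Suc i) - x i) = norm (h x i - w i)" by (simp add: w_def norm_minus_commute)
    also have "\<dots> \<le> norm (w i) + norm (h x i)" using norm_triangle_ineq4[of "h x i" "w i"] by simp
    finally show ?case using xb hb wb norm_ge_zero[of "h x i"] by linarith
  qed
  have bR: "b i \<le> R0" if "i \<le> Suc N" for i
  proof -
    have "(1 + \<kappa> * \<eta>) ^ i \<le> exp (\<kappa> * \<eta>) ^ i" using \<kappa>\<eta> by (intro power_mono exp_ge_add_one_self) auto
    also have "\<dots> = exp (real i * (\<kappa> * \<eta>))" by (simp add: exp_of_nat_mult)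
    also have "\<dots> \<le> exp (2 * \<kappa> * TL)"
    proof -
      have "real i * \<eta> \<le> (real N + 1) * \<eta>" using that \<eta>0 by (intro mult_right_mono) auto
      also have "\<dots> \<le> 2 * TL" using N\<eta> \<eta>TL by (simp add: algebra_simps)
      finally have "\<kappa> * (real i * \<eta>) \<le> \<kappa> * (2 * TL)" using \<kappa> by (intro mult_left_mono) auto
      then show ?thesis by (simp add: mult_ac)
    qed
    finally show ?thesis unfolding b_def R0_def by (intro mult_left_mono) auto
  qed
  have \<kappa>0: "0 \<le> \<kappa>" using \<kappa> by simp
  have BB: "R0 \<le> BB" "\<kappa> * R0 \<le> BB" "0 \<le> BB"
    using R0_pos \<kappa>0 by (auto simp: BB_def algebra_simps)
  define X where "X t = x (idx t)" for t
  define Y where "Y t = x (Suc (idx t))" for t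
  define \<theta> where "\<theta> t = tn (Suc (idx t))" for t
  define f where "f t = fsel t (X t)" for t
  \<comment> \<open>The jump w is spread over its cell with density m/\<eta>, whose integral over
    the cell is 1. Since |w| is of order \<eta>, this leaves a velocity dominated by m.\<close>
  define v where "v t = (m t / \<eta>) *\<^sub>R w (idx t)" for t
  have XR: "norm (x (idx t)) \<le> R0 - 1" for t
    using step[of "idx t"] bR[of "idx t"] idxN[of t] by simp
  have fi: "integrable lebesgue f" unfolding f_def X_def by (rule step_terms(1)[where j = idx and x = x, OF idx_m XR])
  have Gi: "integrable lebesgue (GX X)" unfolding X_def by (rule step_integral_term(2)[where j = idx and x = x, OF idx_m XR])
  have fG: "AE t in lebesgue. norm (f t) + norm (GX X t) \<le> R0 * m t"
    using step_terms(2)[where j = idx and x = x, OF idx_m XR] by (simp add: f_def X_def[abs_def])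
  have wR: "norm (w (idx t)) \<le> \<kappa> * R0 * \<eta>" for t
  proof -
    have "norm (w (idx t)) \<le> \<kappa> * \<eta> * b (idx t)" using step by blast
    also have "\<dots> \<le> \<kappa> * \<eta> * R0" using bR[of "idx t"] idxN[of t] \<kappa>\<eta> by (intro mult_left_mono) auto
    finally show ?thesis by (simp add: mult_ac)
  qed
  have vb: "norm (v t) \<le> \<kappa> * R0 * m t" for t
  proof -
    have "norm (v t) = m t / \<eta> * norm (w (idx t))" using m(2)[of t] \<eta>0 by (simp add: v_def)
    also have "\<dots> \<le> m t / \<eta> * (\<kappa> * R0 * \<eta>)" using m(2)[of t] \<eta>0 wR by (intro mult_left_mono) auto
    also have "\<dots> = \<kappa> * R0 * m t" using \<eta>0 by simp
    finally show ?thesis .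
  qed
  have vm: "v \<in> borel_measurable lebesgue"
  proof -
    have 1: "idx \<in> measurable lebesgue (count_space UNIV)" using idx_m by (intro measurable_completion) simp
    have "(\<lambda>t. w (idx t)) \<in> borel_measurable lebesgue" by (rule measurable_compose[OF 1]) simp
    moreover have "m \<in> borel_measurable lebesgue" using m(1) by auto
    ultimately show ?thesis unfolding v_def by measurable
  qed
  have vi: "integrable lebesgue v"
  proof (rule Bochner_Integration.integrable_bound[OF _ vm])
    show "integrable lebesgue (\<lambda>t. \<kappa> * R0 * m t)" using m(1) by simp
    show "AE t in lebesgue. norm (v t) \<le> norm (\<kappa> * R0 * m t)"
    proof (rule AE_I2)
      fix t show "norm (v t) \<le> norm (\<kappa> * R0 * m t)" using vb[of t] by (metis abs_ge_self order_trans real_norm_def)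
    qed
  qed
  define u where "u t = f t + GX X t - v t" for t
  have ui: "integrable lebesgue u" unfolding u_def by (intro Bochner_Integration.integrable_add Bochner_Integration.integrable_diff fi Gi vi)
  have ub: "AE t in lebesgue. norm (u t) \<le> BB * m t"
    using fG
  proof eventually_elim
    case (elim t)
    have "norm (u t) \<le> norm (f t) + norm (GX X t) + norm (v t)"
      unfolding u_def by (smt (verit) norm_triangle_ineq norm_triangle_ineq4)
    also have "\<dots> \<le> R0 * m t + \<kappa> * R0 * m t" using elim vb[of t] by simp
    also have "\<dots> \<le> BB * m t" using R0_pos m(2)[of t] by (simp add: BB_def algebra_simps)
    finally show ?case .
  qed
  have cell_int: "(LINT s:{tn i..tn (Suc i)}|lebesgue. u s) = h x i - w i" if i: "i < N" for i
  proof -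
    have R: "norm (x (min i (idx t))) \<le> R0 - 1" for t
    proof -
      have "min i (idx t) \<le> Suc N" using i by simp
      then have "b (min i (idx t)) \<le> R0" by (rule bR)
      moreover have "1 + norm (x (min i (idx t))) \<le> b (min i (idx t))" using step by blast
      ultimately show ?thesis by linarith
    qed
    have hi: "integrable lebesgue (\<lambda>t. fsel t (x (min i (idx t))) + GX (\<lambda>s. x (min i (idx s))) t)"
      by (intro Bochner_Integration.integrable_add step_terms(1)[where j = "\<lambda>t. min i (idx t)" and x = x, OF min_m R] step_integral_term(2)[where j = "\<lambda>t. min i (idx t)" and x = x, OF min_m R])
    have mi: "integrable lebesgue (\<lambda>t. (m t / \<eta>) *\<^sub>R w i)" using m(1) by simp
    have "(LINT s:{tn i..tn (Suc i)}|lebesgue. u s)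
      = (LINT t:{tn i..tn (Suc i)}|lebesgue. (fsel t (x (min i (idx t))) + GX (\<lambda>s. x (min i (idx s))) t) - (m t / \<eta>) *\<^sub>R w i)"
    proof (rule set_lebesgue_integral_cong_AE)
      show "u \<in> borel_measurable lebesgue" using ui by auto
      show "(\<lambda>t. (fsel t (x (min i (idx t))) + GX (\<lambda>s. x (min i (idx s))) t) - (m t / \<eta>) *\<^sub>R w i) \<in> borel_measurable lebesgue"
        using Bochner_Integration.integrable_diff[OF hi mi] by auto
      show "AE t\<in>{tn i..tn (Suc i)} in lebesgue. u t = (fsel t (x (min i (idx t))) + GX (\<lambda>s. x (min i (idx s))) t) - (m t / \<eta>) *\<^sub>R w i"
        \<comment> \<open>At the right end the index already jumps to the next cell; this single
          point is excluded. Elsewhere the minimum in h is inactive: \<open>g0\<close> vanishes for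
          s > t, and earlier s have index at most i.\<close>
        using AE_lebesgue_neq[of "tn (Suc i)"]
      proof eventually_elim
        case (elim t)
        show ?case
        proof
          assume t: "t \<in> {tn i..tn (Suc i)}"
          then have lt: "t < tn (Suc i)" "tn i \<le> t" using elim by auto
          have t0: "0 \<le> t" using lt tn(1)[of i] by linarith
          have it: "idx t = i" using idx_eq lt i by blast
          have "g0 t s (X s) = g0 t s (x (min i (idx s)))" for s
          proof (cases "s \<le> t")
            case True
            then show ?thesis using before[OF True lt(1) t0] by (simp add: X_def min_absorb2)
          qed (simp add: g0_def D_def)
          then have "GX X t = GX (\<lambda>s. x (min i (idx s))) t" by (simp add: GX_def)
          then show "u t = (fsel t (x (min i (idx t))) + GX (\<lambda>s. x (min i (idx s))) t) - (m t / \<eta>) *\<^sub>R w i"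
            by (simp add: u_def f_def X_def v_def it)
        qed
      qed
    qed auto
    also have "\<dots> = h x i - (LINT t:{tn i..tn (Suc i)}|lebesgue. (m t / \<eta>) *\<^sub>R w i)"
      unfolding h_def using hi mi by (intro set_integral_diff integrable_imp_set_integrable_lebesgue) auto
    also have "(LINT t:{tn i..tn (Suc i)}|lebesgue. (m t / \<eta>) *\<^sub>R w i) = ((LINT t:{tn i..tn (Suc i)}|lebesgue. m t) / \<eta>) *\<^sub>R w i"
    proof -
      have "(LINT t:{tn i..tn (Suc i)}|lebesgue. (m t / \<eta>) *\<^sub>R w i) = (LINT t:{tn i..tn (Suc i)}|lebesgue. m t / \<eta>) *\<^sub>R w i"
        using m(1) by (intro set_integral_scaleR_left) auto
      then show ?thesis by simp
    qed
    also have "(LINT t:{tn i..tn (Suc i)}|lebesgue. m t) = \<eta>"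
    proof -
      have "real (Suc i) * \<eta> \<le> real N * \<eta>" using i \<eta>0 by (intro mult_right_mono) auto
      then have "real (Suc i) * \<eta> \<le> TL" using N\<eta> by simp
      moreover from this have "real i * \<eta> \<le> TL" using \<eta>0 by (simp add: algebra_simps)
      ultimately have "\<Lambda> (tn (Suc i)) - \<Lambda> (tn i) = \<eta>" by (simp add: tn min_absorb1 algebra_simps)
      then show ?thesis using \<Lambda>_diff[of "tn i" "tn (Suc i)"] tn tn_mono by simp
    qed
    finally show ?thesis using \<eta>0 by simp
  qed
  have node: "x i = x0 + (LINT s:{0..tn i}|lebesgue. u s)" if "i \<le> N" for i
    using that
  proof (induction i)
    case 0 then show ?case by (simp only: tn0 set_integral_point_zero x_0 add_0_right)
  next
    case (Suc i)
    have "x (Suc i) = x i + (h x i - w i)" by (simp add: w_def)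
    also have "\<dots> = x0 + ((LINT s:{0..tn i}|lebesgue. u s) + (LINT s:{tn i..tn (Suc i)}|lebesgue. u s))"
      using Suc cell_int[of i] by simp
    also have "\<dots> = x0 + (LINT s:{0..tn (Suc i)}|lebesgue. u s)"
      using set_integral_interval_split[OF ui tn(1) tn_mono, of i] by simp
    finally show ?case .
  qed
  show ?thesis
  proof (rule exI[of _ X], rule exI[of _ Y], rule exI[of _ \<theta>], rule exI[of _ f], rule exI[of _ v],
      unfold approximation_def, intro conjI ballI allI fi vi Gi)
    fix t
    show "norm (X t) \<le> BB" using XR[of t] BB by (simp add: X_def)
    show "norm (v t) \<le> BB * m t" using vb[of t] mult_right_mono[OF BB(2) m(2)[of t]] by simp
  next
    fix t assume t: "t \<in> {0..T}"
    have r: "0 \<le> \<Lambda> t" "\<Lambda> t \<le> TL" using \<Lambda>_range[OF t] by auto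
    show "\<theta> t \<in> {0..T}" unfolding \<theta>_def by (rule tnT)
    have "\<Lambda> (\<theta> t) - \<Lambda> t \<le> \<eta>"
    proof -
      have "\<Lambda> (\<theta> t) \<le> real (Suc (idx t)) * \<eta>" by (simp add: \<theta>_def tn)
      then show ?thesis using idx_le[of t] \<Lambda>_mono[OF in_cell(1)[OF t]] r by (simp add: algebra_simps)
    qed
    then show "\<bar>\<zeta> (\<theta> t) - \<zeta> t\<bar> \<le> \<eta>"
      using \<zeta>_\<Lambda>[of t "\<theta> t"] in_cell(2)[OF t] t tn(2) by (auto simp: \<theta>_def intro: order_trans)
    show "Y t \<in> C (\<theta> t) (X t)" unfolding Y_def \<theta>_def X_def by (rule xS)
    have "norm (Y t - X t) \<le> \<kappa> * \<eta> * b (idx t)" using step by (simp add: Y_def X_def)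
    also have "\<dots> \<le> \<kappa> * \<eta> * R0" using bR[of "idx t"] idxN[of t] \<kappa>\<eta> by (intro mult_left_mono) auto
    also have "\<dots> \<le> BB * \<eta>" using mult_right_mono[OF BB(2), of \<eta>] \<eta>0 by (simp add: mult_ac)
    finally show "norm (Y t - X t) \<le> BB * \<eta>" .
    show "v t \<in> clarke_normal (C (\<theta> t) (X t)) (Y t)"
      unfolding v_def \<theta>_def X_def Y_def using wN m(2)[of t] \<eta>0 by (intro clarke_normal_scaleR) auto
    show "f t \<in> F t (X t)" unfolding f_def by (rule fsel(1)[OF t])
    \<comment> \<open>At the nodes the integral curve is exact; inside a cell the error is the
      integral since its left end, at most BB times the mass \<eta>.\<close>
    have "X t - (x0 + (LINT s:{0..t}|lebesgue. u s)) = - (LINT s:{tn (idx t)..t}|lebesgue. u s)"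
      using node[OF idxN[of t]] set_integral_interval_split[OF ui tn(1) in_cell(1)[OF t]] by (simp add: X_def)
    then have "norm (X t - (x0 + (LINT s:{0..t}|lebesgue. u s))) \<le> BB * (\<Lambda> t - \<Lambda> (tn (idx t)))"
      using integral_dominated_by_\<Lambda>[OF ui ub tn(1) in_cell(1)[OF t]] by simp
    also have "\<dots> \<le> BB * \<eta>"
    proof -
      have "\<Lambda> t - \<Lambda> (tn (idx t)) \<le> \<eta>" using idx_gt[of t] idx_le[of t] r \<eta>0 by (simp add: tn min_def algebra_simps)
      then show ?thesis using BB by (intro mult_left_mono) auto
    qed
    finally show "norm (X t - (x0 + (LINT s:{0..t}|lebesgue. f s + GX X s - v s))) \<le> BB * \<eta>" by (simp add: u_def)
  next
    show "AE t in lebesgue. norm (f t) \<le> BB * m t \<and> norm (GX X t) \<le> BB * m t \<and> integrable lebesgue (\<lambda>s. g0 t s (X s))"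
      using fG step_integral_term(1)[where j = idx and x = x, OF idx_m XR]
    proof eventually_elim
      case (elim t)
      have "R0 * m t \<le> BB * m t" using BB(1) m(2)[of t] by (rule mult_right_mono)
      then show ?case using elim by (auto simp: X_def) (smt (verit) norm_ge_zero)+
    qed
  qed
qed

subsection \<open>Passage to the limit\<close>

lemma BB_pos: "0 < BB"
proof -
  have "0 < 2 + \<kappa>" using \<kappa>(1) by simp
  moreover have "0 < R0" using R0_pos by simp
  ultimately show ?thesis unfolding BB_def by (rule mult_pos_pos)
qed

text \<open>The points Y n lie in sets at the varying times \<theta> n, to which compactness at t
  does not apply. By the estimate on distances they are close to points z n of C t (X n), which stay
  in one relatively compact set; X n has the same limit points.\<close>

lemma pointwise_subsequence:
  fixes X Y :: "nat \<Rightarrow> 'a" and \<theta> \<eta> :: "nat \<Rightarrow> real"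
  assumes t: "t \<in> {0..T}" and X: "\<And>n. norm (X n) \<le> K" and \<theta>: "\<And>n. \<theta> n \<in> {0..T}" "\<And>n. \<bar>\<zeta> (\<theta> n) - \<zeta> t\<bar> \<le> \<eta> n"
    and Y: "\<And>n. Y n \<in> C (\<theta> n) (X n)" "\<And>n. norm (Y n - X n) \<le> K * \<eta> n" and \<eta>: "\<eta> \<longlonglongrightarrow> 0"
  obtains r l where "strict_mono r" "(\<lambda>n. X (r n)) \<longlonglongrightarrow> (l :: 'a)"
proof -
  have \<eta>nn: "0 \<le> \<eta> n" for n using \<theta>(2)[of n] abs_ge_zero order_trans by blast
  have "\<exists>z. z \<in> C t (X n) \<and> dist (Y n) z < \<eta> n + 1 / (real n + 1)" for n
  proof -
    have ne: "C t (X n) \<noteq> {}" using C_values[OF t] by blast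
    have "infdist (Y n) (C (\<theta> n) (X n)) = 0" using Y(1) by (rule infdist_zero)
    then have le: "infdist (Y n) (C t (X n)) \<le> \<eta> n"
      using C1(4)[OF t \<theta>(1)[of n], where z = "Y n" and x = "X n" and y = "X n"] \<theta>(2)[of n] C1(4)[OF \<theta>(1)[of n] t, where z = "Y n" and x = "X n" and y = "X n"]
      by simp
    obtain z where "z \<in> C t (X n)" "dist (Y n) z < infdist (Y n) (C t (X n)) + 1 / (real n + 1)"
      by (rule ex_dist_less_infdist[OF ne, of "1 / (real n + 1)" "Y n"]) auto
    then show ?thesis using le by (intro exI[of _ z]) auto
  qed
  then obtain z where z: "\<And>n. z n \<in> C t (X n)" "\<And>n. dist (Y n) (z n) < \<eta> n + 1 / (real n + 1)" by metis
  have i0: "(\<lambda>n. 1 / (real n + 1)) \<longlonglongrightarrow> 0"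
    using LIMSEQ_inverse_real_of_nat by (simp add: inverse_eq_divide add.commute)
  have Xz: "(\<lambda>n. norm (X n - z n)) \<longlonglongrightarrow> 0"
  proof (rule tendsto_sandwich[OF _ _ tendsto_const])
    show "(\<lambda>n. K * \<eta> n + (\<eta> n + 1 / (real n + 1))) \<longlonglongrightarrow> 0"
    proof -
      have "(\<lambda>n. K * \<eta> n + (\<eta> n + 1 / (real n + 1))) \<longlonglongrightarrow> K * 0 + (0 + 0)" by (intro tendsto_intros \<eta> i0)
      then show ?thesis by simp
    qed
    show "eventually (\<lambda>n. norm (X n - z n) \<le> K * \<eta> n + (\<eta> n + 1 / (real n + 1))) sequentially"
    proof (rule always_eventually, rule allI)
      fix n
      have "norm (X n - z n) \<le> norm (X n - Y n) + norm (Y n - z n)"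
        using norm_triangle_ineq[of "X n - Y n" "Y n - z n"] by simp
      then show "norm (X n - z n) \<le> K * \<eta> n + (\<eta> n + 1 / (real n + 1))"
        using Y(2)[of n] z(2)[of n] by (simp add: norm_minus_commute dist_norm)
    qed
  qed auto
  have "Bseq (\<lambda>n. norm (X n - z n))" using Xz convergent_def convergent_imp_Bseq by blast
  then obtain k where k: "\<And>n. norm (X n - z n) \<le> k" unfolding Bseq_def by auto
  \<comment> \<open>K bounds the states and k their distance to z n; the summand 1 makes the radius
    positive.\<close>
  define A where "A = closure ((\<Union>a\<in>cball 0 K. C t a) \<inter> cball 0 (\<bar>K\<bar> + \<bar>k\<bar> + 1))"
  have "compact A" unfolding A_def by (rule C3[OF t]) auto
  moreover have "z n \<in> A" for n
  proof -
    have "norm (z n) \<le> norm (X n) + norm (X n - z n)" using norm_triangle_sub[of "z n" "X n"] by (simp add: norm_minus_commute)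
    then have "z n \<in> (\<Union>a\<in>cball 0 K. C t a) \<inter> cball 0 (\<bar>K\<bar> + \<bar>k\<bar> + 1)" using z(1)[of n] X[of n] k[of n] by auto
    then show ?thesis unfolding A_def by (rule subsetD[OF closure_subset])
  qed
  ultimately obtain l r where r: "strict_mono r" "(z \<circ> r) \<longlonglongrightarrow> l" unfolding compact_eq_seq_compact_metric seq_compact_def by metis
  have "(\<lambda>n. X (r n) - z (r n)) \<longlonglongrightarrow> 0"
    using LIMSEQ_subseq_LIMSEQ[OF tendsto_norm_zero_cancel[OF Xz] r(1)] by (simp add: o_def)
  from tendsto_add[OF this r(2)[unfolded o_def]] have "(\<lambda>n. X (r n)) \<longlonglongrightarrow> l" by simp
  with r(1) show ?thesis by (rule that)
qed

lemma rational_near: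
  assumes "t \<in> {0..T}" "0 < \<delta>"
  obtains q where "q \<in> \<rat> \<inter> {0..T}" "\<bar>q - t\<bar> < \<delta>"
proof (cases "t < T")
  case True
  then obtain q where "q \<in> \<rat>" "t < q" "q < min T (t + \<delta>)" using Rats_dense_in_real[of t "min T (t + \<delta>)"] assms by auto
  with assms show ?thesis by (intro that[of q]) auto
next
  case False
  have "max 0 (T - \<delta>) < T" using T_pos assms by auto
  then obtain q where "q \<in> \<rat>" "max 0 (T - \<delta>) < q" "q < T" using Rats_dense_in_real[of "max 0 (T - \<delta>)" T] by auto
  with assms False show ?thesis by (intro that[of q]) auto
qed

text \<open>Diagonal extraction at the rational times. The curves jump, so they are equicontinuous
  only up to an error proportional to \<eta> n; since this tends to zero, Cauchy sequences at
  rational times force Cauchy sequences at all times.\<close>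

lemma convergent_subsequence:
  fixes X Y :: "nat \<Rightarrow> real \<Rightarrow> 'a" and \<theta> :: "nat \<Rightarrow> real \<Rightarrow> real" and \<eta> :: "nat \<Rightarrow> real"
  assumes X: "\<And>n t. norm (X n t) \<le> K"
    and \<theta>: "\<And>n t. t \<in> {0..T} \<Longrightarrow> \<theta> n t \<in> {0..T} \<and> \<bar>\<zeta> (\<theta> n t) - \<zeta> t\<bar> \<le> \<eta> n"
    and Y: "\<And>n t. t \<in> {0..T} \<Longrightarrow> Y n t \<in> C (\<theta> n t) (X n t) \<and> norm (Y n t - X n t) \<le> K * \<eta> n"
    and \<eta>: "\<eta> \<longlonglongrightarrow> 0"
    and equi: "\<And>n s t. 0 \<le> s \<Longrightarrow> s \<le> t \<Longrightarrow> t \<le> T \<Longrightarrow> norm (X n t - X n s) \<le> K * (\<Lambda> t - \<Lambda> s) + 2 * K * \<eta> n"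
  obtains r where "strict_mono (r :: nat \<Rightarrow> nat)" "\<And>t. t \<in> {0..T} \<Longrightarrow> convergent (\<lambda>n. X (r n) t)"
proof -
  have K0: "0 \<le> K" using X[of 0 0] norm_ge_zero order_trans by blast
  define q where "q = from_nat_into (\<rat> \<inter> {0..T})"
  have Qne: "\<rat> \<inter> {0..T} \<noteq> {}" using T_pos by (auto intro!: exI[of _ 0])
  have Qc: "countable (\<rat> \<inter> {0..T})" using countable_rat by auto
  have q: "q k \<in> {0..T}" for k using from_nat_into[OF Qne, of k] by (simp add: q_def)
  interpret subseqs "\<lambda>k s. convergent (\<lambda>n. X (s n) (q k))"
  proof
    fix k and s :: "nat \<Rightarrow> nat" assume s: "strict_mono s"
    obtain r l where "strict_mono r" "(\<lambda>n. X (s (r n)) (q k)) \<longlonglongrightarrow> l"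
    proof (rule pointwise_subsequence[OF q[of k], of "\<lambda>n. X (s n) (q k)" K "\<lambda>n. \<theta> (s n) (q k)" "\<lambda>n. \<eta> (s n)" "\<lambda>n. Y (s n) (q k)"])
      show "(\<lambda>n. \<eta> (s n)) \<longlonglongrightarrow> 0" using LIMSEQ_subseq_LIMSEQ[OF \<eta> s] by (simp add: o_def)
    qed (use X \<theta>[OF q] Y[OF q] in auto)
    then show "\<exists>r'. strict_mono r' \<and> convergent (\<lambda>n. X ((s \<circ> r') n) (q k))" by (auto simp: convergent_def)
  qed
  have qconv: "convergent (\<lambda>n. X (diagseq n) (q k))" for k
  proof -
    \<comment> \<open>From index Suc k on, the diagonal sequence is a subsequence of one converging
      at q k; the finitely many earlier terms are then restored.\<close>
    have "convergent (\<lambda>n. X ((diagseq \<circ> (+) (Suc k)) n) (q k))"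
    proof (rule diagseq_holds)
      fix x s :: "nat \<Rightarrow> nat" and n assume "strict_mono x" "convergent (\<lambda>n'. X (s n') (q n))"
      then show "convergent (\<lambda>n'. X ((s \<circ> x) n') (q n))"
        using convergent_subseq_convergent[of "\<lambda>n'. X (s n') (q n)" x] by (simp add: o_def)
    qed
    then have "convergent (\<lambda>n. X (diagseq (n + Suc k)) (q k))" by (simp add: add.commute)
    then show ?thesis using convergent_ignore_initial_segment[of "\<lambda>n. X (diagseq n) (q k)" "Suc k"] by simp
  qed
  have \<eta>d: "(\<lambda>n. \<eta> (diagseq n)) \<longlonglongrightarrow> 0" using LIMSEQ_subseq_LIMSEQ[OF \<eta> subseq_diagseq] by (simp add: o_def)
  show ?thesis
  proof (rule that[OF subseq_diagseq])
    fix t assume t: "t \<in> {0..T}"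
    have "Cauchy (\<lambda>n. X (diagseq n) t)"
    proof (rule CauchyI)
      fix e :: real assume e: "0 < e"
      have "0 < e / (8 * (K + 1))" using e K0 by simp
      with \<Lambda>_continuous t obtain \<delta> where \<delta>: "\<delta> > 0" "\<And>s. s \<in> {0..T} \<Longrightarrow> dist s t < \<delta> \<Longrightarrow> dist (\<Lambda> s) (\<Lambda> t) < e / (8 * (K + 1))"
        unfolding continuous_on_iff by metis
      obtain p where p: "p \<in> \<rat> \<inter> {0..T}" "\<bar>p - t\<bar> < \<delta>" using rational_near[OF t \<delta>(1)] .
      obtain k where k: "q k = p" using from_nat_into_surj[OF Qc p(1)] by (auto simp: q_def)
      have \<Lambda>p: "K * \<bar>\<Lambda> p - \<Lambda> t\<bar> \<le> e / 8"
      proof -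
        have "\<bar>\<Lambda> p - \<Lambda> t\<bar> \<le> e / (8 * (K + 1))" using \<delta>(2)[of p] p by (simp add: dist_real_def)
        then have "K * \<bar>\<Lambda> p - \<Lambda> t\<bar> \<le> (K + 1) * (e / (8 * (K + 1)))" using K0 by (intro mult_mono) auto
        also have "\<dots> = e / 8" using K0 by (simp add: divide_simps)
        finally show ?thesis .
      qed
      have near: "norm (X n t - X n p) \<le> e / 8 + 2 * K * \<eta> n" for n
      proof (cases "p \<le> t")
        case True
        have "norm (X n t - X n p) \<le> K * (\<Lambda> t - \<Lambda> p) + 2 * K * \<eta> n" using t p True by (intro equi) auto
        also have "K * (\<Lambda> t - \<Lambda> p) \<le> K * \<bar>\<Lambda> p - \<Lambda> t\<bar>" using K0 by (intro mult_left_mono) auto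
        finally show ?thesis using \<Lambda>p by simp
      next
        case False
        have "norm (X n p - X n t) \<le> K * (\<Lambda> p - \<Lambda> t) + 2 * K * \<eta> n" using t p False by (intro equi) auto
        also have "K * (\<Lambda> p - \<Lambda> t) \<le> K * \<bar>\<Lambda> p - \<Lambda> t\<bar>" using K0 by (intro mult_left_mono) auto
        finally show ?thesis using \<Lambda>p by (simp add: norm_minus_commute)
      qed
      have "(\<lambda>n. 2 * K * \<eta> (diagseq n)) \<longlonglongrightarrow> 2 * K * 0" by (intro tendsto_intros \<eta>d)
      then have "eventually (\<lambda>n. 2 * K * \<eta> (diagseq n) < e / 8) sequentially" using e by (intro order_tendstoD) auto
      then obtain n1 where n1: "\<And>n. n \<ge> n1 \<Longrightarrow> 2 * K * \<eta> (diagseq n) < e / 8" by (auto simp: eventually_sequentially)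
      obtain n2 where n2: "\<And>i j. i \<ge> n2 \<Longrightarrow> j \<ge> n2 \<Longrightarrow> norm (X (diagseq i) p - X (diagseq j) p) < e / 4"
        using CauchyD[OF convergent_Cauchy[OF qconv[of k]], of "e/4"] e k by auto
      have "norm (X (diagseq i) t - X (diagseq j) t) < e" if "i \<ge> max n1 n2" "j \<ge> max n1 n2" for i j
      proof -
        let ?a = "X (diagseq i)" and ?b = "X (diagseq j)"
        have "norm (?a t - ?b t) \<le> norm (?a t - ?a p) + norm (?a p - ?b p) + norm (?b t - ?b p)"
          using norm_triangle_ineq4[of "(?a t - ?a p) + (?a p - ?b p)" "?b t - ?b p"]
            norm_triangle_ineq[of "?a t - ?a p" "?a p - ?b p"] by simp
        also have "\<dots> < (e / 8 + e / 8) + e / 4 + (e / 8 + e / 8)"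
        proof -
          have ij: "n1 \<le> i" "n1 \<le> j" "n2 \<le> i" "n2 \<le> j" using that by auto
          show ?thesis
            using near[of "diagseq i"] near[of "diagseq j"] n1[OF ij(1)] n1[OF ij(2)] n2[OF ij(3,4)] by linarith
        qed
        finally show ?thesis using e by simp
      qed
      then show "\<exists>M. \<forall>i\<ge>M. \<forall>j\<ge>M. norm (X (diagseq i) t - X (diagseq j) t) < e" by blast
    qed
    then show "convergent (\<lambda>n. X (diagseq n) t)" by (rule Cauchy_convergent)
  qed
qed

end

lemma sum_scaleR_add_diff:
  "(\<Sum>i<N. w i *\<^sub>R (a i + b i - c i)) = (\<Sum>i<N. w i *\<^sub>R a i) + (\<Sum>i<N. w i *\<^sub>R b i) - (\<Sum>i<N. w i *\<^sub>R (c i :: 'a::real_vector))"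
  by (simp add: algebra_simps sum.distrib sum_subtractf)

lemma norm_le_sum3: "a = p - q + r \<Longrightarrow> norm a \<le> norm p + norm q + norm (r :: 'a::real_normed_vector)"
  using norm_triangle_ineq[of "p - q" r] norm_triangle_ineq4[of p q] by simp

lemma tendsto_convergent_lim: "convergent X \<Longrightarrow> X \<longlonglongrightarrow> lim X" for X :: "nat \<Rightarrow> 'a::real_normed_vector"
  by (simp add: convergent_LIMSEQ_iff)

context sweeping_process
begin

section \<open>Limits of the Volterra term and existence for class \<open>banach\<close>\<close>

lemma g0_tendsto:
  assumes X: "\<And>n. norm (X n) \<le> K" and lim: "s \<in> {0..T} \<Longrightarrow> X \<longlonglongrightarrow> x"
  shows "(\<lambda>n. g0 t s (X n)) \<longlonglongrightarrow> g0 t s x"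
proof (cases "(t, s) \<in> D")
  case True
  then have s: "s \<in> {0..T}" by (auto simp: D_def)
  have x: "norm x \<le> K" using X by (intro LIMSEQ_le_const2[OF tendsto_norm[OF lim[OF s]]]) auto
  have K: "0 < K + 1" using x norm_ge_zero[of x] by linarith
  \<comment> \<open>The Lipschitz hypothesis requires a positive radius, while K may be
    zero.\<close>
  obtain \<mu> where \<mu>: "\<And>x y. x \<in> cball 0 (K + 1) \<Longrightarrow> y \<in> cball 0 (K + 1) \<Longrightarrow> norm (g t s x - g t s y) \<le> \<mu> t * norm (x - y)"
    using g2[OF K] True unfolding D_def by blast
  have "(\<lambda>n. norm (g t s (X n) - g t s x)) \<longlonglongrightarrow> 0"
  proof (rule tendsto_sandwich[OF _ _ tendsto_const])
    have "(\<lambda>n. \<mu> t * norm (X n - x)) \<longlonglongrightarrow> \<mu> t * norm (x - x)" by (intro tendsto_intros lim s)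
    then show "(\<lambda>n. \<mu> t * norm (X n - x)) \<longlonglongrightarrow> 0" by simp
    have "norm (g t s (X n) - g t s x) \<le> \<mu> t * norm (X n - x)" for n
      using X[of n] x by (intro \<mu>) auto
    then show "eventually (\<lambda>n. norm (g t s (X n) - g t s x) \<le> \<mu> t * norm (X n - x)) sequentially" by simp
  qed auto
  then have "(\<lambda>n. g t s (X n) - g t s x) \<longlonglongrightarrow> 0" by (rule tendsto_norm_zero_cancel)
  then show ?thesis using True by (simp add: g0_def LIM_zero_iff)
qed (simp add: g0_def)

text \<open>Dominated convergence in s at fixed t, with majorant (1 + K) \<sigma>0(t, s). The limit
  integrand inherits its measurability from the approximations, so no composition of g with a
  general curve has to be measured.\<close>

lemma GX_tendsto:
  assumes X: "\<And>n s. norm (X n s) \<le> K" and lim: "\<And>s. s \<in> {0..T} \<Longrightarrow> (\<lambda>n. X n s) \<longlonglongrightarrow> x s"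
    and int: "\<And>n. integrable lebesgue (\<lambda>s. g0 t s (X n s))" and \<sigma>: "integrable lebesgue (\<lambda>s. \<sigma>0 (t, s))"
  shows "integrable lebesgue (\<lambda>s. g0 t s (x s))" "(\<lambda>n. GX (X n) t) \<longlonglongrightarrow> GX x t"
proof -
  have pt: "(\<lambda>n. g0 t s (X n s)) \<longlonglongrightarrow> g0 t s (x s)" for s using X lim by (rule g0_tendsto)
  have m: "(\<lambda>s. g0 t s (x s)) \<in> borel_measurable lebesgue"
    by (rule borel_measurable_LIMSEQ_metric[OF borel_measurable_integrable[OF int] pt])
  have b: "norm (g0 t s (X n s)) \<le> (1 + K) * \<sigma>0 (t, s)" for n s
  proof -
    have "\<sigma>0 (t, s) * (1 + norm (X n s)) \<le> \<sigma>0 (t, s) * (1 + K)" using X[of n s] \<sigma>0_nonneg by (intro mult_left_mono) auto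
    then show ?thesis using g0_bound[of t s "X n s"] by (simp add: mult.commute)
  qed
  have w: "integrable lebesgue (\<lambda>s. (1 + K) * \<sigma>0 (t, s))" using \<sigma> by simp
  show "integrable lebesgue (\<lambda>s. g0 t s (x s))"
    by (rule integrable_dominated_convergence[OF m borel_measurable_integrable[OF int] w AE_I2 AE_I2]) (rule pt, rule b)
  show "(\<lambda>n. GX (X n) t) \<longlonglongrightarrow> GX x t"
    unfolding GX_def
    by (rule integral_dominated_convergence[OF m borel_measurable_integrable[OF int] w AE_I2 AE_I2]) (rule pt, rule b)
qed

lemma GX_eq_integral:
  assumes t: "t \<in> {0..T}" and int: "integrable lebesgue (\<lambda>s. g0 t s (x s))"
  shows "integrable (lebesgue_on {0..t}) (\<lambda>s. g t s (x s))" "integral\<^sup>L (lebesgue_on {0..t}) (\<lambda>s. g t s (x s)) = GX x t"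
proof -
  have eq: "(\<lambda>s. indicator {0..t} s *\<^sub>R g t s (x s)) = (\<lambda>s. g0 t s (x s))"
    using t by (auto simp: g0_def D_def indicator_def fun_eq_iff)
  show "integrable (lebesgue_on {0..t}) (\<lambda>s. g t s (x s))"
    using int by (subst integrable_restrict_space) (auto simp: eq)
  show "integral\<^sup>L (lebesgue_on {0..t}) (\<lambda>s. g t s (x s)) = GX x t"
    unfolding GX_def by (subst integral_restrict_space) (auto simp: eq)
qed

theorem existence:
  "\<exists>x. abs_cont_on 0 T x \<and> x 0 = x0 \<and>
       (AE t in lebesgue_on {0..T}.
          integrable (lebesgue_on {0..t}) (\<lambda>s. g t s (x s)) \<and>
          (\<exists>x'. (x has_vector_derivative x') (at t within {0..T}) \<and>
             x' \<in> {- n + f + integral\<^sup>L (lebesgue_on {0..t}) (\<lambda>s. g t s (x s)) | n f.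
                     n \<in> clarke_normal (C t (x t)) (x t) \<and> f \<in> F t (x t)}))"
  (is "\<exists>x. _ \<and> _ \<and> (AE t in _. ?sol x t)")
proof -
  define e where "e n = TL / real (Suc n)" for n
  have e_pos: "0 < e n" for n using TL_pos by (simp add: e_def)
  have e_lim: "e \<longlonglongrightarrow> 0"
    unfolding e_def using tendsto_mult_right_zero[OF LIMSEQ_inverse_real_of_nat, of TL] by (simp add: field_simps)
  have "\<forall>n. \<exists>X Y \<theta> f v. approximation (e n) X Y \<theta> f v"
    by (intro allI approximate_solution[OF zero_less_Suc e_def])
  then have "\<exists>X0 Y0 \<theta>0 f0 v0. \<forall>n. approximation (e n) (X0 n) (Y0 n) (\<theta>0 n) (f0 n) (v0 n)"
    unfolding choice_iff .
  then obtain X0 Y0 \<theta>0 f0 v0 where A': "\<forall>n. approximation (e n) (X0 n) (Y0 n) (\<theta>0 n) (f0 n) (v0 n)"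
    by (elim exE)
  note A = spec[OF A', unfolded approximation_def]
  have ui0: "integrable lebesgue (\<lambda>s. f0 n s + GX (X0 n) s - v0 n s)" for n
    using A[of n] by (intro Bochner_Integration.integrable_add Bochner_Integration.integrable_diff) auto
  \<comment> \<open>Selection, Volterra term and normal contribute BB * m each; hence 3 * BB
    replaces BB in the compactness argument.\<close>
  have ub0: "AE s in lebesgue. norm (f0 n s + GX (X0 n) s - v0 n s) \<le> 3 * BB * m s" for n
  proof -
    have "AE s in lebesgue. norm (f0 n s) \<le> BB * m s \<and> norm (GX (X0 n) s) \<le> BB * m s" using A[of n] by (auto elim: eventually_mono)
    then show ?thesis
    proof eventually_elim
      case (elim s)
      have v: "norm (v0 n s) \<le> BB * m s" using A[of n] by blast
      show ?case
        using norm_triangle_ineq4[of "f0 n s + GX (X0 n) s" "v0 n s"] norm_triangle_ineq[of "f0 n s" "GX (X0 n) s"] elim v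
        by linarith
    qed
  qed
  have equi: "norm (X0 n t - X0 n s) \<le> (3 * BB) * (\<Lambda> t - \<Lambda> s) + 2 * (3 * BB) * e n" if st: "0 \<le> s" "s \<le> t" "t \<le> T" for n s t
  proof -
    let ?u = "\<lambda>s. f0 n s + GX (X0 n) s - v0 n s"
    have a: "norm (X0 n r - (x0 + (LINT s:{0..r}|lebesgue. ?u s))) \<le> BB * e n" if "r \<in> {0..T}" for r using A[of n] that by blast
    have "(LINT r:{0..t}|lebesgue. ?u r) = (LINT r:{0..s}|lebesgue. ?u r) + (LINT r:{s..t}|lebesgue. ?u r)"
      by (rule set_integral_interval_split[OF ui0 st(1,2)])
    then have "X0 n t - X0 n s = (X0 n t - (x0 + (LINT s:{0..t}|lebesgue. ?u s))) - (X0 n s - (x0 + (LINT r:{0..s}|lebesgue. ?u r))) + (LINT r:{s..t}|lebesgue. ?u r)"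
      by simp
    then have "norm (X0 n t - X0 n s) \<le> norm (X0 n t - (x0 + (LINT s:{0..t}|lebesgue. ?u s))) + norm (X0 n s - (x0 + (LINT r:{0..s}|lebesgue. ?u r))) + norm (LINT r:{s..t}|lebesgue. ?u r)"
      by (rule norm_le_sum3)
    also have "\<dots> \<le> BB * e n + BB * e n + (3 * BB) * (\<Lambda> t - \<Lambda> s)"
      using st by (intro add_mono a integral_dominated_by_\<Lambda>[OF ui0 ub0]) auto
    also have "\<dots> \<le> (3 * BB) * (\<Lambda> t - \<Lambda> s) + 2 * (3 * BB) * e n"
      using less_imp_le[OF mult_pos_pos[OF e_pos[of n] BB_pos]] by (simp add: algebra_simps)
    finally show ?thesis .
  qed
  have BB3: "BB \<le> 3 * BB" using BB_pos by simp
  obtain \<rho> where \<rho>: "strict_mono \<rho>" "\<And>t. t \<in> {0..T} \<Longrightarrow> convergent (\<lambda>n. X0 (\<rho> n) t)"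
  proof (rule convergent_subsequence[of X0 "3 * BB" \<theta>0 e Y0])
    show "norm (X0 n t) \<le> 3 * BB" for n t using A[of n] BB3 by (meson order_trans)
    show "\<theta>0 n t \<in> {0..T} \<and> \<bar>\<zeta> (\<theta>0 n t) - \<zeta> t\<bar> \<le> e n" if "t \<in> {0..T}" for n t using A[of n] that by blast
    show "Y0 n t \<in> C (\<theta>0 n t) (X0 n t) \<and> norm (Y0 n t - X0 n t) \<le> (3 * BB) * e n" if "t \<in> {0..T}" for n t
    proof -
      have "BB * e n \<le> (3 * BB) * e n" using BB3 e_pos[of n] by (intro mult_right_mono) auto
      then show ?thesis using A[of n] that by (meson order_trans)
    qed
  qed (use e_lim equi in auto)
  define X where "X n = X0 (\<rho> n)" for n
  define Y where "Y n = Y0 (\<rho> n)" for n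
  define \<theta> where "\<theta> n = \<theta>0 (\<rho> n)" for n
  define f where "f n = f0 (\<rho> n)" for n
  define v where "v n = v0 (\<rho> n)" for n
  define \<eta> where "\<eta> n = e (\<rho> n)" for n
  have \<eta>: "\<eta> \<longlonglongrightarrow> 0" unfolding \<eta>_def using LIMSEQ_subseq_LIMSEQ[OF e_lim \<rho>(1)] by (simp add: o_def)
  have Xb: "norm (X n t) \<le> BB" for n t using A[of "\<rho> n"] by (simp add: X_def)
  have vb: "norm (v n t) \<le> BB * m t" for n t using A[of "\<rho> n"] by (simp add: v_def)
  have pt: "\<theta> n t \<in> {0..T}" "\<bar>\<zeta> (\<theta> n t) - \<zeta> t\<bar> \<le> \<eta> n" "Y n t \<in> C (\<theta> n t) (X n t)" "norm (Y n t - X n t) \<le> BB * \<eta> n"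
    "v n t \<in> clarke_normal (C (\<theta> n t) (X n t)) (Y n t)" "f n t \<in> F t (X n t)" if "t \<in> {0..T}" for n t
    using A[of "\<rho> n"] that by (simp_all add: X_def Y_def \<theta>_def f_def v_def \<eta>_def)
  have fi: "integrable lebesgue (f n)" and vi: "integrable lebesgue (v n)" and Gi: "integrable lebesgue (GX (X n))" for n
    using A[of "\<rho> n"] by (simp_all add: f_def v_def X_def)
  have ae: "AE t in lebesgue. \<forall>n. norm (f n t) \<le> BB * m t \<and> norm (GX (X n) t) \<le> BB * m t \<and> integrable lebesgue (\<lambda>s. g0 t s (X n s))"
    unfolding AE_all_countable
  proof
    fix n show "AE t in lebesgue. norm (f n t) \<le> BB * m t \<and> norm (GX (X n) t) \<le> BB * m t \<and> integrable lebesgue (\<lambda>s. g0 t s (X n s))"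
      using A[of "\<rho> n"] by (simp add: f_def X_def)
  qed
  define u where "u n s = f n s + GX (X n) s - v n s" for n s
  have ui: "integrable lebesgue (u n)" for n unfolding u_def f_def v_def X_def by (rule ui0)
  have ub: "AE s in lebesgue. norm (u n s) \<le> 3 * BB * m s" for n unfolding u_def f_def v_def X_def by (rule ub0)
  have err: "norm (X n t - (x0 + (LINT s:{0..t}|lebesgue. u n s))) \<le> BB * \<eta> n" if "t \<in> {0..T}" for n t
    using A[of "\<rho> n"] that by (simp add: u_def[abs_def] X_def f_def v_def \<eta>_def)
  define x where "x t = lim (\<lambda>n. X n t)" for t
  have Xlim: "(\<lambda>n. X n t) \<longlonglongrightarrow> x t" if "t \<in> {0..T}" for t
    unfolding x_def X_def using \<rho>(2)[OF that] by (rule tendsto_convergent_lim)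
  have Glim: "AE t in lebesgue. integrable lebesgue (\<lambda>s. g0 t s (x s)) \<and> (\<lambda>n. GX (X n) t) \<longlonglongrightarrow> GX x t"
    using ae lebesgue_Fubini(1)[OF \<sigma>0_integrable]
  proof eventually_elim
    case (elim t)
    show ?case using GX_tendsto[of X BB x t, OF Xb Xlim] elim by blast
  qed
  \<comment> \<open>The averaging lemma wants a weight positive everywhere, but m vanishes outside
    [0, T]; the extra 1 is invisible to the restricted measure.\<close>
  define wgt where "wgt t = 2 * BB * m t + (if t \<in> {0..T} then 0 else 1)" for t
  \<comment> \<open>Selections and normals are paired so that the same weights serve both. On the
    null set where the bound on f fails the pair is set to zero, because domination is required at
    every point.\<close>
  define \<phi> where "\<phi> n t = (if norm (f n t) \<le> BB * m t then (f n t, v n t) else 0)" for n t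
  obtain N w where w: "\<And>j. tail_weights j (N j) (w j)"
    and wconv: "AE t in lebesgue_on {0..T}. convergent (\<lambda>j. \<Sum>i<N j. w j i *\<^sub>R \<phi> i t)"
  proof (rule convex_combinations_converge_AE[of \<phi> "lebesgue_on {0..T}" wgt])
    have [measurable]: "f n \<in> borel_measurable lebesgue" "v n \<in> borel_measurable lebesgue" "m \<in> borel_measurable lebesgue" for n
      using fi vi m(1) by auto
    have "\<phi> n \<in> borel_measurable lebesgue" for n unfolding \<phi>_def by measurable
    then show "\<phi> n \<in> borel_measurable (lebesgue_on {0..T})" for n by (rule measurable_restrict_space1)
    have "integrable (lebesgue_on {0..T}) (\<lambda>t. 2 * BB * m t)"
      using m(1) by (subst integrable_restrict_space) (auto simp del: real_scaleR_def intro!: integrable_mult_indicator)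
    then show "integrable (lebesgue_on {0..T}) wgt"
      by (rule Bochner_Integration.integrable_cong[THEN iffD1, rotated 2]) (auto simp: wgt_def)
    show "0 < wgt t" for t
    proof (cases "t \<in> {0..T}")
      case True
      then have "0 < m t" using m(4)[OF True] F3(3)[OF True] Sg_nonneg[of t] by linarith
      then show ?thesis using True BB_pos by (simp add: wgt_def)
    next
      case False
      then show ?thesis using BB_pos m(2)[of t] by (simp add: wgt_def add_nonneg_pos)
    qed
    show "norm (\<phi> n t) \<le> wgt t" for n t
    proof (cases "norm (f n t) \<le> BB * m t")
      case True
      then have "norm (\<phi> n t) \<le> norm (f n t) + norm (v n t)" by (simp add: \<phi>_def norm_Pair_le)
      also have "\<dots> \<le> 2 * BB * m t" using True vb[of n t] by simp
      finally show ?thesis by (simp add: wgt_def)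
    next
      case False
      then show ?thesis using BB_pos m(2)[of t] by (simp add: \<phi>_def wgt_def)
    qed
  qed (rule that)
  define fl where "fl t = lim (\<lambda>j. \<Sum>i<N j. w j i *\<^sub>R f i t)" for t
  define vl where "vl t = lim (\<lambda>j. \<Sum>i<N j. w j i *\<^sub>R v i t)" for t
  \<comment> \<open>A limit of measurable functions, hence measurable; it agrees with the Volterra
    term of x almost everywhere, for which measurability in t is not immediate.\<close>
  define Gl where "Gl t = lim (\<lambda>n. GX (X n) t)" for t
  have flvl: "AE t in lebesgue. t \<in> {0..T} \<longrightarrow>
     (\<lambda>j. \<Sum>i<N j. w j i *\<^sub>R f i t) \<longlonglongrightarrow> fl t \<and> (\<lambda>j. \<Sum>i<N j. w j i *\<^sub>R v i t) \<longlonglongrightarrow> vl t"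
  proof -
    have "AE t in lebesgue. t \<in> {0..T} \<longrightarrow> convergent (\<lambda>j. \<Sum>i<N j. w j i *\<^sub>R \<phi> i t)"
      using wconv by (simp add: AE_restrict_space_iff)
    with ae show ?thesis
    proof eventually_elim
      case (elim t)
      show ?case
      proof
        assume "t \<in> {0..T}"
        then have "convergent (\<lambda>j. \<Sum>i<N j. w j i *\<^sub>R (f i t, v i t))" using elim by (simp add: \<phi>_def)
        then obtain l where l: "(\<lambda>j. \<Sum>i<N j. w j i *\<^sub>R (f i t, v i t)) \<longlonglongrightarrow> l" by (auto simp: convergent_def)
        have "(\<lambda>j. \<Sum>i<N j. w j i *\<^sub>R f i t) \<longlonglongrightarrow> fst l" "(\<lambda>j. \<Sum>i<N j. w j i *\<^sub>R v i t) \<longlonglongrightarrow> snd l"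
          using tendsto_fst[OF l] tendsto_snd[OF l] by (simp_all add: fst_sum snd_sum)
        then show "(\<lambda>j. \<Sum>i<N j. w j i *\<^sub>R f i t) \<longlonglongrightarrow> fl t \<and> (\<lambda>j. \<Sum>i<N j. w j i *\<^sub>R v i t) \<longlonglongrightarrow> vl t"
          unfolding fl_def vl_def by (simp add: limI)
      qed
    qed
  qed
  define U where "U t = indicator {0..T} t *\<^sub>R (fl t + Gl t - vl t)" for t
  have Gl_eq: "AE t in lebesgue. Gl t = GX x t" using Glim by eventually_elim (simp add: Gl_def limI)
  have Um: "U \<in> borel_measurable lebesgue"
  proof -
    have [measurable]: "f n \<in> borel_measurable lebesgue" "v n \<in> borel_measurable lebesgue" "GX (X n) \<in> borel_measurable lebesgue" for n
      using fi vi Gi by auto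
    have [measurable]: "fl \<in> borel_measurable lebesgue" "vl \<in> borel_measurable lebesgue" "Gl \<in> borel_measurable lebesgue"
      unfolding fl_def vl_def Gl_def by (intro borel_measurable_lim_metric; measurable)+
    have "{0..T} \<in> sets lebesgue" by simp
    then show ?thesis unfolding U_def
      by (intro borel_measurable_scaleR borel_measurable_indicator borel_measurable_add borel_measurable_diff) auto
  qed
  define S where "S j s = (\<Sum>i<N j. w j i *\<^sub>R u i s)" for j s
  have Si: "integrable lebesgue (S j)" for j
    unfolding S_def using ui by (intro Bochner_Integration.integrable_sum integrable_scaleR_right)
  have Sb: "AE s in lebesgue. \<forall>j. norm (S j s) \<le> 3 * BB * m s"
  proof -
    have "AE s in lebesgue. \<forall>n. norm (u n s) \<le> 3 * BB * m s" using ub by (simp add: AE_all_countable)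
    then show ?thesis by eventually_elim (auto simp: S_def intro!: tail_weights_norm_le[OF w])
  qed
  have Slim: "AE s in lebesgue. s \<in> {0..T} \<longrightarrow> (\<lambda>j. S j s) \<longlonglongrightarrow> U s"
    using flvl Glim Gl_eq
  proof eventually_elim
    case (elim s)
    show ?case
    proof
      assume s: "s \<in> {0..T}"
      have "(\<lambda>j. \<Sum>i<N j. w j i *\<^sub>R GX (X i) s) \<longlonglongrightarrow> Gl s" using elim by (intro tail_weights_tendsto[OF w]) simp
      then have "(\<lambda>j. (\<Sum>i<N j. w j i *\<^sub>R f i s) + (\<Sum>i<N j. w j i *\<^sub>R GX (X i) s) - (\<Sum>i<N j. w j i *\<^sub>R v i s)) \<longlonglongrightarrow> fl s + Gl s - vl s"
        using elim s by (intro tendsto_add tendsto_diff) auto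
      then show "(\<lambda>j. S j s) \<longlonglongrightarrow> U s" using s by (simp add: S_def u_def sum_scaleR_add_diff U_def)
    qed
  qed
  have Ui: "integrable lebesgue U"
  proof (rule Bochner_Integration.integrable_bound[OF _ Um])
    show "integrable lebesgue (\<lambda>t. 3 * BB * m t)" using m(1) by simp
    show "AE t in lebesgue. norm (U t) \<le> norm (3 * BB * m t)"
      using Slim Sb
    proof eventually_elim
      case (elim t)
      have nn: "0 \<le> 3 * BB * m t" using BB_pos m(2)[of t] by simp
      show ?case
      proof (cases "t \<in> {0..T}")
        case True
        then have "(\<lambda>j. norm (S j t)) \<longlonglongrightarrow> norm (U t)" using elim by (intro tendsto_norm) auto
        then have "norm (U t) \<le> 3 * BB * m t" using elim by (intro LIMSEQ_le_const2) auto
        then show ?thesis using nn by simp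
      next
        case False then show ?thesis using nn by (simp add: U_def)
      qed
    qed
  qed
  have xeq: "x t = x0 + (LINT s:{0..t}|lebesgue. U s)" if t: "t \<in> {0..T}" for t
  proof -
    define a where "a n = x0 + (LINT s:{0..t}|lebesgue. u n s)" for n
    have "(\<lambda>n. norm (X n t - a n)) \<longlonglongrightarrow> 0"
    proof (rule tendsto_sandwich[OF _ _ tendsto_const])
      have "(\<lambda>n. BB * \<eta> n) \<longlonglongrightarrow> BB * 0" by (intro tendsto_intros \<eta>)
      then show "(\<lambda>n. BB * \<eta> n) \<longlonglongrightarrow> 0" by simp
      show "eventually (\<lambda>n. norm (X n t - a n) \<le> BB * \<eta> n) sequentially" using err[OF t] by (simp add: a_def)
    qed auto
    from tendsto_diff[OF Xlim[OF t] tendsto_norm_zero_cancel[OF this]] have "a \<longlonglongrightarrow> x t" by simp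
    \<comment> \<open>The integral curves a n already converge to x t, so their averages do too; for
      these averages the velocities S j converge almost everywhere and dominated convergence
      applies.\<close>
    then have 1: "(\<lambda>j. \<Sum>i<N j. w j i *\<^sub>R a i) \<longlonglongrightarrow> x t" by (rule tail_weights_tendsto[OF w])
    have eq: "(\<Sum>i<N j. w j i *\<^sub>R a i) = x0 + (LINT s:{0..t}|lebesgue. S j s)" for j
    proof -
      have i: "integrable lebesgue (\<lambda>s. indicator {0..t} s *\<^sub>R u i s)" for i using ui by (intro integrable_mult_indicator) auto
      have "(LINT s:{0..t}|lebesgue. S j s) = (LINT s|lebesgue. (\<Sum>i<N j. w j i *\<^sub>R (indicator {0..t} s *\<^sub>R u i s)))"
        unfolding set_lebesgue_integral_def S_def
        by (intro Bochner_Integration.integral_cong refl) (simp add: scaleR_sum_right mult.commute)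
      also have "\<dots> = (\<Sum>i<N j. LINT s|lebesgue. w j i *\<^sub>R (indicator {0..t} s *\<^sub>R u i s))"
        by (intro Bochner_Integration.integral_sum integrable_scaleR_right i)
      also have "\<dots> = (\<Sum>i<N j. w j i *\<^sub>R (LINT s:{0..t}|lebesgue. u i s))"
        unfolding set_lebesgue_integral_def by (simp only: integral_scaleR_right)
      finally have "(LINT s:{0..t}|lebesgue. S j s) = (\<Sum>i<N j. w j i *\<^sub>R (LINT s:{0..t}|lebesgue. u i s))" .
      then show ?thesis using tail_weights_sum_const[OF w, of j x0] by (simp add: a_def scaleR_add_right sum.distrib)
    qed
    have "(\<lambda>j. LINT s:{0..t}|lebesgue. S j s) \<longlonglongrightarrow> (LINT s:{0..t}|lebesgue. U s)"
      unfolding set_lebesgue_integral_def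
    proof (rule integral_dominated_convergence)
      show "(\<lambda>s. indicator {0..t} s *\<^sub>R U s) \<in> borel_measurable lebesgue" using Um by (intro borel_measurable_scaleR borel_measurable_indicator) auto
      show "(\<lambda>s. indicator {0..t} s *\<^sub>R S j s) \<in> borel_measurable lebesgue" for j
        using borel_measurable_integrable[OF Si] by (intro borel_measurable_scaleR borel_measurable_indicator) auto
      show "integrable lebesgue (\<lambda>s. 3 * BB * m s)" using m(1) by simp
      show "AE s in lebesgue. (\<lambda>j. indicat_real {0..t} s *\<^sub>R S j s) \<longlonglongrightarrow> indicat_real {0..t} s *\<^sub>R U s"
        using Slim
      proof eventually_elim
        case (elim s)
        show ?case
        proof (cases "s \<in> {0..t}")
          case True
          then have "s \<in> {0..T}" using t by auto
          then show ?thesis using elim True by simp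
        qed simp
      qed
      show "AE s in lebesgue. norm (indicat_real {0..t} s *\<^sub>R S j s) \<le> 3 * BB * m s" for j
        using Sb
      proof eventually_elim
        case (elim s)
        have "norm (indicat_real {0..t} s *\<^sub>R S j s) \<le> norm (S j s)" by (auto simp: indicator_def)
        then show ?case using elim by (meson order_trans)
      qed
    qed
    then have "(\<lambda>j. x0 + (LINT s:{0..t}|lebesgue. S j s)) \<longlonglongrightarrow> x0 + (LINT s:{0..t}|lebesgue. U s)" by (intro tendsto_intros)
    with 1 show ?thesis unfolding eq by (rule LIMSEQ_unique)
  qed
  show ?thesis
  proof (intro exI[of _ x] conjI)
    show "abs_cont_on 0 T x"
    proof (rule abs_cont_on_dominated[of "\<lambda>s. norm (U s)"])
      show "integrable lebesgue (\<lambda>s. norm (U s))" using Ui by simp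
      fix s t assume st: "0 \<le> s" "s \<le> t" "t \<le> T"
      have "x t - x s = (LINT r:{s..t}|lebesgue. U r)"
        using st set_integral_interval_split[OF Ui st(1,2)] by (simp add: xeq)
      then show "norm (x t - x s) \<le> (LINT r:{s..t}|lebesgue. norm (U r))" using set_integral_norm_le by simp
    qed
    show "x 0 = x0" using xeq[of 0] T_pos set_integral_point_zero[of 0 U] by simp
    have der: "AE t in lebesgue. t \<in> {0..T} \<longrightarrow> (x has_vector_derivative U t) (at t within {0..T})"
      by (rule indefinite_integral_has_vector_derivative[OF Ui]) (rule xeq)
    have usc: "AE t in lebesgue. t \<in> {0..T} \<longrightarrow> usc_weak (F t)" using F2 by (simp add: AE_restrict_space_iff)
    have "AE t in lebesgue. t \<in> {0..T} \<longrightarrow> ?sol x t"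
      using usc Glim Gl_eq flvl der
    proof eventually_elim
      case (elim t)
      show ?case
      proof
        assume t: "t \<in> {0..T}"
        note Ft = F_values[OF t, of "x t"]
        have fF: "fl t \<in> F t (x t)"
          by (rule usc_weak_convex_limit[where xs = "\<lambda>n. X n t" and fs = "\<lambda>n. f n t" and N = N and w = w])
            (use elim t Ft Xlim[OF t] pt(6)[OF t] w in auto)
        \<comment> \<open>At this fixed t the bound BB * m t serves as \<rho>, and the distance
          functions converge because both the time shift in \<zeta> and L times the distance of the
          states tend to zero.\<close>
        have vN: "vl t \<in> clarke_normal (C t (x t)) (x t)"
        proof (rule clarke_normal_convex_limit[OF C2, of "\<lambda>n. (\<theta> n t, X n t)" "C t (x t)" "\<lambda>n. Y n t" "x t" "\<lambda>n. v n t"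
              "BB * m t" N w "vl t"])
          show "(\<theta> n t, X n t) \<in> {0..T} \<times> UNIV" for n using pt(1)[OF t] by simp
          show "(case (\<theta> n t, X n t) of (t, x) \<Rightarrow> C t x) \<noteq> {}" for n using C_values[OF pt(1)[OF t]] by simp
          show "closed (C t (x t))" "C t (x t) \<noteq> {}" using C_values[OF t] by auto
          show "(\<lambda>n. infdist z (case (\<theta> n t, X n t) of (t, x) \<Rightarrow> C t x)) \<longlonglongrightarrow> infdist z (C t (x t))" for z
          proof -
            have "(\<lambda>n. norm (infdist z (C (\<theta> n t) (X n t)) - infdist z (C t (x t)))) \<longlonglongrightarrow> 0"
            proof (rule tendsto_sandwich[OF _ _ tendsto_const])
              have "(\<lambda>n. \<eta> n + L * norm (X n t - x t)) \<longlonglongrightarrow> 0 + L * norm (x t - x t)" by (intro tendsto_intros \<eta> Xlim[OF t])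
              then show "(\<lambda>n. \<eta> n + L * norm (X n t - x t)) \<longlonglongrightarrow> 0" by simp
              have "norm (infdist z (C (\<theta> n t) (X n t)) - infdist z (C t (x t))) \<le> \<eta> n + L * norm (X n t - x t)" for n
                using C1(4)[OF t pt(1)[OF t], where z = z and x = "X n t" and y = "x t", of n] pt(2)[OF t, of n] by simp
              then show "eventually (\<lambda>n. norm (infdist z (C (\<theta> n t) (X n t)) - infdist z (C t (x t))) \<le> \<eta> n + L * norm (X n t - x t)) sequentially"
                by simp
            qed auto
            from LIM_zero_cancel[OF tendsto_norm_zero_cancel[OF this]] show ?thesis by simp
          qed
          show "(\<lambda>n. Y n t) \<longlonglongrightarrow> x t"
          proof -
            have "(\<lambda>n. norm (Y n t - X n t)) \<longlonglongrightarrow> 0"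
            proof (rule tendsto_sandwich[OF _ _ tendsto_const])
              have "(\<lambda>n. BB * \<eta> n) \<longlonglongrightarrow> BB * 0" by (intro tendsto_intros \<eta>)
              then show "(\<lambda>n. BB * \<eta> n) \<longlonglongrightarrow> 0" by simp
              show "eventually (\<lambda>n. norm (Y n t - X n t) \<le> BB * \<eta> n) sequentially" using pt(4)[OF t] by simp
            qed auto
            from tendsto_add[OF tendsto_norm_zero_cancel[OF this] Xlim[OF t]] show ?thesis by simp
          qed
          show "Y n t \<in> (case (\<theta> n t, X n t) of (t, x) \<Rightarrow> C t x)" for n using pt(3)[OF t] by simp
          show "v n t \<in> clarke_normal (case (\<theta> n t, X n t) of (t, x) \<Rightarrow> C t x) (Y n t)" for n using pt(5)[OF t] by simp
          show "norm (v n t) \<le> BB * m t" for n by (rule vb)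
          show "tail_weights j (N j) (w j)" for j by (rule w)
          show "(\<lambda>j. \<Sum>i<N j. w j i *\<^sub>R v i t) \<longlonglongrightarrow> vl t" using elim t by blast
        qed
        have int: "integrable lebesgue (\<lambda>s. g0 t s (x s))" using elim by blast
        have Ut: "U t = - vl t + fl t + integral\<^sup>L (lebesgue_on {0..t}) (\<lambda>s. g t s (x s))"
          using t elim GX_eq_integral(2)[OF t int] by (simp add: U_def)
        have "(x has_vector_derivative U t) (at t within {0..T})" using elim t by blast
        then show "?sol x t"
          using GX_eq_integral(1)[OF t int] Ut fF vN by blast
      qed
    qed
    moreover have "{0..T} \<inter> space lebesgue \<in> sets lebesgue" by simp
    ultimately show "AE t in lebesgue_on {0..T}. ?sol x t"
      by (subst AE_restrict_space_iff)
  qed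
qed

end

section \<open>An isometric copy of class banach\<close>

text \<open>The sort \<open>{real_inner, complete_space}\<close> does not entail the class \<open>banach\<close>, on which most of the
  Bochner integration library rests. The following isometric copy of a Hilbert space is of class \<open>banach\<close>.\<close>

typedef 'a hcopy = "UNIV :: 'a set" morphisms of_copy to_copy by simp

setup_lifting type_definition_hcopy

lemma to_of_copy [simp]: "to_copy (of_copy x) = x" "of_copy (to_copy y) = y"
  by (simp_all add: of_copy_inverse to_copy_inverse)

lemma of_copy_eq_iff [simp]: "of_copy x = of_copy y \<longleftrightarrow> x = y"
  by (rule of_copy_inject)

instantiation hcopy :: (real_vector) real_vector
begin

lift_definition zero_hcopy :: "'a hcopy" is 0 .
lift_definition plus_hcopy :: "'a hcopy \<Rightarrow> 'a hcopy \<Rightarrow> 'a hcopy" is "(+)" .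
lift_definition minus_hcopy :: "'a hcopy \<Rightarrow> 'a hcopy \<Rightarrow> 'a hcopy" is "(-)" .
lift_definition uminus_hcopy :: "'a hcopy \<Rightarrow> 'a hcopy" is uminus .
lift_definition scaleR_hcopy :: "real \<Rightarrow> 'a hcopy \<Rightarrow> 'a hcopy" is scaleR .

instance
  by standard (transfer; simp add: algebra_simps)+

end

instantiation hcopy :: (real_inner) real_inner
begin

lift_definition inner_hcopy :: "'a hcopy \<Rightarrow> 'a hcopy \<Rightarrow> real" is inner .
lift_definition norm_hcopy :: "'a hcopy \<Rightarrow> real" is norm .
lift_definition dist_hcopy :: "'a hcopy \<Rightarrow> 'a hcopy \<Rightarrow> real" is dist .
lift_definition sgn_hcopy :: "'a hcopy \<Rightarrow> 'a hcopy" is sgn .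
definition uniformity_hcopy :: "('a hcopy \<times> 'a hcopy) filter" where
  "uniformity_hcopy = (INF e\<in>{0<..}. principal {(x, y). dist x y < e})"
definition open_hcopy :: "'a hcopy set \<Rightarrow> bool" where
  "open_hcopy U \<longleftrightarrow> (\<forall>x\<in>U. eventually (\<lambda>(x', y). x' = x \<longrightarrow> y \<in> U) uniformity)"

instance
proof
  fix x y z :: "'a hcopy" and a :: real
  show "dist x y = norm (x - y)" by transfer (rule dist_norm)
  show "sgn x = x /\<^sub>R norm x" by transfer (rule sgn_div_norm)
  show "inner x y = inner y x" by transfer (rule inner_commute)
  show "inner (x + y) z = inner x z + inner y z" by transfer (rule inner_add_left)
  show "inner (a *\<^sub>R x) y = a * inner x y" by transfer simp
  show "0 \<le> inner x x" by transfer simp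
  show "inner x x = 0 \<longleftrightarrow> x = 0" by transfer simp
  show "norm x = sqrt (inner x x)" by transfer (rule norm_eq_sqrt_inner)
qed (rule uniformity_hcopy_def open_hcopy_def)+

end

lemma of_copy_simps [simp]:
  "of_copy 0 = 0" "of_copy (x + y) = of_copy x + of_copy y" "of_copy (x - y) = of_copy x - of_copy y"
  "of_copy (- x) = - of_copy x" "of_copy (r *\<^sub>R x) = r *\<^sub>R of_copy x"
  "inner (of_copy x) (of_copy y) = inner x y" "norm (of_copy x) = norm x" "dist (of_copy x) (of_copy y) = dist x y"
  by (simp_all add: zero_hcopy.rep_eq plus_hcopy.rep_eq minus_hcopy.rep_eq uminus_hcopy.rep_eq scaleR_hcopy.rep_eq
      inner_hcopy.rep_eq norm_hcopy.rep_eq dist_hcopy.rep_eq)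

lemma to_copy_simps [simp]:
  fixes x y :: "'a::real_inner"
  shows "to_copy 0 = (0 :: 'a hcopy)" "to_copy (x + y) = to_copy x + to_copy y" "to_copy (x - y) = to_copy x - to_copy y"
  "to_copy (r *\<^sub>R x) = r *\<^sub>R to_copy x"
  "inner (to_copy x) (to_copy y) = inner x y" "norm (to_copy x) = norm x" "dist (to_copy x) (to_copy y) = dist x y"
proof -
  show "to_copy 0 = (0 :: 'a hcopy)" "to_copy (x + y) = to_copy x + to_copy y" "to_copy (x - y) = to_copy x - to_copy y"
    "to_copy (r *\<^sub>R x) = r *\<^sub>R to_copy x"
    by (simp_all flip: of_copy_eq_iff)
  show "inner (to_copy x) (to_copy y) = inner x y" by (simp flip: of_copy_simps(6))
  show "norm (to_copy x) = norm x" by (simp flip: of_copy_simps(7))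
  show "dist (to_copy x) (to_copy y) = dist x y" by (simp flip: of_copy_simps(8))
qed

lemma bounded_linear_of_copy: "bounded_linear (of_copy :: 'a::real_inner hcopy \<Rightarrow> 'a)"
  by (rule bounded_linear_intro[of _ 1]) simp_all

lemma bounded_linear_to_copy: "bounded_linear (to_copy :: 'a::real_inner \<Rightarrow> 'a hcopy)"
  by (rule bounded_linear_intro[of _ 1]) simp_all

lemma continuous_on_of_copy: "continuous_on S (of_copy :: 'a::real_inner hcopy \<Rightarrow> 'a)"
  by (rule linear_continuous_on[OF bounded_linear_of_copy])

lemma continuous_on_to_copy: "continuous_on S (to_copy :: 'a::real_inner \<Rightarrow> 'a hcopy)"
  by (rule linear_continuous_on[OF bounded_linear_to_copy])

lemma mem_to_copy_image [simp]: "x \<in> to_copy ` S \<longleftrightarrow> of_copy x \<in> S"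
  by (metis imageE imageI to_of_copy)

lemma to_copy_image_eq: "to_copy ` S = of_copy -` S"
  by auto

lemma closed_to_copy_image: "closed (S :: 'a::real_inner set) \<Longrightarrow> closed (to_copy ` S)"
  unfolding to_copy_image_eq by (rule closed_vimage) (auto intro: continuous_on_of_copy)

lemma open_to_copy_image: "open (S :: 'a::real_inner set) \<Longrightarrow> open (to_copy ` S)"
  unfolding to_copy_image_eq by (rule open_vimage) (auto intro: continuous_on_of_copy)

lemma open_to_copy_vimage: "open (U :: 'a::real_inner hcopy set) \<Longrightarrow> open (to_copy -` U)"
  by (rule open_vimage) (auto intro: continuous_on_to_copy)

lemma of_copy_tendsto: "X \<longlonglongrightarrow> l \<Longrightarrow> (\<lambda>n. of_copy (X n)) \<longlonglongrightarrow> of_copy (l :: 'a::real_inner hcopy)"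
  by (rule bounded_linear.tendsto[OF bounded_linear_of_copy])

lemma to_copy_tendsto: "X \<longlonglongrightarrow> l \<Longrightarrow> (\<lambda>n. to_copy (X n)) \<longlonglongrightarrow> to_copy (l :: 'a::real_inner)"
  by (rule bounded_linear.tendsto[OF bounded_linear_to_copy])

instance hcopy :: ("{real_inner,complete_space}") complete_space
proof
  fix X :: "nat \<Rightarrow> 'a hcopy" assume "Cauchy X"
  then have "Cauchy (\<lambda>n. of_copy (X n))" unfolding Cauchy_def by simp
  then obtain l where "(\<lambda>n. of_copy (X n)) \<longlonglongrightarrow> l" using Cauchy_convergent convergent_def by blast
  from to_copy_tendsto[OF this] show "convergent X" by (auto simp: convergent_def)
qed

instance hcopy :: ("{real_inner,complete_space}") banach ..

instance hcopy :: ("{real_inner,second_countable_topology}") second_countable_topology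
proof
  obtain B :: "'a set set" where B: "countable B" "topological_basis B" using ex_countable_basis by blast
  have "topological_basis ((`) to_copy ` B)"
  proof (rule topological_basisI)
    show "open U" if "U \<in> (`) to_copy ` B" for U
      using that B(2) by (auto intro: open_to_copy_image topological_basis_open)
    fix U and x :: "'a hcopy" assume U: "open U" "x \<in> U"
    then obtain V where "V \<in> B" "of_copy x \<in> V" "V \<subseteq> to_copy -` U"
      using topological_basisE[OF B(2) open_to_copy_vimage[OF U(1)], of "of_copy x"] by auto
    then show "\<exists>V\<in>(`) to_copy ` B. x \<in> V \<and> V \<subseteq> U" by (intro bexI[of _ "to_copy ` V"]) auto
  qed
  then show "\<exists>B :: 'a hcopy set set. countable B \<and> open = generate_topology B"
    using B(1) topological_basis_imp_subbasis by blast
qed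

section \<open>Transport of the data to the isometric copy\<close>

lemma infdist_to_copy: "infdist z (to_copy ` S) = infdist (of_copy z) (S :: 'a::real_inner set)"
proof -
  have "dist z (to_copy y) = dist (of_copy z) y" for y :: 'a by (metis of_copy_simps(8) to_of_copy(2))
  then show ?thesis by (simp add: infdist_def image_image)
qed

lemma clarke_tangent_to_copy:
  "clarke_tangent (to_copy ` S) (to_copy x) = to_copy ` clarke_tangent S (x :: 'a::real_inner)"
proof -
  have "of_copy h \<in> clarke_tangent S x \<longleftrightarrow> h \<in> clarke_tangent (to_copy ` S) (to_copy x)" for h :: "'a hcopy"
  proof
    assume h: "of_copy h \<in> clarke_tangent S x"
    show "h \<in> clarke_tangent (to_copy ` S) (to_copy x)"
      unfolding clarke_tangent_def mem_Collect_eq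
    proof (intro allI impI)
      fix xs :: "nat \<Rightarrow> 'a hcopy" and ts :: "nat \<Rightarrow> real"
      assume a: "(\<forall>n. xs n \<in> to_copy ` S) \<and> xs \<longlonglongrightarrow> to_copy x \<and> (\<forall>n. ts n > 0) \<and> ts \<longlonglongrightarrow> 0"
      have "(\<forall>n. of_copy (xs n) \<in> S) \<and> (\<lambda>n. of_copy (xs n)) \<longlonglongrightarrow> x \<and> (\<forall>n. ts n > 0) \<and> ts \<longlonglongrightarrow> 0"
        using a of_copy_tendsto[of xs "to_copy x"] by auto
      then obtain hs where hs: "hs \<longlonglongrightarrow> of_copy h" "\<And>n. of_copy (xs n) + ts n *\<^sub>R hs n \<in> S"
        using h[unfolded clarke_tangent_def mem_Collect_eq, rule_format, of "\<lambda>n. of_copy (xs n)" ts] by metis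
      have "(\<lambda>n. to_copy (hs n)) \<longlonglongrightarrow> h" using to_copy_tendsto[OF hs(1)] by simp
      moreover have "xs n + ts n *\<^sub>R to_copy (hs n) \<in> to_copy ` S" for n using hs(2)[of n] by simp
      ultimately show "\<exists>hs. hs \<longlonglongrightarrow> h \<and> (\<forall>n. xs n + ts n *\<^sub>R hs n \<in> to_copy ` S)" by blast
    qed
  next
    assume h: "h \<in> clarke_tangent (to_copy ` S) (to_copy x)"
    show "of_copy h \<in> clarke_tangent S x"
      unfolding clarke_tangent_def mem_Collect_eq
    proof (intro allI impI)
      fix xs :: "nat \<Rightarrow> 'a" and ts :: "nat \<Rightarrow> real"
      assume a: "(\<forall>n. xs n \<in> S) \<and> xs \<longlonglongrightarrow> x \<and> (\<forall>n. ts n > 0) \<and> ts \<longlonglongrightarrow> 0"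
      have "(\<forall>n. to_copy (xs n) \<in> to_copy ` S) \<and> (\<lambda>n. to_copy (xs n)) \<longlonglongrightarrow> to_copy x \<and> (\<forall>n. ts n > 0) \<and> ts \<longlonglongrightarrow> 0"
        using a to_copy_tendsto[of xs x] by auto
      then obtain hs where hs: "hs \<longlonglongrightarrow> h" "\<And>n. to_copy (xs n) + ts n *\<^sub>R hs n \<in> to_copy ` S"
        using h[unfolded clarke_tangent_def mem_Collect_eq, rule_format, of "\<lambda>n. to_copy (xs n)" ts] by metis
      have "xs n + ts n *\<^sub>R of_copy (hs n) \<in> S" for n using hs(2)[of n] by simp
      with of_copy_tendsto[OF hs(1)] show "\<exists>hs. hs \<longlonglongrightarrow> of_copy h \<and> (\<forall>n. xs n + ts n *\<^sub>R hs n \<in> S)" by blast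
    qed
  qed
  then show ?thesis by (intro set_eqI) (simp only: mem_to_copy_image)
qed

lemma clarke_normal_to_copy:
  "v \<in> clarke_normal (to_copy ` S) x \<longleftrightarrow> of_copy v \<in> clarke_normal S (of_copy x :: 'a::real_inner)"
proof -
  have "inner v (to_copy h) = inner (of_copy v) h" for h by (metis of_copy_simps(6) to_of_copy(2))
  moreover have "clarke_tangent (to_copy ` S) x = to_copy ` clarke_tangent S (of_copy x)"
    using clarke_tangent_to_copy[of S "of_copy x"] by simp
  ultimately show ?thesis unfolding clarke_normal_def by (simp del: image_iff)
qed

text \<open>Preimages of subbasic sets are subbasic because \<open>to_copy\<close> preserves inner
  products, and this suffices for continuity into a generated topology.\<close>

lemma openin_weak_topology_vimage_to_copy:
  assumes "openin weak_topology (W :: 'a::real_inner hcopy set)"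
  shows "openin weak_topology (to_copy -` W)"
proof -
  have "continuous_map (weak_topology :: 'a topology) weak_topology (to_copy :: 'a \<Rightarrow> 'a hcopy)"
    unfolding weak_topology_def[where 'a = "'a hcopy"]
  proof (rule continuous_on_generated_topo)
    fix U :: "'a hcopy set" assume "U \<in> {{x. inner x y \<in> U} |y U. open U}"
    then obtain y V where V: "U = {x. inner x y \<in> V}" "open V" by blast
    have "to_copy -` U = {x. inner x (of_copy y) \<in> V}"
    proof -
      have "inner (to_copy x) y = inner x (of_copy y)" for x by (metis of_copy_simps(6) to_of_copy(2))
      then show ?thesis by (auto simp: V)
    qed
    moreover have "openin weak_topology {x. inner x (of_copy y) \<in> V}"
      unfolding weak_topology_def using V(2) by (intro topology_generated_by_Basis CollectI exI[of _ "of_copy y"] exI[of _ V] conjI refl)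
    ultimately show "openin weak_topology (to_copy -` U \<inter> topspace (weak_topology :: 'a topology))"
      by (intro openin_Int openin_topspace) simp
  next
    \<comment> \<open>The generator with y = 0 and U = UNIV is the whole space, so the generators
      cover it.\<close>
    have "\<exists>U\<in>{{x. inner x y \<in> U} |y U. open U}. x \<in> U" for x :: "'a hcopy"
      by (rule bexI[of _ "{x. inner x 0 \<in> UNIV}"]) (auto intro!: exI[of _ 0] exI[of _ UNIV])
    then show "to_copy ` topspace (weak_topology :: 'a topology) \<subseteq> \<Union> {{x :: 'a hcopy. inner x y \<in> U} |y U. open U}" by blast
  qed
  from openin_continuous_map_preimage[OF this assms]
  have "openin weak_topology {x \<in> topspace (weak_topology :: 'a topology). to_copy x \<in> W}" .
  moreover have "topspace (weak_topology :: 'a topology) = UNIV"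
  proof -
    have "{x :: 'a. inner x 0 \<in> UNIV} \<subseteq> topspace weak_topology"
      by (rule openin_subset, unfold weak_topology_def, rule topology_generated_by_Basis) (auto intro!: exI[of _ 0] exI[of _ UNIV])
    then show ?thesis by auto
  qed
  ultimately show ?thesis by (simp add: vimage_def)
qed

lemma usc_weak_to_copy:
  assumes "usc_weak (G :: 'a::real_inner \<Rightarrow> 'a set)"
  shows "usc_weak (\<lambda>v. to_copy ` G (of_copy v))"
  unfolding usc_weak_def
proof (intro allI impI)
  fix v :: "'a hcopy" and W assume W: "openin weak_topology W \<and> to_copy ` G (of_copy v) \<subseteq> W"
  then have "openin weak_topology (to_copy -` W)" "G (of_copy v) \<subseteq> to_copy -` W"
    using openin_weak_topology_vimage_to_copy by auto
  then obtain \<delta> where \<delta>: "\<delta> > 0" "\<And>u. norm (u - of_copy v) < \<delta> \<Longrightarrow> G u \<subseteq> to_copy -` W"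
    using assms unfolding usc_weak_def by blast
  have "to_copy ` G (of_copy u) \<subseteq> W" if "norm (u - v) < \<delta>" for u
  proof -
    have "norm (of_copy u - of_copy v) < \<delta>" using that by (simp flip: of_copy_simps(3))
    from \<delta>(2)[OF this] show ?thesis by blast
  qed
  with \<delta>(1) show "\<exists>\<delta>>0. \<forall>u. norm (u - v) < \<delta> \<longrightarrow> to_copy ` G (of_copy u) \<subseteq> W" by blast
qed

text \<open>The reindexing f is there because the index of the moving set contains the state, which
  is a copied vector as well.\<close>

lemma equi_unif_subsmooth_to_copy:
  assumes "equi_unif_subsmooth E (S :: 'i \<Rightarrow> 'a::real_inner set)"
  shows "equi_unif_subsmooth (f -` E) (\<lambda>i. to_copy ` S (f i))"
  unfolding equi_unif_subsmooth_def
proof (intro allI impI)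
  fix \<epsilon> :: real assume "0 < \<epsilon>"
  then obtain \<delta> where \<delta>: "\<delta> > 0" "\<forall>i\<in>E. \<forall>x1\<in>S i. \<forall>x2\<in>S i. \<forall>v1\<in>clarke_normal (S i) x1 \<inter> cball 0 1. \<forall>v2\<in>clarke_normal (S i) x2 \<inter> cball 0 1.
      norm (x1 - x2) < \<delta> \<longrightarrow> inner (v1 - v2) (x1 - x2) \<ge> - \<epsilon> * norm (x1 - x2)"
    using assms unfolding equi_unif_subsmooth_def by meson
  show "\<exists>\<delta>>0. \<forall>i\<in>f -` E. \<forall>x1\<in>to_copy ` S (f i). \<forall>x2\<in>to_copy ` S (f i). \<forall>v1\<in>clarke_normal (to_copy ` S (f i)) x1 \<inter> cball 0 1.
      \<forall>v2\<in>clarke_normal (to_copy ` S (f i)) x2 \<inter> cball 0 1. norm (x1 - x2) < \<delta> \<longrightarrow> inner (v1 - v2) (x1 - x2) \<ge> - \<epsilon> * norm (x1 - x2)"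
  proof (intro exI[of _ \<delta>] conjI ballI impI \<delta>(1))
    fix i x1 x2 v1 v2
    assume a: "i \<in> f -` E" "x1 \<in> to_copy ` S (f i)" "x2 \<in> to_copy ` S (f i)" "v1 \<in> clarke_normal (to_copy ` S (f i)) x1 \<inter> cball 0 1"
      "v2 \<in> clarke_normal (to_copy ` S (f i)) x2 \<inter> cball 0 1" "norm (x1 - x2) < \<delta>"
    have "norm (of_copy x1 - of_copy x2) < \<delta>" using a(6) by (simp flip: of_copy_simps(3))
    then have "inner (of_copy v1 - of_copy v2) (of_copy x1 - of_copy x2) \<ge> - \<epsilon> * norm (of_copy x1 - of_copy x2)"
      using a \<delta>(2)[rule_format, of "f i" "of_copy x1" "of_copy x2" "of_copy v1" "of_copy v2"]
      by (simp add: clarke_normal_to_copy)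
    then show "inner (v1 - v2) (x1 - x2) \<ge> - \<epsilon> * norm (x1 - x2)" by (simp flip: of_copy_simps(3))
  qed
qed

theorem theorem5p2:
  fixes T :: real
    and F :: "real \<Rightarrow> 'a::{real_inner, complete_space, second_countable_topology} \<Rightarrow> 'a set"
    and g :: "real \<Rightarrow> real \<Rightarrow> 'a \<Rightarrow> 'a"
    and C :: "real \<Rightarrow> 'a \<Rightarrow> 'a set"
    and c d k :: "real \<Rightarrow> real"
    and \<sigma> :: "real \<times> real \<Rightarrow> real"
    and \<zeta> :: "real \<Rightarrow> real"
    and L :: real
    and x0 :: 'a
  assumes T_pos: "T > 0"
    and F_values: "\<And>t v. t \<in> {0..T} \<Longrightarrow> F t v \<noteq> {} \<and> closed (F t v) \<and> convex (F t v)"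
    and F1: "\<And>v. meas_multifun T (\<lambda>t. F t v)"
    and F2: "AE t in lebesgue_on {0..T}. usc_weak (F t)"
    and F3: "integrable (lebesgue_on {0..T}) c" "integrable (lebesgue_on {0..T}) d"
            "\<And>t. t \<in> {0..T} \<Longrightarrow> c t \<ge> 0 \<and> d t \<ge> 0"
            "AE t in lebesgue_on {0..T}. \<forall>v. Inf (norm ` F t v) \<le> c t * norm v + d t"
    and F4: "integrable (lebesgue_on {0..T}) k" "\<And>t. t \<in> {0..T} \<Longrightarrow> k t \<ge> 0"
            "(AE t in lebesgue_on {0..T}. \<forall>A. bounded A \<longrightarrow>
                 kuratowski_mnc (\<Union>a\<in>A. F t a) \<le> ennreal (k t) * kuratowski_mnc A)
             \<or> (AE t in lebesgue_on {0..T}. \<forall>A. bounded A \<longrightarrow>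
                 hausdorff_mnc (\<Union>a\<in>A. F t a) \<le> ennreal (k t) * hausdorff_mnc A)"
    and g1: "\<And>v. (\<lambda>(t, s). g t s v) \<in> borel_measurable (lebesgue_on ({0..T} \<times> {0..T}))"
    and g2: "\<And>r. r > 0 \<Longrightarrow> \<exists>\<mu>. integrable (lebesgue_on {0..T}) \<mu> \<and>
               (\<forall>t\<in>{0..T}. \<mu> t \<ge> 0) \<and>
               (\<forall>t s x y. (t, s) \<in> {(t, s). t \<in> {0..T} \<and> s \<in> {0..T} \<and> s \<le> t} \<and>
                  x \<in> cball 0 r \<and> y \<in> cball 0 r \<longrightarrow>
                  norm (g t s x - g t s y) \<le> \<mu> t * norm (x - y))"
    and g3: "integrable (lebesgue_on {(t, s). t \<in> {0..T} \<and> s \<in> {0..T} \<and> s \<le> t}) \<sigma>"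
            "\<And>t s. (t, s) \<in> {(t, s). t \<in> {0..T} \<and> s \<in> {0..T} \<and> s \<le> t} \<Longrightarrow> \<sigma> (t, s) \<ge> 0"
            "\<And>t s x. (t, s) \<in> {(t, s). t \<in> {0..T} \<and> s \<in> {0..T} \<and> s \<le> t} \<Longrightarrow>
               norm (g t s x) \<le> \<sigma> (t, s) * (1 + norm x)"
    and C_values: "\<And>t x. t \<in> {0..T} \<Longrightarrow> C t x \<noteq> {} \<and> closed (C t x)"
    and C1: "abs_cont_on 0 T \<zeta>" "\<And>t. t \<in> {0..T} \<Longrightarrow> \<zeta> t \<ge> 0" "0 \<le> L" "L < 1"
            "\<And>s t x y z. s \<in> {0..T} \<Longrightarrow> t \<in> {0..T} \<Longrightarrow>
               \<bar>infdist z (C t x) - infdist z (C s y)\<bar> \<le> \<bar>\<zeta> t - \<zeta> s\<bar> + L * norm (x - y)"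
    and C2: "equi_unif_subsmooth ({0..T} \<times> UNIV) (\<lambda>(t, x). C t x)"
    and C3: "\<And>t r A. t \<in> {0..T} \<Longrightarrow> r > 0 \<Longrightarrow> bounded A \<Longrightarrow>
               compact (closure ((\<Union>a\<in>A. C t a) \<inter> cball 0 r))"
    and x0_in: "x0 \<in> C 0 x0"
  shows "\<exists>x :: real \<Rightarrow> 'a. abs_cont_on 0 T x \<and> x 0 = x0 \<and>
           (AE t in lebesgue_on {0..T}.
              integrable (lebesgue_on {0..t}) (\<lambda>s. g t s (x s)) \<and>
              (\<exists>x'. (x has_vector_derivative x') (at t within {0..T}) \<and>
                 x' \<in> {- n + f + integral\<^sup>L (lebesgue_on {0..t}) (\<lambda>s. g t s (x s)) | n f.
                         n \<in> clarke_normal (C t (x t)) (x t) \<and> f \<in> F t (x t)}))"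
proof -
  \<comment> \<open>Both the arguments and the values are copied; the scalar data c, d, \<sigma>,
    \<zeta> and L stay the same, since the copy is isometric.\<close>
  define F' where "F' t v = to_copy ` F t (of_copy v)" for t v
  define g' where "g' t s v = to_copy (g t s (of_copy v))" for t s v
  define C' where "C' t y = to_copy ` C t (of_copy y)" for t y
  interpret copy: sweeping_process T F' g' C' c d \<sigma> \<zeta> L "to_copy x0"
  proof
    fix v :: "'a hcopy"
    show "F' t v \<noteq> {} \<and> closed (F' t v) \<and> convex (F' t v)" if "t \<in> {0..T}" for t
      using F_values[OF that, of "of_copy v"] bounded_linear.linear[OF bounded_linear_to_copy]
      by (auto simp: F'_def intro: closed_to_copy_image convex_linear_image)
    show "meas_multifun T (\<lambda>t. F' t v)"
      unfolding meas_multifun_def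
    proof (intro allI impI)
      fix U :: "'a hcopy set" assume "open U"
      then have "{t \<in> {0..T}. F t (of_copy v) \<inter> to_copy -` U \<noteq> {}} \<in> sets (lebesgue_on {0..T})"
        using F1[of "of_copy v"] open_to_copy_vimage unfolding meas_multifun_def by blast
      moreover have "F' t v \<inter> U \<noteq> {} \<longleftrightarrow> F t (of_copy v) \<inter> to_copy -` U \<noteq> {}" for t
        unfolding F'_def by blast
      ultimately show "{t \<in> {0..T}. F' t v \<inter> U \<noteq> {}} \<in> sets (lebesgue_on {0..T})" by simp
    qed
    have "to_copy \<in> borel_measurable (borel :: 'a measure)"
      by (rule borel_measurable_continuous_onI[OF continuous_on_to_copy])
    from measurable_compose[OF g1[of "of_copy v"] this]
    show "(\<lambda>(t, s). g' t s v) \<in> borel_measurable (lebesgue_on ({0..T} \<times> {0..T}))"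
      by (simp add: g'_def case_prod_beta')
  next
    show "AE t in lebesgue_on {0..T}. usc_weak (F' t)"
      using F2 by eventually_elim (simp add: F'_def[abs_def] usc_weak_to_copy)
    have "norm ` F' t v = norm ` F t (of_copy v)" for t v by (simp add: F'_def image_image)
    then show "AE t in lebesgue_on {0..T}. \<forall>v. Inf (norm ` F' t v) \<le> c t * norm v + d t"
      using F3(4)
    proof (elim eventually_mono)
      fix t assume "\<And>t v. norm ` F' t v = norm ` F t (of_copy v)" "\<forall>v. Inf (norm ` F t v) \<le> c t * norm v + d t"
      then show "\<forall>v. Inf (norm ` F' t v) \<le> c t * norm v + d t"
        using of_copy_simps(7) by metis
    qed
  next
    fix r :: real assume "0 < r"
    then obtain \<mu> where \<mu>: "integrable (lebesgue_on {0..T}) \<mu>" "\<forall>t\<in>{0..T}. \<mu> t \<ge> 0"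
      "\<And>t s x y. (t, s) \<in> {(t, s). t \<in> {0..T} \<and> s \<in> {0..T} \<and> s \<le> t} \<and> x \<in> cball 0 r \<and> y \<in> cball 0 r \<Longrightarrow>
          norm (g t s x - g t s y) \<le> \<mu> t * norm (x - y)"
      using g2[of r] by blast
    have "norm (g' t s x - g' t s y) \<le> \<mu> t * norm (x - y)"
      if "(t, s) \<in> {(t, s). t \<in> {0..T} \<and> s \<in> {0..T} \<and> s \<le> t} \<and> x \<in> cball 0 r \<and> y \<in> cball 0 r" for t s and x y :: "'a hcopy"
      using \<mu>(3)[of t s "of_copy x" "of_copy y"] that
      by (simp add: g'_def flip: to_copy_simps(3) of_copy_simps(3))
    with \<mu> show "\<exists>\<mu>. integrable (lebesgue_on {0..T}) \<mu> \<and> (\<forall>t\<in>{0..T}. \<mu> t \<ge> 0) \<and>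
        (\<forall>t s x y. (t, s) \<in> {(t, s). t \<in> {0..T} \<and> s \<in> {0..T} \<and> s \<le> t} \<and> x \<in> cball 0 r \<and> y \<in> cball 0 r \<longrightarrow>
           norm (g' t s x - g' t s y) \<le> \<mu> t * norm (x - y))"
      by blast
  next
    fix t s and x :: "'a hcopy"
    assume "(t, s) \<in> {(t, s). t \<in> {0..T} \<and> s \<in> {0..T} \<and> s \<le> t}"
    from g3(3)[OF this, of "of_copy x"] show "norm (g' t s x) \<le> \<sigma> (t, s) * (1 + norm x)" by (simp add: g'_def)
  next
    show "C' t x \<noteq> {} \<and> closed (C' t x)" if "t \<in> {0..T}" for t x
      using C_values[OF that] by (auto simp: C'_def intro: closed_to_copy_image)
  next
    fix s t and x y z :: "'a hcopy" assume "s \<in> {0..T}" "t \<in> {0..T}"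
    from C1(5)[OF this, of "of_copy z" "of_copy x" "of_copy y"]
    show "\<bar>infdist z (C' t x) - infdist z (C' s y)\<bar> \<le> \<bar>\<zeta> t - \<zeta> s\<bar> + L * norm (x - y)"
      by (simp add: C'_def infdist_to_copy flip: of_copy_simps(3))
  next
    have "equi_unif_subsmooth (map_prod id of_copy -` ({0..T} \<times> UNIV)) (\<lambda>i. to_copy ` (case map_prod id of_copy i of (t, x) \<Rightarrow> C t x))"
      by (rule equi_unif_subsmooth_to_copy[OF C2])
    moreover have "map_prod id of_copy -` ({0..T} \<times> UNIV) = {0..T} \<times> (UNIV :: 'a hcopy set)" by auto
    moreover have "(\<lambda>i. to_copy ` (case map_prod id of_copy i of (t, x) \<Rightarrow> C t x)) = (\<lambda>(t, x). C' t x)"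
      by (auto simp: C'_def fun_eq_iff)
    ultimately show "equi_unif_subsmooth ({0..T} \<times> UNIV) (\<lambda>(t, x). C' t x)" by simp
  next
    fix t r :: real and A :: "'a hcopy set" assume a: "t \<in> {0..T}" "r > 0" "bounded A"
    define K where "K = closure ((\<Union>a\<in>of_copy ` A. C t a) \<inter> cball 0 r)"
    have "compact K"
      unfolding K_def using a bounded_linear_image[OF a(3) bounded_linear_of_copy] by (intro C3)
    then have K: "compact (to_copy ` K)" by (intro compact_continuous_image continuous_on_to_copy)
    \<comment> \<open>It is enough to place the set inside the continuous image of a compact set;
      the closure is then a closed subset of a compact set.\<close>
    have "(\<Union>a\<in>A. C' t a) \<inter> cball 0 r \<subseteq> to_copy ` K"
    proof
      fix y assume "y \<in> (\<Union>a\<in>A. C' t a) \<inter> cball 0 r"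
      then have "of_copy y \<in> (\<Union>a\<in>of_copy ` A. C t a) \<inter> cball 0 r" by (auto simp: C'_def)
      then have "of_copy y \<in> K" unfolding K_def by (rule subsetD[OF closure_subset])
      then show "y \<in> to_copy ` K" by simp
    qed
    then have "closure ((\<Union>a\<in>A. C' t a) \<inter> cball 0 r) \<subseteq> to_copy ` K"
      using K by (intro closure_minimal) (auto intro: compact_imp_closed)
    then show "compact (closure ((\<Union>a\<in>A. C' t a) \<inter> cball 0 r))"
      using compact_Int_closed[OF K closed_closure] by (metis inf.absorb2)
  next
    show "to_copy x0 \<in> C' 0 (to_copy x0)" using x0_in by (simp add: C'_def)
  qed (use T_pos F3 g3 C1 in auto)
  obtain y where y: "abs_cont_on 0 T y" "y 0 = to_copy x0"
    and sol: "AE t in lebesgue_on {0..T}. integrable (lebesgue_on {0..t}) (\<lambda>s. g' t s (y s)) \<and>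
          (\<exists>x'. (y has_vector_derivative x') (at t within {0..T}) \<and>
             x' \<in> {- n + f + integral\<^sup>L (lebesgue_on {0..t}) (\<lambda>s. g' t s (y s)) | n f.
                     n \<in> clarke_normal (C' t (y t)) (y t) \<and> f \<in> F' t (y t)})"
    using copy.existence by blast
  \<comment> \<open>\<open>of_copy\<close> is a bounded linear isometry: it commutes with
    derivatives and Bochner integrals and preserves normals and increments, so the solution is
    carried back.\<close>
  define x where "x t = of_copy (y t)" for t
  have "abs_cont_on 0 T x"
    using y(1) unfolding abs_cont_on_def x_def by (simp flip: of_copy_simps(3))
  moreover have "x 0 = x0" by (simp add: x_def y)
  moreover have "AE t in lebesgue_on {0..T}. integrable (lebesgue_on {0..t}) (\<lambda>s. g t s (x s)) \<and>
          (\<exists>x'. (x has_vector_derivative x') (at t within {0..T}) \<and>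
             x' \<in> {- n + f + integral\<^sup>L (lebesgue_on {0..t}) (\<lambda>s. g t s (x s)) | n f.
                     n \<in> clarke_normal (C t (x t)) (x t) \<and> f \<in> F t (x t)})"
    using sol
  proof (rule eventually_mono, elim conjE exE)
    fix t y' assume int: "integrable (lebesgue_on {0..t}) (\<lambda>s. g' t s (y s))"
      and der: "(y has_vector_derivative y') (at t within {0..T})"
      and "y' \<in> {- n + f + integral\<^sup>L (lebesgue_on {0..t}) (\<lambda>s. g' t s (y s)) | n f.
                     n \<in> clarke_normal (C' t (y t)) (y t) \<and> f \<in> F' t (y t)}"
    then obtain n f where nf: "y' = - n + f + integral\<^sup>L (lebesgue_on {0..t}) (\<lambda>s. g' t s (y s))"
      "n \<in> clarke_normal (C' t (y t)) (y t)" "f \<in> F' t (y t)" by blast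
    have eq: "(\<lambda>s. of_copy (g' t s (y s))) = (\<lambda>s. g t s (x s))" by (simp add: g'_def x_def)
    have i: "integrable (lebesgue_on {0..t}) (\<lambda>s. g t s (x s))"
      using integrable_bounded_linear[OF bounded_linear_of_copy int] by (simp add: eq)
    have "integral\<^sup>L (lebesgue_on {0..t}) (\<lambda>s. g t s (x s)) = of_copy (integral\<^sup>L (lebesgue_on {0..t}) (\<lambda>s. g' t s (y s)))"
      using integral_bounded_linear[OF bounded_linear_of_copy int] by (simp add: eq)
    then have "of_copy y' = - of_copy n + of_copy f + integral\<^sup>L (lebesgue_on {0..t}) (\<lambda>s. g t s (x s))"
      by (simp add: nf(1))
    moreover have "of_copy n \<in> clarke_normal (C t (x t)) (x t)" "of_copy f \<in> F t (x t)"
      using nf(2,3) by (simp_all add: C'_def F'_def x_def clarke_normal_to_copy)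
    moreover have "(x has_vector_derivative of_copy y') (at t within {0..T})"
      unfolding x_def by (rule bounded_linear.has_vector_derivative[OF bounded_linear_of_copy der])
    ultimately show "integrable (lebesgue_on {0..t}) (\<lambda>s. g t s (x s)) \<and>
          (\<exists>x'. (x has_vector_derivative x') (at t within {0..T}) \<and>
             x' \<in> {- n + f + integral\<^sup>L (lebesgue_on {0..t}) (\<lambda>s. g t s (x s)) | n f.
                     n \<in> clarke_normal (C t (x t)) (x t) \<and> f \<in> F t (x t)})"
      using i by blast
  qed
  ultimately show ?thesis by blast
qed

end
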